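(* For every integer $n\ge0$, the integer $$\begin{aligned}&4(n^{2}+n+14)(n^{3}+n^{2}+15)M_2(n)+(10n^{4}+2n^{3}+8n^{2}+21n+22)M_{4}(n)\\ &+13(n+18)(n^{2}+21n+13)M_{6}(n)+5n(n+6)M_{8}(n)+15(n+19)M_{10}(n)+M_{12}(n)\\ &+12(n+10)(n+14)(n+19)(n+20)(n+21)N_{2}(n)+N_{12}(n)\end{aligned}$$ is congruent modulo $23$ to $(-1)^k$ if $n=\frac{23k(3k\pm1)}{2}+1$ for some integer $k$ and some choice of sign, and is congruent to $0$ modulo $23$ otherwise.
   Context: The rank of a partition is its largest part minus its number of parts. $N(m,n)$ is the number of partitions of $n$ with rank $m$; $N(0,0)=1$ and $N(m,0)=0$ for $m\ne0$. The crank of a partition is its largest part if the partition contains no ones; otherwise it is (the number of parts larger than the number of ones) minus (the number of ones). For $n\ge2$, $M(m,n)$ is the number of partitions of $n$ with crank $m$. By convention $M(0,0)=1$ and $M(m,0)=0$ for $m\neq0$; and $M(0,1)=-1$, $M(-1,1)=M(1,1)=1$, $M(m,1)=0$ otherwise. With these conventions it is known that $\sum_{n\ge0}\sum_m M(m,n)z^mq^n=\prod_{n\ge1}\frac{1-q^n}{(1-zq^n)(1-z^{-1}q^n)}$. For even $j\ge2$ the rank and crank moments are the integers $N_j(n)=\sum_{k\in\mathbb Z}k^jN(k,n)$ and $M_j(n)=\sum_{k\in\mathbb Z}k^jM(k,n)$. *)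

theory Defs
  imports
    "HOL-Library.Multiset"
    "HOL-Library.Groups_Big_Fun"
    "HOL-Number_Theory.Cong"
begin

definition partitions :: "nat \<Rightarrow> nat multiset set" where
  "partitions n = {p. (\<forall>i \<in># p. 0 < i) \<and> \<Sum>\<^sub># p = n}"

text \<open>Rank and crank are meaningful only for nonempty \<open>p\<close>, since \<^const>\<open>Max\<close> of the empty set
  is unspecified. The case of the empty partition is fixed in the counting functions below.\<close>

definition rank :: "nat multiset \<Rightarrow> int" where
  "rank p = int (Max (set_mset p)) - int (size p)"

definition crank :: "nat multiset \<Rightarrow> int" where
  "crank p =
     (if 1 \<notin># p then int (Max (set_mset p))
      else int (size {# i \<in># p. count p 1 < i #}) - int (count p 1))"

definition rank_count :: "int \<Rightarrow> nat \<Rightarrow> int" where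
  "rank_count m n =
     (if n = 0 then (if m = 0 then 1 else 0)
      else int (card {p \<in> partitions n. rank p = m}))"

text \<open>For \<open>n = 1\<close> the values are the coefficients of \<open>q\<close> in the generating function
  \<open>\<Prod>i\<ge>1. (1 - q\<^sup>i) / ((1 - z q\<^sup>i) (1 - z\<^sup>-\<^sup>1 q\<^sup>i))\<close>, not a count of partitions.\<close>

definition crank_count :: "int \<Rightarrow> nat \<Rightarrow> int" where
  "crank_count m n =
     (if n = 0 then (if m = 0 then 1 else 0)
      else if n = 1 then (if m = 0 then -1 else if m = 1 \<or> m = -1 then 1 else 0)
      else int (card {p \<in> partitions n. crank p = m}))"

text \<open>\<^const>\<open>Sum_any\<close> sums over the support of its argument, which is finite in both cases below,
  see \<open>finite_support_rank_count\<close> and \<open>finite_support_crank_count\<close>.\<close>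

definition rank_moment :: "nat \<Rightarrow> nat \<Rightarrow> int" where
  "rank_moment j n = Sum_any (\<lambda>k. k ^ j * rank_count k n)"

definition crank_moment :: "nat \<Rightarrow> nat \<Rightarrow> int" where
  "crank_moment j n = Sum_any (\<lambda>k. k ^ j * crank_count k n)"

lemma finite_partitions: "finite (partitions n)"
proof (rule finite_subset)
  show "partitions n \<subseteq> mset ` {xs. set xs \<subseteq> {..n} \<and> length xs \<le> n}"
  proof
    fix p assume "p \<in> partitions n"
    then have pos: "\<forall>i \<in># p. 0 < i" and sum: "\<Sum>\<^sub># p = n"
      by (auto simp: partitions_def)
    obtain xs where xs: "mset xs = p"
      using ex_mset by blast
    have "set xs \<subseteq> {..n}"
      using sum xs member_le_sum_list[of _ xs] by (auto simp flip: sum_mset_sum_list)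
    moreover have "(\<forall>i \<in> set ys. 0 < i) \<Longrightarrow> length ys \<le> sum_list ys" for ys :: "nat list"
      by (induction ys) auto
    then have "length xs \<le> n"
      using pos sum xs by (auto simp flip: sum_mset_sum_list)
    ultimately show "p \<in> mset ` {xs. set xs \<subseteq> {..n} \<and> length xs \<le> n}"
      using xs by blast
  qed
  show "finite (mset ` {xs. set xs \<subseteq> {..n} \<and> length xs \<le> n})"
    by (intro finite_imageI finite_lists_length_le) simp
qed

lemma finite_support_rank_count: "finite {k. k ^ j * rank_count k n \<noteq> 0}"
proof (rule finite_subset)
  show "{k. k ^ j * rank_count k n \<noteq> 0} \<subseteq> insert 0 (rank ` partitions n)"
    by (auto simp: rank_count_def card_eq_0_iff split: if_splits)
qed (simp add: finite_partitions)

lemma finite_support_crank_count: "finite {k. k ^ j * crank_count k n \<noteq> 0}"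
proof (rule finite_subset)
  show "{k. k ^ j * crank_count k n \<noteq> 0} \<subseteq> {-1, 0, 1} \<union> crank ` partitions n"
    by (auto simp: crank_count_def card_eq_0_iff split: if_splits)
qed (simp add: finite_partitions)

end

theory Submission
  imports
    Defs
    "HOL-Computational_Algebra.Computational_Algebra"
    "HOL-Library.Numeral_Type"
begin

text \<open>
  Both generating functions are treated as power series in \<open>q\<close> over Laurent polynomials in \<open>z\<close>. Applying
  \<open>z d/dz\<close> to the product for the crank gives a recursion that expresses the crank moments through
  \<open>P = \<Sum> p(n) q\<^sup>n\<close> and the divisor sums \<open>\<Phi>\<^sub>k = \<Sum> \<sigma>\<^sub>k(n) q\<^sup>n\<close>. The rank moments satisfy a similar recursion by
  the rank-crank differential equation of Atkin and Garvan, in which the cube of the crank generating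
  function occurs. Expanding the Weierstrass equation and the heat equation at \<open>z = 1\<close> reduces all
  \<open>\<Phi>\<^sub>k\<close> to \<open>\<Phi>\<^sub>1, \<Phi>\<^sub>3, \<Phi>\<^sub>5\<close> and yields Ramanujan's differential equations for the Eisenstein series
  \<open>E\<^sub>2, E\<^sub>4, E\<^sub>6\<close>.

  Multiplication by \<open>n\<close> is the derivation \<open>q d/dq\<close>, so modulo 23 the combination of moments becomes an
  identity between quasimodular forms, and its generating function is \<open>8 P (E\<^sub>4\<^sup>3 - E\<^sub>6\<^sup>2)\<close>. Since
  \<open>P\<^bsup>24\<^esup> (E\<^sub>4\<^sup>3 - E\<^sub>6\<^sup>2) = 1728 q\<close> and \<open>8 \<cdot> 1728 \<equiv> 1\<close>, this is \<open>q\<close> times the 23rd power of \<open>1 / P\<close>. By Euler's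
  pentagonal number theorem \<open>1 / P = \<Sum> (-1)\<^sup>k q\<^bsup>k(3k+1)/2\<^esup>\<close>, and the Frobenius map replaces \<open>q\<close> by \<open>q\<^bsup>23\<^esup>\<close>.
\<close>

section \<open>Partitions, ranks and cranks\<close>

text \<open>The crank series is never expanded as an infinite product. It is determined by two
  symmetries that are proved by bijections: \<open>crank_gf\<close> is invariant under z -> 1/z, and
  \<open>crank_gf / (1 - z)\<close> under z -> q/z.

  The obstacle is the pole at z = 1. As a power series in z the factor 1 / (1 - z) is not symmetric
  under z -> 1/z, so the pole is split off in every argument, and the failure of symmetry is
  computed explicitly. It turns out to depend only on values at z = 1 of a series and its
  derivatives.

  The rank-crank equation leaves the second rank moment undetermined. It expresses each higher even
  rank moment modulo 23 as \<open>P\<close> times a polynomial in E2, E4, E6 plus a combination of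
  the second rank moment and its derivatives under q d/dq. The factor of N_2 in the theorem is a
  polynomial in n that cancels exactly this combination for N_12; only then does a purely
  quasimodular expression remain, which collapses to the discriminant.\<close>

lemma mem_partitions: "p \<in> partitions n \<longleftrightarrow> (\<forall>i\<in>#p. 0 < i) \<and> \<Sum>\<^sub># p = n"
  by (simp add: partitions_def)

lemma partitions_0: "partitions 0 = {{#}}"
proof -
  have "p = {#}" if "\<forall>i\<in>#p. 0 < i" "\<Sum>\<^sub># p = 0" for p :: "nat multiset"
    using that by (cases p) auto
  then show ?thesis by (auto simp: partitions_def)
qed

lemma size_le_sum_mset: "\<forall>i\<in>#p. 0 < i \<Longrightarrow> size p \<le> \<Sum>\<^sub># p" for p :: "nat multiset"
  by (induction p) auto

lemma mem_le_sum_mset: "i \<in># p \<Longrightarrow> i \<le> \<Sum>\<^sub># p" for p :: "nat multiset"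
  by (induction p) auto

section \<open>Removing and adding a column of the Young diagram\<close>

definition dec :: "nat multiset \<Rightarrow> nat multiset" where
  "dec p = {#i \<in># image_mset (\<lambda>i. i - 1) p. 0 < i#}"

text \<open>\<open>dec\<close> deletes the first column of the Young diagram and forgets how many
  parts were 1, so the height \<open>N\<close> of the column to be added has to be supplied.\<close>

definition inc :: "nat \<Rightarrow> nat multiset \<Rightarrow> nat multiset" where
  "inc N p = image_mset Suc p + replicate_mset (N - size p) 1"

lemma dec_pos: "\<forall>i\<in>#dec p. 0 < i"
  by (auto simp: dec_def)

lemma inc_pos: "\<forall>i\<in>#inc N p. 0 < i"
  by (auto simp: inc_def)

lemma size_dec_le: "size (dec p) \<le> size p"
  by (simp add: dec_def) (metis size_filter_mset_lesseq size_image_mset)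

lemma size_inc: "size p \<le> N \<Longrightarrow> size (inc N p) = N"
  by (simp add: inc_def)

lemma sum_dec: "\<forall>i\<in>#p. 0 < i \<Longrightarrow> \<Sum>\<^sub># (dec p) + size p = \<Sum>\<^sub># p"
  by (induction p) (auto simp: dec_def)

lemma sum_inc: "size p \<le> N \<Longrightarrow> \<Sum>\<^sub># (inc N p) = \<Sum>\<^sub># p + N"
proof -
  have "\<Sum>\<^sub># (image_mset Suc p) = \<Sum>\<^sub># p + size p"
    by (induction p) auto
  then show "size p \<le> N \<Longrightarrow> \<Sum>\<^sub># (inc N p) = \<Sum>\<^sub># p + N"
    by (simp add: inc_def sum_mset_replicate_mset)
qed

lemma dec_inc:
  assumes "\<forall>i\<in>#p. 0 < i"
  shows "dec (inc N p) = p"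
proof -
  have "{#i \<in># p. 0 < i#} = p"
    using assms by (simp add: filter_mset_eq_conv)
  then show ?thesis
    by (simp add: dec_def inc_def image_mset.compositionality comp_def)
qed

lemma inc_dec:
  assumes "\<forall>i\<in>#p. 0 < i"
  shows "inc (size p) (dec p) = p"
  using assms
proof (induction p)
  case empty
  then show ?case by (simp add: dec_def inc_def)
next
  case (add x p)
  have IH: "inc (size p) (dec p) = p" using add by simp
  have le: "size (dec p) \<le> size p" by (rule size_dec_le)
  show ?case
  proof (cases "x = 1")
    case True
    then have "dec (add_mset x p) = dec p" by (simp add: dec_def)
    then show ?thesis using IH le True
      by (simp add: inc_def Suc_diff_le)
  next
    case False
    with add.prems have "1 < x" by simp
    then have "dec (add_mset x p) = add_mset (x - 1) (dec p)" by (simp add: dec_def)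
    then show ?thesis using IH le \<open>1 < x\<close>
      by (simp add: inc_def)
  qed
qed

lemma Max_dec_le: "i \<in># dec p \<Longrightarrow> \<exists>j\<in>#p. i = j - 1"
  by (auto simp: dec_def)

lemma card_size_eq:
  "card {p \<in> partitions (n + k). size p = k} = card {p \<in> partitions n. size p \<le> k}"
proof (rule bij_betw_same_card, rule bij_betw_byWitness[where f = dec and f' = "inc k"])
  show "\<forall>p\<in>{p \<in> partitions (n + k). size p = k}. inc k (dec p) = p"
    by (auto simp: mem_partitions inc_dec)
  show "\<forall>p\<in>{p \<in> partitions n. size p \<le> k}. dec (inc k p) = p"
    by (auto simp: mem_partitions dec_inc)
  show "dec ` {p \<in> partitions (n + k). size p = k} \<subseteq> {p \<in> partitions n. size p \<le> k}"
  proof clarify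
    fix p assume p: "p \<in> partitions (n + size p)" "k = size p"
    have "\<Sum>\<^sub># (dec p) + size p = n + size p"
      using p(1) sum_dec[of p] by (simp add: mem_partitions)
    then show "dec p \<in> partitions n \<and> size (dec p) \<le> size p"
      by (simp add: mem_partitions size_dec_le dec_pos)
  qed
  show "inc k ` {p \<in> partitions n. size p \<le> k} \<subseteq> {p \<in> partitions (n + k). size p = k}"
    by (auto simp: mem_partitions size_inc sum_inc inc_pos)
qed

lemma card_Max_eq:
  assumes "0 < k"
  shows "card {p \<in> partitions (n + k). p \<noteq> {#} \<and> Max (set_mset p) = k} =
      card {p \<in> partitions n. \<forall>i\<in>#p. i \<le> k}"
proof (rule bij_betw_same_card,
    rule bij_betw_byWitness[where f = "\<lambda>p. p - {#k#}" and f' = "add_mset k"])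
  show "\<forall>p\<in>{p \<in> partitions (n + k). p \<noteq> {#} \<and> Max (set_mset p) = k}. add_mset k (p - {#k#}) = p"
    by (metis (mono_tags, lifting) Max_in finite_set_mset insert_DiffM mem_Collect_eq set_mset_eq_empty_iff)
  show "\<forall>p\<in>{p \<in> partitions n. \<forall>i\<in>#p. i \<le> k}. add_mset k p - {#k#} = p"
    by simp
  show "(\<lambda>p. p - {#k#}) ` {p \<in> partitions (n + k). p \<noteq> {#} \<and> Max (set_mset p) = k}
    \<subseteq> {p \<in> partitions n. \<forall>i\<in>#p. i \<le> k}"
  proof
    fix q assume "q \<in> (\<lambda>p. p - {#k#}) ` {p \<in> partitions (n + k). p \<noteq> {#} \<and> Max (set_mset p) = k}"
    then obtain p where p: "p \<in> partitions (n + k)" "p \<noteq> {#}" "Max (set_mset p) = k" and q: "q = p - {#k#}"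
      by blast
    have "k \<in># p" using p(2,3) by (metis Max_in finite_set_mset set_mset_eq_empty_iff)
    then have r: "p = add_mset k q" using q by simp
    have "i \<le> k" if "i \<in># q" for i
      using that p(3) r by (metis Max_ge finite_set_mset insertCI set_mset_add_mset_insert)
    moreover have "q \<in> partitions n"
      using p(1) unfolding r by (simp add: mem_partitions)
    ultimately show "q \<in> {p \<in> partitions n. \<forall>i\<in>#p. i \<le> k}" by blast
  qed
  show "add_mset k ` {p \<in> partitions n. \<forall>i\<in>#p. i \<le> k}
    \<subseteq> {p \<in> partitions (n + k). p \<noteq> {#} \<and> Max (set_mset p) = k}"
    using assms by (auto simp: mem_partitions intro!: Max_eqI)
qed

lemma Max_mset_le_iff: "p \<noteq> {#} \<Longrightarrow> Max (set_mset p) \<le> k \<longleftrightarrow> (\<forall>i\<in>#p. i \<le> k)" for k :: nat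
  by simp

text \<open>Conjugation: removing one from every part, or the largest part, leaves a partition of \<open>n - k\<close> with
  at most \<open>k\<close> parts or with parts at most \<open>k\<close>, and the induction hypothesis compares these.\<close>

lemma card_size_eq_card_Max:
  assumes "0 < n"
  shows "card {p \<in> partitions n. size p = k} = card {p \<in> partitions n. Max (set_mset p) = k}"
  using assms
proof (induction n arbitrary: k rule: less_induct)
  case (less n)
  have ne: "p \<noteq> {#}" if "p \<in> partitions n" for p
    using that less.prems by (auto simp: mem_partitions)
  show ?case
  proof (cases "0 < k \<and> k \<le> n")
    case False
    have "{p \<in> partitions n. size p = k} = {}"
    proof -
      have "0 < size p \<and> size p \<le> n" if "p \<in> partitions n" for p
        using ne[OF that] that size_le_sum_mset[of p] by (auto simp: mem_partitions nonempty_has_size)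
      then show ?thesis using False by blast
    qed
    moreover have "{p \<in> partitions n. Max (set_mset p) = k} = {}"
    proof -
      have "0 < Max (set_mset p) \<and> Max (set_mset p) \<le> n" if "p \<in> partitions n" for p
        using ne[OF that] that Max_in[of "set_mset p"] mem_le_sum_mset by (auto simp: mem_partitions)
      then show ?thesis using False by blast
    qed
    ultimately show ?thesis by (simp only:)
  next
    case True
    then obtain m where m: "n = m + k" by (metis le_add_diff_inverse2)
    have "card {p \<in> partitions m. size p \<le> k} = card {p \<in> partitions m. \<forall>i\<in>#p. i \<le> k}"
    proof (cases "m = 0")
      case True
      have "{p. p = {#} \<and> size p \<le> k} = {p. p = {#} \<and> (\<forall>i\<in>#p. i \<le> k)}" by auto
      then show ?thesis using True by (simp add: partitions_0)
    next
      case False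
      have "card {p \<in> partitions m. size p \<le> k} = (\<Sum>j\<le>k. card {p \<in> partitions m. size p = j})"
        by (subst card_UN_disjoint[symmetric])
           (auto simp: finite_partitions intro!: arg_cong[where f=card])
      also have "\<dots> = (\<Sum>j\<le>k. card {p \<in> partitions m. Max (set_mset p) = j})"
        using m True False by (intro sum.cong refl less.IH) auto
      also have "\<dots> = card {p \<in> partitions m. Max (set_mset p) \<le> k}"
        by (subst card_UN_disjoint[symmetric])
           (auto simp: finite_partitions intro!: arg_cong[where f=card])
      also have "{p \<in> partitions m. Max (set_mset p) \<le> k} = {p \<in> partitions m. \<forall>i\<in>#p. i \<le> k}"
      proof (intro Collect_cong conj_cong refl Max_mset_le_iff)
        show "p \<noteq> {#}" if "p \<in> partitions m" for p
          using that False by (auto simp: mem_partitions)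
      qed
      finally show ?thesis .
    qed
    moreover have "{p \<in> partitions n. Max (set_mset p) = k} =
        {p \<in> partitions n. p \<noteq> {#} \<and> Max (set_mset p) = k}"
      using ne by auto
    ultimately show ?thesis
      using card_size_eq[of m k] card_Max_eq[of k m] True m by simp
  qed
qed

section \<open>Conjugate sequences\<close>

definition parts_above :: "nat \<Rightarrow> nat multiset \<Rightarrow> nat" where
  "parts_above t p = size {#i \<in># p. t < i#}"

lemma above_empty [simp]: "parts_above t {#} = 0"
  by (simp add: parts_above_def)

lemma above_add [simp]: "parts_above t (add_mset i p) = parts_above t p + (if t < i then 1 else 0)"
  by (simp add: parts_above_def)

lemma above_union [simp]: "parts_above t (p + q) = parts_above t p + parts_above t q"
  by (simp add: parts_above_def)

lemma above_replicate [simp]: "parts_above t (replicate_mset k i) = (if t < i then k else 0)"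
  by (induction k) auto

lemma above_Suc: "parts_above t p = parts_above (Suc t) p + count p (Suc t)"
  by (induction p) auto

lemma above_antimono: "antimono (\<lambda>t. parts_above t p)"
proof (rule antimonoI)
  fix x y :: nat assume "x \<le> y"
  have "parts_above (Suc t) p \<le> parts_above t p" for t
    using above_Suc[of t p] by simp
  then show "parts_above y p \<le> parts_above x p"
    using \<open>x \<le> y\<close> by (rule lift_Suc_antimono_le)
qed

lemma above_0: "\<forall>i\<in>#p. 0 < i \<Longrightarrow> parts_above 0 p = size p"
  by (induction p) auto

lemma above_eq_0: "\<forall>i\<in>#p. i \<le> t \<Longrightarrow> parts_above t p = 0"
  by (induction p) auto

lemma sum_above: "\<forall>i\<in>#p. i \<le> N \<Longrightarrow> (\<Sum>t<N. parts_above t p) = \<Sum>\<^sub># p"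
proof (induction p)
  case (add i p)
  have "(\<Sum>t<N. if t < i then 1 else (0::nat)) = card ({..<N} \<inter> {t. t < i})"
    by (simp add: sum.If_cases)
  also have "{..<N} \<inter> {t. t < i} = {..<i}" using add.prems by auto
  finally show ?case using add by (simp add: sum.distrib)
qed simp

text \<open>The sequence \<^term>\<open>\<lambda>t. parts_above t p\<close> is the conjugate of \<open>p\<close>.\<close>

definition conjugates :: "nat \<Rightarrow> nat \<Rightarrow> (nat \<Rightarrow> nat) set" where
  "conjugates N n = {g. antimono g \<and> (\<forall>t\<ge>N. g t = 0) \<and> (\<Sum>t<N. g t) = n}"

text \<open>The partition is recovered from \<open>g\<close> by taking the part \<open>Suc t\<close>
  with multiplicity \<open>g t - g (Suc t)\<close>. Any bound \<open>N\<close> from \<open>n\<close>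
  on is allowed, because \<open>vcount_rec\<close> compares sequences of lengths
  \<open>Suc N\<close> and \<open>N\<close>.\<close>

lemma bij_betw_conjugates:
  assumes "n \<le> N"
  shows "bij_betw (\<lambda>p t. parts_above t p) (partitions n) (conjugates N n)"
proof (rule bij_betw_imageI)
  show "inj_on (\<lambda>p t. parts_above t p) (partitions n)"
  proof (rule inj_onI)
    fix p r assume pr: "p \<in> partitions n" "r \<in> partitions n" and eq: "(\<lambda>t. parts_above t p) =
        (\<lambda>t. parts_above t r)"
    show "p = r"
    proof (rule multiset_eqI)
      fix i
      show "count p i = count r i"
      proof (cases i)
        case 0
        have "0 \<notin># p" "0 \<notin># r" using pr by (auto simp: mem_partitions)
        then show ?thesis using 0 by (simp add: not_in_iff)
      next
        case (Suc t)
        then show ?thesis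
          using above_Suc[of t p] above_Suc[of t r] fun_cong[OF eq, of t] fun_cong[OF eq, of "Suc t"] by simp
      qed
    qed
  qed
  show "(\<lambda>p t. parts_above t p) ` partitions n = conjugates N n"
  proof (intro equalityI subsetI)
    fix g assume "g \<in> (\<lambda>p t. parts_above t p) ` partitions n"
    then obtain p where p: "p \<in> partitions n" "g = (\<lambda>t. parts_above t p)" by auto
    have le: "\<forall>i\<in>#p. i \<le> N" and sum: "\<Sum>\<^sub># p = n"
      using p(1) assms mem_le_sum_mset[of _ p] by (auto simp: mem_partitions intro: order_trans)
    have "parts_above t p = 0" if "N \<le> t" for t
      using le that by (intro above_eq_0) (auto intro: order_trans)
    then show "g \<in> conjugates N n"
      using above_antimono[of p] sum_above[OF le] sum unfolding p(2) conjugates_def by simp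
  next
    fix g assume g: "g \<in> conjugates N n"
    have anti: "antimono g" and z: "\<And>t. N \<le> t \<Longrightarrow> g t = 0" and sum: "(\<Sum>t<N. g t) = n"
      using g by (auto simp: conjugates_def)
    define p where "p = (\<Sum>t<N. replicate_mset (g t - g (Suc t)) (Suc t))"
    have ab: "parts_above s p = g s" for s
    proof -
      have hom: "parts_above s (\<Sum>t\<in>A. f t) = (\<Sum>t\<in>A. parts_above s (f t))" if "finite A" for A :: "nat set" and f
        using that by (induction A) auto
      have "parts_above s p = (\<Sum>t<N. if s \<le> t then g t - g (Suc t) else 0)"
        unfolding p_def by (subst hom) (auto intro!: sum.cong)
      also have "\<dots> = (\<Sum>t\<in>{s..<N}. g t - g (Suc t))"
        by (simp add: sum.If_cases) (rule sum.cong, auto)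
      also have "\<dots> = g s"
      proof (cases "s \<le> N")
        case True
        have "(\<Sum>t\<in>{s..<N}. g t - g (Suc t)) = g s - g N"
          using True
        proof (induction N rule: dec_induct)
          case (step m)
          have "g (Suc m) \<le> g m" "g m \<le> g s" using anti step by (auto simp: antimono_def)
          then show ?case using step by simp
        qed simp
        then show ?thesis using z by simp
      qed (simp add: z)
      finally show ?thesis .
    qed
    have mem: "i \<in># p \<Longrightarrow> 0 < i \<and> i \<le> N" for i
      unfolding p_def by (auto simp: set_mset_sum split: if_splits)
    then have "\<Sum>\<^sub># p = n"
      using sum_above[of p N] ab sum by simp
    with mem have "p \<in> partitions n"
      by (simp add: mem_partitions)
    moreover have "g = (\<lambda>t. parts_above t p)" using ab by auto
    ultimately show "g \<in> (\<lambda>p t. parts_above t p) ` partitions n" by blast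
  qed
qed

lemma card_partitions_above:
  assumes "n \<le> N"
  shows "card {p \<in> partitions n. R (\<lambda>t. parts_above t p)} = card {g \<in> conjugates N n. R g}"
proof -
  have "bij_betw (\<lambda>p t. parts_above t p) {p \<in> partitions n. R (\<lambda>t. parts_above t p)} {g \<in> conjugates N n. R g}"
    using bij_betw_conjugates[OF assms]
    by (auto simp: bij_betw_def inj_on_def)
  then show ?thesis by (rule bij_betw_same_card)
qed

section \<open>Partitions attaining a given value of \<open>parts_above t p - t\<close>\<close>

lemma antimono_fixed_unique:
  assumes "antimono g" "int (g t) = int t + k" "int (g s) = int s + k"
  shows "t = s"
proof (rule ccontr)
  assume "t \<noteq> s"
  then consider "t < s" | "s < t" by linarith
  then show False
    using antimonoD[OF assms(1), of t s] antimonoD[OF assms(1), of s t] assms(2,3) by cases auto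
qed

text \<open>The difference \<open>parts_above t p - t\<close> is strictly decreasing in
  \<open>t\<close>, so at most one \<open>t\<close> qualifies. The count turns out to be the sum of
  \<open>crank_count m n\<close> over \<open>m \<ge> k\<close> (see \<open>crank_count_eq\<close>),
  but in this form it has recursions that the crank itself does not show.\<close>

definition vcount :: "int \<Rightarrow> nat \<Rightarrow> nat" where
  "vcount k n = card {p \<in> partitions n. \<exists>t. int (parts_above t p) = int t + k}"

lemma vcount_eq_0:
  assumes "int n < k"
  shows "vcount k n = 0"
proof -
  have "\<not> int (parts_above t p) = int t + k" if "p \<in> partitions n" for p t
  proof -
    have "parts_above t p \<le> size p" by (simp add: parts_above_def size_filter_mset_lesseq)
    also have "\<dots> \<le> n" using that size_le_sum_mset by (auto simp: mem_partitions)
    finally show ?thesis using assms by linarith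
  qed
  then show ?thesis by (auto simp: vcount_def card_eq_0_iff)
qed

text \<open>Deleting the entry \<open>g t = t + k\<close> of the conjugate sequence and adding 1 to the earlier entries
  yields a sequence without an entry \<open>g t = t + k + 1\<close>; all such sequences arise once.\<close>

lemma vcount_rec:
  assumes nm: "int n = int m + k"
  shows "vcount k n + vcount (k + 1) m = card (partitions m)"
proof -
  \<comment> \<open>Large enough that both sets describe all partitions, that a matching entry lies
    inside the window, and that the search in \<open>h\<close> succeeds.\<close>
  define N where "N = n + m + nat \<bar>k\<bar> + 1"
  let ?A = "{g \<in> conjugates (Suc N) n. \<exists>t. int (g t) = int t + k}"
  let ?B = "{g \<in> conjugates N m. \<not> (\<exists>t. int (g t) = int t + (k + 1))}"
  define del where "del = (\<lambda>(g::nat\<Rightarrow>nat) s t. if t < s then g t + 1 else g (Suc t))"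
  define ins where "ins = (\<lambda>(g::nat\<Rightarrow>nat) s t. if t < s then g t - 1 else if t =
      s then nat (int s + k) else g (t - 1))"
  define f where "f = (\<lambda>g. del g (SOME t. int (g t) = int t + k))"
  \<comment> \<open>In an image under \<open>f\<close>, the entries before the deleted position
    exceed \<open>t + k\<close> and the later ones do not, so the least such \<open>t\<close>
    recovers the position.\<close>
  define h where "h = (\<lambda>g. ins g (LEAST t. int (g t) \<le> int t + k))"
  have f: "f g \<in> ?B \<and> h (f g) = g" if g: "g \<in> ?A" for g
  proof -
    define s where "s = (SOME t. int (g t) = int t + k)"
    have s: "int (g s) = int s + k" unfolding s_def using g by (metis (mono_tags, lifting) mem_Collect_eq someI_ex)
    have fg: "f g = del g s" by (simp add: f_def s_def)
    have anti: "g y \<le> g x" if "x \<le> y" for x y using g that by (auto simp: conjugates_def antimono_def)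
    have z: "\<And>t. Suc N \<le> t \<Longrightarrow> g t = 0" and sum: "(\<Sum>t<Suc N. g t) = n"
      using g unfolding conjugates_def by auto
    have sN: "s < Suc N"
    proof (rule ccontr)
      assume "\<not> ?thesis"
      then show False using s z[of s] by (auto simp: N_def)
    qed
    have "antimono (del g s)"
    proof (rule antimonoI)
      fix x y :: nat assume "x \<le> y"
      then show "del g s y \<le> del g s x"
        using anti[of x y] anti[of "Suc x" "Suc y"] anti[of x "Suc y"] by (simp add: del_def)
    qed
    moreover have "s \<le> N" using sN by simp
    moreover have "(\<Sum>t<N. del g s t) = m"
    proof -
      have "(\<Sum>t<N. del g s t) = (\<Sum>t<s. del g s t) + (\<Sum>t=s..<N. del g s t)"
        using \<open>s \<le> N\<close> by (metis lessThan_atLeast0 sum.atLeastLessThan_concat zero_le)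
      also have "(\<Sum>t<s. del g s t) = (\<Sum>t<s. g t) + s"
        by (simp add: del_def sum_Suc)
      also have "(\<Sum>t=s..<N. del g s t) = (\<Sum>t=Suc s..<Suc N. g t)"
        by (subst sum.shift_bounds_Suc_ivl) (auto simp: del_def)
      finally have 1: "(\<Sum>t<N. del g s t) = (\<Sum>t<s. g t) + (\<Sum>t=Suc s..<Suc N. g t) + s" by simp
      have "n = (\<Sum>t<s. g t) + (\<Sum>t=s..<Suc N. g t)"
        using sN sum by (metis lessThan_atLeast0 less_or_eq_imp_le sum.atLeastLessThan_concat zero_le)
      also have "(\<Sum>t=s..<Suc N. g t) = g s + (\<Sum>t=Suc s..<Suc N. g t)"
        using sN by (rule sum.atLeast_Suc_lessThan)
      finally show ?thesis using 1 s nm by linarith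
    qed
    moreover have "del g s t = 0" if "N \<le> t" for t
      using that \<open>s \<le> N\<close> z by (auto simp: del_def)
    moreover have "int (del g s t) \<noteq> int t + (k + 1)" for t
      using anti[of t s] anti[of s "Suc t"] s by (auto simp: del_def)
    ultimately have B: "f g \<in> ?B" by (auto simp: fg conjugates_def)
    have "(LEAST t. int (del g s t) \<le> int t + k) = s"
    proof (rule Least_equality)
      show "int (del g s s) \<le> int s + k" using anti[of s "Suc s"] s by (simp add: del_def)
      show "s \<le> y" if "int (del g s y) \<le> int y + k" for y
        using that anti[of y s] s by (cases "y < s") (auto simp: del_def)
    qed
    then have "h (f g) = ins (del g s) s" by (simp add: h_def fg)
    also have "\<dots> = g"
    proof
      fix t show "ins (del g s) s t = g t" using s by (auto simp: ins_def del_def)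
    qed
    finally show ?thesis using B by blast
  qed
  have h: "h g \<in> ?A \<and> f (h g) = g" if g: "g \<in> ?B" for g
  proof -
    have anti: "g y \<le> g x" if "x \<le> y" for x y using g that by (auto simp: conjugates_def antimono_def)
    have z: "\<And>t. N \<le> t \<Longrightarrow> g t = 0" and sum: "(\<Sum>t<N. g t) = m"
      using g unfolding conjugates_def by auto
    have nofix: "int (g t) \<noteq> int t + (k + 1)" for t using g by blast
    define s where "s = (LEAST t. int (g t) \<le> int t + k)"
    have ex: "int (g N) \<le> int N + k" using z[of N] by (simp add: N_def)
    have s: "int (g s) \<le> int s + k" and sN: "s \<le> N"
      unfolding s_def using ex by (rule LeastI) (use ex in \<open>rule Least_le\<close>)
    \<comment> \<open>This uses that the value \<open>t + k + 1\<close> is excluded: after 1 is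
      subtracted, the entries before \<open>s\<close> are still at least \<open>s + k\<close>, the
      inserted entry.\<close>
    have less: "int (g t) \<ge> int t + k + 2" if "t < s" for t
      using not_less_Least[of t "\<lambda>t. int (g t) \<le> int t + k"] that nofix[of t] unfolding s_def by force
    have hg: "h g = ins g s" by (simp add: h_def s_def)
    have sk: "int s + k \<ge> 0" using s by linarith
    have gs: "int (ins g s s) = int s + k" using sk by (simp add: ins_def)
    have bef: "int (ins g s t) = int (g t) - 1 \<and> int (g t) - 1 \<ge> int s + k" if "t < s" for t
    proof -
      have "int (g t) \<ge> int s + k + 1"
      proof -
        have "g (s - 1) \<le> g t" using that by (intro anti) simp
        then show ?thesis using less[of "s - 1"] that by simp
      qed
      then show ?thesis using that sk by (simp add: ins_def)
    qed
    have aft: "ins g s t = g (t - 1) \<and> int (g (t - 1)) \<le> int s + k" if "s < t" for t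
    proof -
      have "g (t - 1) \<le> g s" using that by (intro anti) simp
      then show ?thesis using that s by (auto simp: ins_def)
    qed
    have "antimono (ins g s)"
    proof (rule antimonoI)
      fix x y :: nat assume "x \<le> y"
      then consider "y < s" "x < s" | "x < s" "s < y" | "s < x" "s < y" | "x = s" "s < y" | "x < s" "y = s" | "x = y"
        by linarith
      then show "ins g s y \<le> ins g s x"
      proof cases
        case 1
        then show ?thesis using bef[of x] bef[of y] anti[OF \<open>x \<le> y\<close>] by linarith
      next
        case 2
        then show ?thesis using bef[of x] aft[of y] by linarith
      next
        case 3
        then show ?thesis using aft[of x] aft[of y] anti[of "x - 1" "y - 1"] \<open>x \<le> y\<close> by auto
      next
        case 4
        then show ?thesis using aft[of y] gs by auto
      next
        case 5
        then show ?thesis using bef[of x] gs by auto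
      qed simp
    qed
    moreover have "(\<Sum>t<Suc N. ins g s t) = n"
    proof -
      have "(\<Sum>t<Suc N. ins g s t) = (\<Sum>t<s. ins g s t) + (\<Sum>t=s..<Suc N. ins g s t)"
        using sN by (metis le_SucI lessThan_atLeast0 sum.atLeastLessThan_concat zero_le)
      also have "(\<Sum>t=s..<Suc N. ins g s t) = ins g s s + (\<Sum>t=Suc s..<Suc N. ins g s t)"
        using sN by (intro sum.atLeast_Suc_lessThan) simp
      also have "(\<Sum>t=Suc s..<Suc N. ins g s t) = (\<Sum>t=s..<N. g t)"
        by (subst sum.shift_bounds_Suc_ivl) (auto simp: ins_def)
      finally have 1: "int (\<Sum>t<Suc N. ins g s t) = (\<Sum>t<s. int (ins g s t)) + (int s + k) +
          (\<Sum>t=s..<N. int (g t))"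
        using gs by simp
      have "(\<Sum>t<s. int (ins g s t)) = (\<Sum>t<s. int (g t) - 1)"
        using bef by (intro sum.cong) auto
      also have "\<dots> = (\<Sum>t<s. int (g t)) - int s" by (simp add: sum_subtractf)
      finally have 2: "int (\<Sum>t<Suc N. ins g s t) = (\<Sum>t<s. int (g t)) + (\<Sum>t=s..<N. int (g t)) + k"
        using 1 by simp
      have "(\<Sum>t<s. int (g t)) + (\<Sum>t=s..<N. int (g t)) = (\<Sum>t<N. int (g t))"
        using sN by (metis lessThan_atLeast0 sum.atLeastLessThan_concat zero_le)
      also have "\<dots> = int m" using sum by (metis of_nat_sum)
      finally show ?thesis using 2 nm by linarith
    qed
    moreover have "ins g s t = 0" if "Suc N \<le> t" for t
      using aft[of t] z[of "t - 1"] that sN by auto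
    ultimately have A: "h g \<in> ?A" using gs by (auto simp: hg conjugates_def)
    have "(SOME t. int (ins g s t) = int t + k) = s"
      using gs \<open>antimono (ins g s)\<close> antimono_fixed_unique by (intro some_equality) auto
    then have "f (h g) = del (ins g s) s" by (simp add: f_def hg)
    also have "\<dots> = g"
    proof
      fix t show "del (ins g s) s t = g t"
        using bef[of t] aft[of "Suc t"] less[of t] by (auto simp: del_def)
    qed
    finally show ?thesis using A by blast
  qed
  have "bij_betw f ?A ?B"
    using f h by (intro bij_betw_byWitness[where f' = h]) blast+
  then have "card ?A = card ?B" by (rule bij_betw_same_card)
  also have "card ?A = vcount k n"
    unfolding vcount_def
    by (rule card_partitions_above[symmetric, where R = "\<lambda>g. \<exists>t. int (g t) = int t + k"]) (simp add: N_def)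
  also have "card ?B = card {p \<in> partitions m. \<not> (\<exists>t. int (parts_above t p) = int t + (k + 1))}"
    by (rule card_partitions_above[symmetric, where R = "\<lambda>g. \<not> (\<exists>t. int (g t) = int t +
        (k + 1))"]) (simp add: N_def)
  also have "\<dots> + vcount (k + 1) m = card (partitions m)"
    unfolding vcount_def
    by (subst card_Un_disjoint[symmetric]) (auto simp: finite_partitions intro!: arg_cong[where f=card])
  finally show ?thesis .
qed

lemma card_split:
  assumes "finite A"
  shows "card {p \<in> A. P p} = card {p \<in> A. P p \<and> Q p} + card {p \<in> A. P p \<and> \<not> Q p}"
proof -
  have "{p \<in> A. P p} = {p \<in> A. P p \<and> Q p} \<union> {p \<in> A. P p \<and> \<not> Q p}" by blast
  also have "card \<dots> = card {p \<in> A. P p \<and> Q p} + card {p \<in> A. P p \<and> \<not> Q p}"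
    by (rule card_Un_disjoint) (use assms in auto)
  finally show ?thesis .
qed

text \<open>Two instances of \<open>vcount_rec\<close> have the same right-hand side and reduce the
  claim for \<open>n\<close> and \<open>s\<close> to that for \<open>n - Suc s\<close> and
  \<open>Suc s\<close>. If \<open>n \<le> s\<close>, both sides count all partitions of
  \<open>n\<close>. This is the source of the symmetry under z -> q/z.\<close>

lemma vcount_minus: "vcount (- int s) n = vcount (int s) (n + s)"
proof (induction n arbitrary: s rule: less_induct)
  case (less n)
  have rec: "vcount (int s) (n + s) + vcount (int s + 1) n = card (partitions n)"
    by (rule vcount_rec) simp
  show ?case
  proof (cases "n \<le> s")
    case True
    have "parts_above s p = 0" if "p \<in> partitions n" for p
      using that True mem_le_sum_mset by (intro above_eq_0) (fastforce simp: mem_partitions)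
    then have "\<exists>t. int (parts_above t p) = int t + (- int s)" if "p \<in> partitions n" for p
      using that by (intro exI[of _ s]) auto
    then have "vcount (- int s) n = card (partitions n)"
      by (auto simp: vcount_def intro!: arg_cong[where f=card])
    then show ?thesis using rec True by (simp add: vcount_eq_0)
  next
    case False
    define m where "m = n - Suc s"
    have n: "n = m + Suc s" using False by (simp add: m_def)
    have "vcount (- int (Suc s)) m + vcount (- int (Suc s) + 1) n = card (partitions n)"
      by (rule vcount_rec) (simp add: n)
    moreover have "vcount (- int (Suc s)) m = vcount (int s + 1) n"
      using less.IH[of m "Suc s"] n by (simp add: add.commute)
    ultimately show ?thesis using rec by simp
  qed
qed

text \<open>An intermediate count between \<open>vcount\<close> and the crank: from
  \<open>n - 1\<close> to \<open>n\<close> it grows by the number of partitions of \<open>n\<close>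
  with crank \<open>k\<close>, provided \<open>n \<ge> 2\<close>.\<close>

definition acount :: "int \<Rightarrow> nat \<Rightarrow> nat" where
  "acount k n = card {p \<in> partitions n. \<exists>t. int (parts_above t p) = int t + k \<and> (t = 0 \<or> t \<in># p)}"

lemma above_unique:
  assumes "int (parts_above t p) = int t + k" "int (parts_above s p) = int s + k"
  shows "t = s"
  using antimono_fixed_unique[OF above_antimono assms] .

text \<open>A partition that has \<open>t + k\<close> parts larger than \<open>t \<ge> 1\<close> but no part \<open>t\<close> has \<open>(t - 1) + (k + 1)\<close>
  parts larger than \<open>t - 1\<close>; this cancels most of the difference.\<close>

lemma vcount_diff:
  assumes "0 < n"
  shows "int (vcount k n) - int (vcount (k + 1) n) = int (acount k n) - int (acount k (n - 1))"
proof -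
  let ?X = "\<lambda>k p t. int (parts_above t p) = int t + k"
  let ?N1 = "{p \<in> partitions n. (\<exists>t. ?X k p t) \<and> \<not> (\<exists>t. ?X k p t \<and> (t =
      0 \<or> t \<in># p))}"
  let ?N2 = "{p \<in> partitions n. (\<exists>t. ?X (k + 1) p t) \<and> \<not> (\<exists>t. ?X (k +
      1) p t \<and> Suc t \<in># p)}"
  let ?S = "{p \<in> partitions n. \<exists>t. ?X (k + 1) p t \<and> Suc t \<in># p}"
  let ?T = "{p \<in> partitions (n - 1). \<exists>t. ?X k p t \<and> (t = 0 \<or> t \<in># p)}"
  have "((\<exists>t. ?X k p t) \<and> \<not> (\<exists>t. ?X k p t \<and> (t = 0 \<or> t \<in># p))) \<longleftrightarrow>
    ((\<exists>t. ?X (k + 1) p t) \<and> \<not> (\<exists>t. ?X (k +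
        1) p t \<and> Suc t \<in># p))" (is "?P p \<longleftrightarrow> ?Q p") for p
  proof
    assume "?P p"
    then obtain t where t: "?X k p t" "t \<noteq> 0" "t \<notin># p" by blast
    then obtain u where u: "t = Suc u" by (cases t) auto
    then have "?X (k + 1) p u"
      using t above_Suc[of u p] by (simp add: not_in_iff)
    then show "?Q p"
      using above_unique[of u p "k + 1"] t u by blast
  next
    assume "?Q p"
    then obtain t where t: "?X (k + 1) p t" "Suc t \<notin># p" by blast
    then have "?X k p (Suc t)"
      using above_Suc[of t p] by (simp add: not_in_iff)
    then show "?P p"
      using above_unique[of "Suc t" p k] t by blast
  qed
  then have "?N1 = ?N2" by (simp only:)
  moreover have "vcount k n = acount k n + card ?N1"
  proof -
    have "acount k n = card {p \<in> partitions n. (\<exists>t. ?X k p t) \<and> (\<exists>t. ?X k p t \<and> (t = 0 \<or> t \<in># p))}"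
      unfolding acount_def by (intro arg_cong[where f=card]) blast
    then show ?thesis unfolding vcount_def
      by (subst card_split[where Q = "\<lambda>p. \<exists>t. ?X k p t \<and> (t =
          0 \<or> t \<in># p)"]) (simp_all add: finite_partitions)
  qed
  moreover have "vcount (k + 1) n = card ?S + card ?N2"
  proof -
    have "card ?S = card {p \<in> partitions n. (\<exists>t. ?X (k + 1) p t) \<and> (\<exists>t. ?X (k +
        1) p t \<and> Suc t \<in># p)}"
      by (intro arg_cong[where f=card]) blast
    then show ?thesis unfolding vcount_def
      by (subst card_split[where Q = "\<lambda>p. \<exists>t. ?X (k +
          1) p t \<and> Suc t \<in># p"]) (simp_all add: finite_partitions)
  qed
  \<comment> \<open>Lowering the part \<open>Suc t\<close> to \<open>t\<close>, or dropping it if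
    \<open>t = 0\<close>, takes one part out of \<open>parts_above t\<close> and so turns
    \<open>k + 1\<close> into \<open>k\<close>.\<close>
  moreover have "card ?S = acount k (n - 1)"
  proof -
    define tS where "tS = (\<lambda>p. THE t. ?X (k + 1) p t)"
    define tT where "tT = (\<lambda>p. THE t. ?X k p t)"
    have tS: "tS p = t" if "?X (k + 1) p t" for p t
      unfolding tS_def using that by (intro the_equality) (auto dest: above_unique)
    have tT: "tT p = t" if "?X k p t" for p t
      unfolding tT_def using that by (intro the_equality) (auto dest: above_unique)
    define f where "f p = p - {#Suc (tS p)#} + (if tS p = 0 then {#} else {#tS p#})" for p
    define h where "h p = (if tT p = 0 then p else p - {#tT p#}) + {#Suc (tT p)#}" for p
    have f: "f p \<in> ?T \<and> h (f p) = p" if "p \<in> ?S" for p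
    proof -
      from that obtain t where p: "p \<in> partitions n" "?X (k + 1) p t" "Suc t \<in># p" by blast
      define u where "u = (if t = 0 then {#} else {#t#})"
      obtain r where r: "p = add_mset (Suc t) r" using p(3) by (metis multi_member_split)
      have fp: "f p = r + u" unfolding f_def tS[OF p(2)] by (simp add: r u_def)
      have x: "?X k (f p) t" using p(2) unfolding fp unfolding r u_def by simp
      have "h (f p) = p" unfolding h_def[of "f p"] tT[OF x] unfolding fp unfolding r u_def by simp
      moreover have "f p \<in> partitions (n - 1)"
        using p(1) unfolding fp unfolding r u_def by (auto simp: mem_partitions)
      moreover have "t = 0 \<or> t \<in># f p" unfolding fp u_def by simp
      ultimately show ?thesis using x by blast
    qed
    have h: "h p \<in> ?S \<and> f (h p) = p" if "p \<in> ?T" for p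
    proof -
      from that obtain t where p: "p \<in> partitions (n - 1)" "?X k p t" "t = 0 \<or> t \<in># p" by blast
      define u where "u = (if t = 0 then {#} else {#t#})"
      obtain r where r: "p = r + u"
      proof (cases "t = 0")
        case True
        then show thesis using that[of p] by (simp add: u_def)
      next
        case False
        then show thesis using p(3) that[of "p - {#t#}"] by (simp add: u_def)
      qed
      have hp: "h p = add_mset (Suc t) r" unfolding h_def tT[OF p(2)] unfolding r u_def by simp
      have x: "?X (k + 1) (h p) t" using p(2) unfolding hp unfolding r u_def by (simp split: if_splits)
      have "f (h p) = p" unfolding f_def[of "h p"] tS[OF x] unfolding hp unfolding r u_def by simp
      moreover have "h p \<in> partitions n"
        using p(1) assms unfolding hp unfolding r u_def by (auto simp: mem_partitions split: if_splits)
      moreover have "Suc t \<in># h p" unfolding hp by simp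
      ultimately show ?thesis using x by blast
    qed
    have "bij_betw f ?S ?T"
      using f h by (intro bij_betw_byWitness[where f' = h]) blast+
    then show ?thesis unfolding acount_def by (rule bij_betw_same_card)
  qed
  ultimately show ?thesis by simp
qed

section \<open>The crank\<close>

lemma crank_of_ones: "1 \<in># p \<Longrightarrow> crank p = int (parts_above (count p 1) p) - int (count p 1)"
  by (simp add: crank_def parts_above_def)

text \<open>Adding a part 1 to a nonempty partition keeps the largest part, so the difference counts
  the partitions without ones, where the crank is the largest part.\<close>

lemma card_Max_diff:
  assumes n: "2 \<le> n"
  shows "int (card {p \<in> partitions n. int (Max (set_mset p)) = k}) - int (card {p \<in> partitions (n -
      1). int (Max (set_mset p)) = k})
     = int (card {p \<in> partitions n. 1 \<notin># p \<and> crank p = k})"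
proof -
  have "bij_betw (add_mset 1) {p \<in> partitions (n - 1). int (Max (set_mset p)) = k}
     {p \<in> partitions n. int (Max (set_mset p)) = k \<and> 1 \<in># p}"
  proof (rule bij_betw_byWitness[where f' = "\<lambda>p. p - {#1#}"])
    have M: "Max (set_mset (add_mset 1 p)) = Max (set_mset p)" if "p \<in> partitions (n - 1)" for p
    proof -
      have "p \<noteq> {#}" using that n by (auto simp: mem_partitions)
      then have "Max (set_mset p) \<in># p" by (simp add: Max_in)
      then have "1 \<le> Max (set_mset p)" using that by (auto simp: mem_partitions Suc_le_eq)
      then show ?thesis using \<open>p \<noteq> {#}\<close> by simp
    qed
    show "add_mset 1 ` {p \<in> partitions (n - 1). int (Max (set_mset p)) = k}
        \<subseteq> {p \<in> partitions n. int (Max (set_mset p)) = k \<and> 1 \<in># p}"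
      using n M by (auto simp: mem_partitions)
    show "(\<lambda>p. p - {#1#}) ` {p \<in> partitions n. int (Max (set_mset p)) = k \<and> 1 \<in># p}
        \<subseteq> {p \<in> partitions (n - 1). int (Max (set_mset p)) = k}"
    proof clarify
      fix p assume p: "p \<in> partitions n" "1 \<in># p" "k = int (Max (set_mset p))"
      then obtain r where r: "p = add_mset 1 r" by (metis multi_member_split)
      have "r \<in> partitions (n - 1)" using p r by (auto simp: mem_partitions)
      then show "p - {#1#} \<in> partitions (n - 1) \<and> int (Max (set_mset (p - {#1#}))) = int (Max (set_mset p))"
        using M[of r] r by simp
    qed
  qed auto
  then have "card {p \<in> partitions (n - 1). int (Max (set_mset p)) = k}
     = card {p \<in> partitions n. int (Max (set_mset p)) = k \<and> 1 \<in># p}"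
    by (rule bij_betw_same_card)
  moreover have "{p \<in> partitions n. int (Max (set_mset p)) = k \<and> 1 \<notin># p} =
      {p \<in> partitions n. 1 \<notin># p \<and> crank p = k}"
    by (auto simp: crank_def)
  ultimately show ?thesis
    using card_split[OF finite_partitions[of n], of "\<lambda>p. int (Max (set_mset p)) =
        k" "\<lambda>p. 1 \<in># p"] by simp
qed
definition apos :: "int \<Rightarrow> nat \<Rightarrow> nat multiset set" where
  "apos k n = {p \<in> partitions n. \<exists>t\<ge>1. int (parts_above t p) = int t + k \<and> t \<in># p}"

text \<open>Adding a part 1 embeds \<open>apos k (n - 1)\<close> in \<open>apos k n\<close>. The
  partitions not reached have no 1 except possibly the part \<open>t\<close> itself. Trading
  \<open>t\<close> for \<open>t\<close> ones makes \<open>t\<close> the number of ones, and the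
  equation for \<open>parts_above t p\<close> then says that the crank is \<open>k\<close>.\<close>

lemma card_apos_diff:
  assumes n: "2 \<le> n"
  shows "int (card (apos k n)) - int (card (apos k (n - 1))) =
      int (card {p \<in> partitions n. 1 \<in># p \<and> crank p = k})"
proof -
  let ?X = "\<lambda>p t. int (parts_above t p) = int t + k"
  let ?c = "\<lambda>p. p - {#1#}"
  \<comment> \<open>If \<open>t = 1\<close>, one of the ones serves as the part \<open>t\<close> and
    must stay, hence the 2.\<close>
  let ?U = "{p \<in> apos k n. \<exists>t\<ge>1. ?X p t \<and> t \<in># p \<and> (if t = 1 then 2 else 1) \<le> count p 1}"
  let ?W = "{p \<in> partitions n. \<exists>t\<ge>1. ?X p t \<and> t \<in># p \<and> count p 1 = (if t = 1 then 1 else 0)}"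
  have ab1: "parts_above t (add_mset 1 p) = parts_above t p" if "1 \<le> t" for t p using that by simp
  have "bij_betw (add_mset 1) (apos k (n - 1)) ?U"
  proof (rule bij_betw_byWitness[where f' = ?c])
    show "add_mset 1 ` apos k (n - 1) \<subseteq> ?U"
      using n by (fastforce simp: apos_def mem_partitions)
    show "?c ` ?U \<subseteq> apos k (n - 1)"
    proof clarify
      fix p t assume p: "p \<in> apos k n" "1 \<le> t" "?X p t" "t \<in># p" "(if t = 1 then 2 else 1) \<le> count p 1"
      then have "0 < count p 1" by (auto split: if_splits)
      then have "1 \<in># p" by simp
      then obtain r where r: "p = add_mset 1 r" by (metis multi_member_split)
      have "r \<in> partitions (n - 1)" "?X r t" "t \<in># r"
        using p r by (auto simp: apos_def mem_partitions split: if_splits)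
      then show "p - {#1#} \<in> apos k (n - 1)" using p(2) r by (auto simp: apos_def)
    qed
    show "\<forall>a\<in>?U. add_mset 1 (a - {#1#}) = a"
    proof
      fix p assume "p \<in> ?U"
      then have "0 < count p 1" by (auto split: if_splits)
      then have "1 \<in># p" by simp
      then show "add_mset 1 (p - {#1#}) = p" by simp
    qed
  qed auto
  then have 1: "card (apos k (n - 1)) = card ?U" by (rule bij_betw_same_card)
  have "card (apos k n) = card ?U + card ?W"
  proof -
    have eq: "apos k n = ?U \<union> ?W"
    proof (intro equalityI subsetI)
      fix p assume p: "p \<in> apos k n"
      then obtain t where t: "1 \<le> t" "?X p t" "t \<in># p" by (auto simp: apos_def)
      show "p \<in> ?U \<union> ?W"
      proof (cases "(if t = 1 then 2 else 1) \<le> count p 1")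
        case True
        then show ?thesis using p t by blast
      next
        case False
        have pos: "t = 1 \<longrightarrow> 0 < count p 1" using t(3) by auto
        have "\<not> (if t = 1 then 2 else 1) \<le> c \<Longrightarrow> t =
            1 \<longrightarrow> 0 < c \<Longrightarrow> c = (if t = 1 then 1 else 0)" for c :: nat
          by (auto split: if_splits)
        from this[OF False pos] have c: "count p 1 = (if t = 1 then 1 else 0)" .
        have "p \<in> partitions n" using p by (simp add: apos_def)
        then have "p \<in> ?W" using t c unfolding mem_Collect_eq by (intro conjI exI[of _ t])
        then show ?thesis by simp
      qed
    qed (auto simp: apos_def)
    have dis: "?U \<inter> ?W = {}"
    proof -
      have False if "?X p t" "(if t = 1 then 2 else 1) \<le> count p 1" "?X p s" "count p 1 = (if s =
          1 then 1 else 0)" for p t s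
        using above_unique[OF that(1,3)] that(2,4) by (auto split: if_splits)
      then show ?thesis by blast
    qed
    have "finite ?U" "finite ?W" by (simp_all add: apos_def finite_partitions)
    from card_Un_disjoint[OF this dis] show ?thesis unfolding eq[symmetric] .
  qed
  moreover have "card ?W = card {p \<in> partitions n. 1 \<in># p \<and> crank p = k}"
  proof -
    define tW where "tW = (\<lambda>p. THE t. ?X p t)"
    have tW: "tW p = t" if "?X p t" for p t
      unfolding tW_def using that by (intro the_equality) (auto dest: above_unique)
    define f where "f p = p - {#tW p#} + replicate_mset (tW p) 1" for p
    define h where "h p = p - replicate_mset (count p 1) 1 + {#count p 1#}" for p :: "nat multiset"
    have f: "f p \<in> {p \<in> partitions n. 1 \<in># p \<and> crank p = k} \<and> h (f p) = p" if "p \<in> ?W" for p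
    proof -
      from that obtain t where p: "p \<in> partitions n" "1 \<le> t" "?X p t" "t \<in># p" "count p 1 =
          (if t = 1 then 1 else 0)"
        unfolding mem_Collect_eq by blast
      obtain r where r: "p = add_mset t r" using p(4) by (metis multi_member_split)
      have c: "count r 1 = 0" using p(5) unfolding r by (simp split: if_splits)
      have fp: "f p = r + replicate_mset t 1" unfolding f_def tW[OF p(3)] unfolding r by simp
      have c1: "count (f p) 1 = t" unfolding fp by (simp only: count_union c count_replicate_mset) simp
      have "parts_above t (f p) = parts_above t p" using p(2) unfolding fp unfolding r by simp
      moreover have in1: "1 \<in># f p" using c1 p(2) by (simp only: flip: count_greater_zero_iff)
      ultimately have "crank (f p) = k" using p(3) crank_of_ones[OF in1] unfolding c1 by simp
      moreover have "f p \<in> partitions n"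
        using p(1) unfolding fp unfolding r by (auto simp: mem_partitions sum_mset_replicate_mset)
      moreover have "h (f p) = p" unfolding h_def c1 unfolding fp unfolding r by simp
      ultimately show ?thesis using in1 by blast
    qed
    have h: "h p \<in> ?W \<and> f (h p) = p" if "p \<in> {p \<in> partitions n. 1 \<in># p \<and> crank p = k}" for p
    proof -
      define t where "t = count p 1"
      have in1: "1 \<in># p" and p: "p \<in> partitions n" using that by auto
      have t: "1 \<le> t" using in1 unfolding t_def by simp
      have X: "?X p t" using that crank_of_ones[OF in1] by (simp add: t_def)
      define r where "r = {#i \<in># p. i \<noteq> 1#}"
      have c: "count r 1 = 0" by (simp add: r_def)
      have r: "p = r + replicate_mset t 1"
        using multiset_partition[of p "\<lambda>i. i \<noteq> 1"] by (simp add: r_def t_def filter_eq_replicate_mset)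
      have "p - replicate_mset t 1 = r" unfolding r by simp
      then have hp: "h p = add_mset t r" unfolding h_def t_def[symmetric] by simp
      have "parts_above t p = parts_above t r" using t unfolding r by simp
      then have x: "?X (h p) t" using X unfolding hp by simp
      have "f (h p) = p" unfolding f_def[of "h p"] tW[OF x] unfolding hp by (simp add: r)
      moreover have "\<Sum>\<^sub># r + t = \<Sum>\<^sub># p" by (subst r) (simp add: sum_mset_replicate_mset)
      then have "h p \<in> partitions n"
        using p t unfolding hp by (auto simp: mem_partitions r_def)
      moreover have "count (h p) 1 = (if t = 1 then 1 else 0)" using c unfolding hp by simp
      moreover have "t \<in># h p" unfolding hp by simp
      ultimately show ?thesis using x t by blast
    qed
    have "bij_betw f ?W {p \<in> partitions n. 1 \<in># p \<and> crank p = k}"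
      using f h by (intro bij_betw_byWitness[where f' = h]) blast+
    then show ?thesis by (rule bij_betw_same_card)
  qed
  ultimately show ?thesis using 1 by simp
qed
text \<open>The case \<open>t = 0\<close> of \<open>acount\<close> counts partitions with
  \<open>k\<close> parts. By conjugation these may be replaced by partitions with largest part
  \<open>k\<close>, which account for the cranks of partitions without ones; \<open>apos\<close>
  accounts for the others.\<close>

lemma acount_diff:
  assumes n: "2 \<le> n"
  shows "int (acount k n) - int (acount k (n - 1)) = int (card {p \<in> partitions n. crank p = k})"
proof -
  let ?X = "\<lambda>p t. int (parts_above t p) = int t + k"
  have zero: "card {p \<in> partitions m. int (size p) = k} = card {p \<in> partitions m. int (Max (set_mset p)) = k}"
    if "0 < m" for m
  proof (cases "0 \<le> k")
    case True
    then obtain j where "k = int j" by (metis nonneg_int_cases)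
    then show ?thesis using card_size_eq_card_Max[OF that, of j] by simp
  qed (auto intro!: arg_cong[where f=card])
  have ac: "acount k m = card {p \<in> partitions m. int (size p) = k} + card (apos k m)" for m
  proof -
    have "(\<exists>t. ?X p t \<and> (t = 0 \<or> t \<in># p)) \<longleftrightarrow> int (size p) =
        k \<or> (\<exists>t\<ge>1. ?X p t \<and> t \<in># p)"
      if "p \<in> partitions m" for p
    proof -
      have "?X p 0 \<longleftrightarrow> int (size p) = k" using that above_0[of p] by (simp add: mem_partitions)
      moreover have "1 \<le> t \<longleftrightarrow> t \<noteq> 0" for t :: nat by auto
      moreover have "0 \<notin># p" using that by (auto simp: mem_partitions)
      ultimately show ?thesis by metis
    qed
    then have "{p \<in> partitions m. \<exists>t. ?X p t \<and> (t = 0 \<or> t \<in># p)} =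
        {p \<in> partitions m. int (size p) = k} \<union> apos k m"
      unfolding apos_def by blast
    moreover have "{p \<in> partitions m. int (size p) = k} \<inter> apos k m = {}"
    proof -
      have "t = 0" if "p \<in> partitions m" "int (size p) = k" "?X p t" for p t
        using that above_0[of p] above_unique[of t p k 0] by (auto simp: mem_partitions)
      then show ?thesis by (auto simp: apos_def)
    qed
    ultimately show ?thesis unfolding acount_def
      by (simp add: card_Un_disjoint apos_def finite_partitions)
  qed
  have "card {p \<in> partitions n. crank p = k} = card {p \<in> partitions n. 1 \<in># p \<and> crank p =
      k} + card {p \<in> partitions n. 1 \<notin># p \<and> crank p = k}"
    using card_split[OF finite_partitions[of n], of "\<lambda>p. crank p =
        k" "\<lambda>p. 1 \<in># p"] by (simp add: conj_commute)
  then show ?thesis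
    using ac[of n] ac[of "n - 1"] zero[of n] zero[of "n - 1"] card_Max_diff[OF n, of k] card_apos_diff[OF n, of k] n by simp
qed

lemma partitions_1: "partitions 1 = {{#1#}}"
proof -
  have "p = {#1#}" if "\<forall>i\<in>#p. 0 < i" "\<Sum>\<^sub># p = 1" for p :: "nat multiset"
  proof (cases p)
    case (add x q)
    have "0 < x" "x + \<Sum>\<^sub># q = 1" "\<forall>i\<in>#q. 0 < i" using that add by auto
    then have "x = 1" "\<Sum>\<^sub># q = 0" by linarith+
    then have "q \<in> partitions 0" using \<open>\<forall>i\<in>#q. 0 < i\<close> by (simp only: mem_partitions)
    then show ?thesis using add \<open>x = 1\<close> by (simp add: partitions_0)
  qed (use that in auto)
  then show ?thesis by (auto simp: partitions_def)
qed

text \<open>The conventional values of the crank count for \<open>n = 0\<close> and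
  \<open>n = 1\<close> are the ones for which this formula has no exception.\<close>

lemma crank_count_eq: "crank_count k n = int (vcount k n) - int (vcount (k + 1) n)"
proof -
  consider "n = 0" | "n = 1" | "2 \<le> n" by linarith
  then show ?thesis
  proof cases
    case 1
    have "vcount j 0 = (if j \<le> 0 then 1 else 0)" for j
    proof -
      have "(\<exists>t. int (parts_above t {#}) = int t + j) \<longleftrightarrow> j \<le> 0"
        by (auto intro: exI[of _ "nat (- j)"])
      then have "{p \<in> partitions 0. \<exists>t. int (parts_above t p) = int t + j} = (if j \<le> 0 then {{#}} else {})"
        unfolding partitions_0 by auto
      then show ?thesis by (simp add: vcount_def)
    qed
    then show ?thesis using 1 by (simp add: crank_count_def)
  next
    case 2
    have "vcount j 1 = (if j = 1 \<or> j \<le> -1 then 1 else 0)" for j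
    proof -
      have "(\<exists>t. int (if t = 0 then 1 else 0) = int t + j) \<longleftrightarrow> j = 1 \<or> j \<le> -1"
      proof
        assume "\<exists>t. int (if t = 0 then 1 else 0) = int t + j"
        then show "j = 1 \<or> j \<le> -1" by (auto split: if_splits)
      next
        assume "j = 1 \<or> j \<le> -1"
        then show "\<exists>t. int (if t = 0 then 1 else 0) = int t + j"
          by (intro exI[of _ "if j = 1 then 0 else nat (- j)"]) auto
      qed
      moreover have "parts_above t {#1#} = (if t = 0 then 1 else 0)" for t by simp
      ultimately have "{p \<in> partitions 1. \<exists>t. int (parts_above t p) = int t + j} = (if j =
          1 \<or> j \<le> -1 then {{#1#}} else {})"
        unfolding partitions_1 by auto
      then show ?thesis by (simp add: vcount_def)
    qed
    then show ?thesis using 2 by (auto simp: crank_count_def)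
  next
    case 3
    then show ?thesis
      using vcount_diff[of n k] acount_diff[OF 3, of k] by (simp add: crank_count_def)
  qed
qed

section \<open>The rank and Dyson's recursion\<close>

lemma rank_le_iff: "p \<noteq> {#} \<Longrightarrow> rank p \<le> k \<longleftrightarrow> (\<forall>i\<in>#p. int i \<le> k + int (size p))"
proof -
  assume "p \<noteq> {#}"
  then have "Max (set_mset p) \<le> m \<longleftrightarrow> (\<forall>i\<in>#p. i \<le> m)" for m by simp
  from this[of "nat (k + int (size p))"] show ?thesis
  proof (cases "0 \<le> k + int (size p)")
    case True
    then show ?thesis
      using \<open>Max (set_mset p) \<le> nat (k + int (size p)) \<longleftrightarrow> _\<close> by (auto simp: rank_def le_nat_iff)
  next
    case False
    have "Max (set_mset p) \<in># p" using \<open>p \<noteq> {#}\<close> by (simp add: Max_in)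
    then show ?thesis using False by (force simp: rank_def)
  qed
qed

text \<open>The empty partition is excluded, as its \<open>rank\<close> is unspecified; it returns
  as a correction term for \<open>n = 0\<close>.\<close>

definition rank_ge :: "nat \<Rightarrow> nat \<Rightarrow> nat" where
  "rank_ge r n = card {p \<in> partitions n. p \<noteq> {#} \<and> int r \<le> rank p}"

definition rank_le :: "nat \<Rightarrow> nat \<Rightarrow> nat" where
  "rank_le r n = card {p \<in> partitions n. p \<noteq> {#} \<and> rank p \<le> - int r}"

lemma mem_inc: "i \<in># inc N p \<Longrightarrow> i = 1 \<or> (\<exists>j\<in>#p. i = Suc j)"
  by (auto simp: inc_def split: if_splits)

lemma Max_mem: "p \<noteq> {#} \<Longrightarrow> Max (set_mset p) \<in># p" for p :: "nat multiset"
  by (simp add: Max_in)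

lemma rank_ge_eq_0: "n \<le> r \<Longrightarrow> rank_ge r n = 0"
proof -
  assume "n \<le> r"
  have "\<not> int r \<le> rank p" if "p \<in> partitions n" "p \<noteq> {#}" for p
  proof -
    have "Max (set_mset p) \<le> n" using that Max_mem mem_le_sum_mset by (metis mem_partitions)
    moreover have "0 < size p" using that by (simp add: nonempty_has_size)
    ultimately show ?thesis using \<open>n \<le> r\<close> by (simp add: rank_def)
  qed
  then show ?thesis unfolding rank_ge_def by (metis (mono_tags, lifting) card.empty empty_Collect_eq)
qed

lemma rank_le_eq_0: "n \<le> r \<Longrightarrow> rank_le r n = 0"
proof -
  assume "n \<le> r"
  have "\<not> rank p \<le> - int r" if "p \<in> partitions n" "p \<noteq> {#}" for p
  proof -
    have "0 < Max (set_mset p)" using that Max_mem by (metis mem_partitions)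
    moreover have "size p \<le> n" using that size_le_sum_mset by (metis mem_partitions)
    ultimately show ?thesis using \<open>n \<le> r\<close> by (simp add: rank_def)
  qed
  then show ?thesis unfolding rank_le_def by (metis (mono_tags, lifting) card.empty empty_Collect_eq)
qed

text \<open>Dyson's map: remove one from each of the \<open>s\<close> parts and insert a new part \<open>s + r + 1\<close>.\<close>

lemma rank_ge_rec: "rank_ge r (n + r + 1) + rank_ge (r + 3) n = card (partitions n)"
proof -
  let ?A = "{p \<in> partitions n. \<not> (p \<noteq> {#} \<and> int (r + 3) \<le> rank p)}"
  let ?B = "{p \<in> partitions (n + r + 1). p \<noteq> {#} \<and> int r \<le> rank p}"
  define f where "f p = add_mset (size p + r + 1) (dec p)" for p
  define h where "h q = inc (Max (set_mset q) - r - 1) (q - {#Max (set_mset q)#})" for q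
  have f: "f p \<in> ?B \<and> h (f p) = p" if p: "p \<in> ?A" for p
  proof -
    \<comment> \<open>The inserted part is the largest one because the rank of \<open>p\<close> is
      at most \<open>r + 2\<close>; this is where the shift from \<open>r\<close> to
      \<open>r + 3\<close> comes from.\<close>
    have "i \<le> size p + r + 1" if i: "i \<in># dec p" for i
    proof -
      have "p \<noteq> {#}" using i by (auto simp: dec_def)
      then have "rank p \<le> int r + 2" using p by auto
      with \<open>p \<noteq> {#}\<close> have le: "\<forall>i\<in>#p. int i \<le> int r + 2 + int (size p)" by (simp add: rank_le_iff)
      obtain j where j: "j \<in># p" "i = j - 1" using Max_dec_le[OF i] by blast
      have "int j \<le> int r + 2 + int (size p)" using le j(1) by blast
      then show ?thesis using j(2) by simp
    qed
    then have M: "Max (set_mset (f p)) = size p + r + 1"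
      unfolding f_def by (intro Max_eqI) auto
    have "int r \<le> rank (f p)"
      using size_dec_le[of p] by (simp add: rank_def M) (simp add: f_def)
    moreover have "f p \<in> partitions (n + r + 1)"
      using p sum_dec[of p] dec_pos[of p] by (auto simp: mem_partitions f_def)
    moreover have "h (f p) = p"
      unfolding h_def M using p inc_dec[of p] by (simp add: f_def mem_partitions)
    ultimately show ?thesis by (simp add: f_def)
  qed
  have h: "h q \<in> ?A \<and> f (h q) = q" if q: "q \<in> ?B" for q
  proof -
    define M where "M = Max (set_mset q)"
    obtain u where u: "q = add_mset M u"
      using q Max_mem[of q] unfolding M_def by (metis (mono_tags, lifting) mem_Collect_eq multi_member_split)
    have le: "i \<le> M" if "i \<in># u" for i
    proof -
      have "i \<in># q" using that by (subst u) simp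
      then show ?thesis by (simp add: M_def)
    qed
    have "size q = Suc (size u)" by (subst u) simp
    moreover have "int r \<le> int M - int (size q)" using q by (simp add: rank_def M_def)
    moreover define N where "N = M - r - 1"
    ultimately have M: "M = N + r + 1" and N: "size u \<le> N" by auto
    have hq: "h q = inc N u"
      unfolding h_def M_def[symmetric] using M by (simp add: u)
    have pos: "\<forall>i\<in>#u. 0 < i" and "\<Sum>\<^sub># u = n - N" "N \<le> n"
      using q M unfolding u by (auto simp: mem_partitions)
    then have "h q \<in> partitions n"
      using sum_inc[OF N] inc_pos[of N u] unfolding hq by (simp add: mem_partitions)
    moreover have "\<not> int (r + 3) \<le> rank (h q)" if ne: "h q \<noteq> {#}"
    proof -
      have s: "size (h q) = N" unfolding hq by (rule size_inc[OF N])
      have "i \<le> M + 1" if "i \<in># h q" for i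
        using mem_inc[of i N u] le that unfolding hq by auto
      then have "int i \<le> int r + 2 + int N" if "i \<in># h q" for i
        using that M by force
      then have "rank (h q) \<le> int r + 2"
        unfolding rank_le_iff[OF ne] s by blast
      then show ?thesis by simp
    qed
    moreover have "f (h q) = q"
      unfolding f_def hq size_inc[OF N] dec_inc[OF pos] using M u by simp
    ultimately show ?thesis by blast
  qed
  have "bij_betw f ?A ?B"
    by (intro bij_betw_byWitness[where f' = h] ballI image_subsetI
      conjunct1[OF f] conjunct2[OF f] conjunct1[OF h] conjunct2[OF h])
  then have "card ?A = rank_ge r (n + r + 1)"
    unfolding rank_ge_def by (rule bij_betw_same_card)
  moreover have "card (partitions n) = rank_ge (r + 3) n + card ?A"
    using card_split[OF finite_partitions[of n], of "\<lambda>_. True" "\<lambda>p. p \<noteq> {#} \<and> int (r + 3) \<le> rank p"]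
    by (simp add: rank_ge_def)
  ultimately show ?thesis by simp
qed

text \<open>The conjugate of Dyson's map: the largest part \<open>m\<close> is removed and a column
  of height \<open>m + r + 1\<close> is added.\<close>

lemma rank_le_rec: "rank_le r (n + r + 1) + rank_le (r + 3) n = card (partitions n)"
proof -
  let ?A = "{p \<in> partitions n. \<not> (p \<noteq> {#} \<and> rank p \<le> - int (r + 3))}"
  let ?B = "{p \<in> partitions (n + r + 1). p \<noteq> {#} \<and> rank p \<le> - int r}"
  \<comment> \<open>The value 0 makes the empty partition correspond to a single column of height
    \<open>r + 1\<close>.\<close>
  define m where "m p = (if p = {#} then 0 else Max (set_mset p))" for p :: "nat multiset"
  define f where "f p = inc (m p + r + 1) (p - {#m p#})" for p
  define h where "h q = {#i \<in># add_mset (size q - r - 1) (dec q). 0 < i#}" for q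
  have m_le: "i \<le> m p" if "i \<in># p" for i p
    using that by (auto simp: m_def)
  have f: "f p \<in> ?B \<and> h (f p) = p" if p: "p \<in> ?A" for p
  proof -
    have pos: "\<forall>i\<in>#p. 0 < i" and sum: "\<Sum>\<^sub># p = n" using p by (auto simp: mem_partitions)
    define u where "u = p - {#m p#}"
    have m_pos: "0 < m p \<and> p = add_mset (m p) u" if "p \<noteq> {#}"
    proof -
      have "m p \<in># p" using that Max_mem by (simp add: m_def)
      then show ?thesis using pos by (simp add: u_def)
    qed
    have m_0: "m p = 0 \<and> u = {#}" if "p = {#}" using that by (simp add: m_def u_def)
    have posu: "\<forall>i\<in>#u. 0 < i" using pos unfolding u_def by (auto dest: in_diffD)
    have le: "size u \<le> m p + r + 1"
    proof (cases "p = {#}")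
      case False
      then have "- int (r + 2) \<le> rank p" using p by auto
      then have "int (size p) \<le> int (m p) + int r + 2" using False by (simp add: rank_def m_def)
      moreover have "size p = Suc (size u)"
        using m_pos[OF False] by (metis size_add_mset)
      ultimately show ?thesis by simp
    qed (simp add: m_0)
    have fp: "f p = inc (m p + r + 1) u" by (simp add: f_def u_def)
    have s: "size (f p) = m p + r + 1" unfolding fp by (rule size_inc[OF le])
    then have ne: "f p \<noteq> {#}" by auto
    have "i \<le> m p" if "i \<in># u" for i using m_le that unfolding u_def by (auto dest: in_diffD)
    then have "i \<le> m p + 1" if "i \<in># f p" for i
      using mem_inc[of i "m p + r + 1" u] that unfolding fp by auto
    then have "int i \<le> - int r + int (m p + r + 1)" if "i \<in># f p" for i
      using that by force
    then have "rank (f p) \<le> - int r"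
      unfolding rank_le_iff[OF ne] s by blast
    moreover have "\<Sum>\<^sub># u + m p = n"
    proof (cases "p = {#}")
      case False
      then have "add_mset (m p) u = p" using m_pos by metis
      then have "\<Sum>\<^sub># (add_mset (m p) u) = n" using sum by (simp only:)
      then show ?thesis by (simp add: add.commute)
    qed (use sum m_0 in auto)
    then have "f p \<in> partitions (n + r + 1)"
      using sum_inc[OF le] inc_pos unfolding fp by (simp add: mem_partitions)
    moreover have hfp: "h (f p) = {#i \<in># add_mset (m p) u. 0 < i#}"
      unfolding h_def s unfolding fp dec_inc[OF posu] by simp
    then have "h (f p) = p"
    proof (cases "p = {#}")
      case False
      have "{#i \<in># p. 0 < i#} = p" using pos by (simp add: filter_mset_eq_conv)
      moreover have "add_mset (m p) u = p" using m_pos[OF False] by metis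
      ultimately show ?thesis using hfp by simp
    qed (use m_0 in simp)
    ultimately show ?thesis using ne by blast
  qed
  have h: "h q \<in> ?A \<and> f (h q) = q" if q: "q \<in> ?B" for q
  proof -
    define s where "s = size q - r - 1"
    have ne: "q \<noteq> {#}" and pos: "\<forall>i\<in>#q. 0 < i" and sum: "\<Sum>\<^sub># q = n + r + 1"
      using q by (auto simp: mem_partitions)
    have le: "\<forall>i\<in>#q. int i \<le> - int r + int (size q)"
      using q rank_le_iff[OF ne] by blast
    have "0 < Max (set_mset q)" using Max_mem[OF ne] pos by blast
    moreover have "int (Max (set_mset q)) \<le> - int r + int (size q)" using le Max_mem[OF ne] by blast
    ultimately have sz: "size q = s + r + 1" by (simp add: s_def)
    have led: "i \<le> s" if i: "i \<in># dec q" for i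
    proof -
      obtain j where "j \<in># q" "i = j - 1" using Max_dec_le[OF i] by blast
      moreover from this have "int j \<le> - int r + int (size q)" using le by blast
      ultimately show ?thesis using sz by simp
    qed
    have d0: "dec q = {#}" if "s = 0"
    proof (rule ccontr)
      assume "dec q \<noteq> {#}"
      then obtain i where "i \<in># dec q" by blast
      then show False using led[of i] dec_pos[of q] that by auto
    qed
    have hs: "h q = {#i \<in># add_mset s (dec q). 0 < i#}" unfolding h_def s_def ..
    have hq: "h q = (if s = 0 then {#} else add_mset s (dec q))"
    proof (cases "s = 0")
      case True
      then show ?thesis using d0 by (simp add: hs)
    next
      case False
      have "{#i \<in># dec q. 0 < i#} = dec q" using dec_pos[of q] by (simp add: filter_mset_eq_conv)
      then show ?thesis using False by (simp add: hs)
    qed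
    have mh: "m (h q) = s"
    proof (cases "s = 0")
      case False
      have "Max (set_mset (add_mset s (dec q))) = s" by (intro Max_eqI) (use led in auto)
      then show ?thesis using False by (simp add: m_def hq)
    qed (simp add: m_def hq)
    have "h q - {#s#} = dec q" using d0 by (simp add: hq)
    then have "f (h q) = inc (size q) (dec q)" unfolding f_def mh sz by simp
    then have "f (h q) = q" using inc_dec[OF pos] by simp
    moreover have "h q \<in> partitions n"
    proof (cases "s = 0")
      case True
      then show ?thesis using sum_dec[OF pos] sum sz d0 by (simp add: mem_partitions hq)
    next
      case False
      then show ?thesis using sum_dec[OF pos] sum sz dec_pos[of q] by (simp add: mem_partitions hq)
    qed
    moreover have "\<not> rank (h q) \<le> - int (r + 3)" if "h q \<noteq> {#}"
    proof -
      have "s \<noteq> 0" using that unfolding hq by (simp split: if_splits)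
      have "Max (set_mset (h q)) = s" using mh that by (simp add: m_def)
      then show ?thesis unfolding rank_def using size_dec_le[of q] sz \<open>s \<noteq> 0\<close> by (simp add: hq)
    qed
    ultimately show ?thesis by blast
  qed
  have "bij_betw f ?A ?B"
    by (intro bij_betw_byWitness[where f' = h] ballI image_subsetI
      conjunct1[OF f] conjunct2[OF f] conjunct1[OF h] conjunct2[OF h])
  then have "card ?A = rank_le r (n + r + 1)"
    unfolding rank_le_def by (rule bij_betw_same_card)
  moreover have "card (partitions n) = rank_le (r + 3) n + card ?A"
    using card_split[OF finite_partitions[of n], of "\<lambda>_. True" "\<lambda>p. p \<noteq> {#} \<and> rank p \<le> - int (r + 3)"]
    by (simp add: rank_le_def)
  ultimately show ?thesis by simp
qed

text \<open>Both counts obey the same recursion, which lowers \<open>n\<close> by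
  \<open>r + 1\<close>.\<close>

lemma rank_le_eq_rank_ge: "rank_le r n = rank_ge r n"
proof (induction n arbitrary: r rule: less_induct)
  case (less n)
  show ?case
  proof (cases "n \<le> r")
    case False
    then obtain m where n: "n = m + r + 1" by (metis add.assoc add.commute less_iff_Suc_add not_le Suc_eq_plus1)
    have "rank_le (r + 3) m = rank_ge (r + 3) m" using n by (intro less.IH) simp
    then show ?thesis using rank_ge_rec[of r m] rank_le_rec[of r m] n by simp
  qed (simp add: rank_ge_eq_0 rank_le_eq_0)
qed

lemma rank_count_nonneg:
  "rank_count (int m) n = int (rank_ge m n) - int (rank_ge (Suc m) n) + (if m = 0 \<and> n = 0 then 1 else 0)"
proof (cases "n = 0")
  case True
  then show ?thesis by (simp add: rank_count_def rank_ge_eq_0)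
next
  case False
  have ne: "p \<noteq> {#}" if "p \<in> partitions n" for p using that False by (auto simp: mem_partitions)
  have "rank_ge m n = card {p \<in> partitions n. (p \<noteq> {#} \<and> int m \<le> rank p) \<and> int (Suc m) \<le> rank p}
     + card {p \<in> partitions n. (p \<noteq> {#} \<and> int m \<le> rank p) \<and> \<not> int (Suc m) \<le> rank p}"
    unfolding rank_ge_def by (rule card_split[OF finite_partitions])
  moreover have "{p \<in> partitions n. (p \<noteq> {#} \<and> int m \<le> rank p) \<and> int (Suc m) \<le> rank p}
     = {p \<in> partitions n. p \<noteq> {#} \<and> int (Suc m) \<le> rank p}" by auto
  moreover have "{p \<in> partitions n. (p \<noteq> {#} \<and> int m \<le> rank p) \<and> \<not> int (Suc m) \<le> rank p}
     = {p \<in> partitions n. rank p = int m}" using ne by auto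
  ultimately show ?thesis using False by (simp add: rank_count_def rank_ge_def)
qed

lemma rank_count_minus: "rank_count (- int m) n = rank_count (int m) n"
proof (cases "m = 0 \<or> n = 0")
  case True
  then show ?thesis by (auto simp: rank_count_def)
next
  case False
  have ne: "p \<noteq> {#}" if "p \<in> partitions n" for p using that False by (auto simp: mem_partitions)
  have "rank_le m n = card {p \<in> partitions n. (p \<noteq> {#} \<and> rank p \<le> -
      int m) \<and> rank p \<le> - int (Suc m)}
     + card {p \<in> partitions n. (p \<noteq> {#} \<and> rank p \<le> - int m) \<and> \<not> rank p \<le> - int (Suc m)}"
    unfolding rank_le_def by (rule card_split[OF finite_partitions])
  moreover have "{p \<in> partitions n. (p \<noteq> {#} \<and> rank p \<le> - int m) \<and> rank p \<le> - int (Suc m)}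
     = {p \<in> partitions n. p \<noteq> {#} \<and> rank p \<le> - int (Suc m)}" by auto
  moreover have "{p \<in> partitions n. (p \<noteq> {#} \<and> rank p \<le> -
      int m) \<and> \<not> rank p \<le> - int (Suc m)}
     = {p \<in> partitions n. rank p = - int m}" using ne by auto
  ultimately have "int (card {p \<in> partitions n. rank p = - int m}) = int (rank_le m n) - int (rank_le (Suc m) n)"
    by (simp add: rank_le_def)
  then show ?thesis
    using False by (simp add: rank_count_nonneg rank_le_eq_rank_ge) (simp add: rank_count_def)
qed

text \<open>Nonempty partitions have rank at least 0 or at most -1, and the latter are as many as
  those of rank at least 1. Together with Dyson's recursion this yields the pentagonal number
  theorem.\<close>

lemma card_partitions_rank:
  "int (card (partitions n)) = int (rank_ge 0 n) + int (rank_ge 1 n) + (if n = 0 then 1 else 0)"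
proof (cases "n = 0")
  case True
  then show ?thesis by (simp add: partitions_0 rank_ge_eq_0)
next
  case False
  have ne: "p \<noteq> {#}" if "p \<in> partitions n" for p using that False by (auto simp: mem_partitions)
  have "card (partitions n) = card {p \<in> partitions n. True \<and> p \<noteq> {#} \<and> int 0 \<le> rank p}
    + card {p \<in> partitions n. True \<and> \<not> (p \<noteq> {#} \<and> int 0 \<le> rank p)}"
    using card_split[OF finite_partitions[of n], of "\<lambda>_. True" "\<lambda>p. p \<noteq> {#} \<and> int 0 \<le> rank p"] by simp
  moreover have "{p \<in> partitions n. True \<and> \<not> (p \<noteq> {#} \<and> int 0 \<le> rank p)} =
      {p \<in> partitions n. p \<noteq> {#} \<and> rank p \<le> - int 1}"
    using ne by auto
  ultimately have "card (partitions n) = rank_ge 0 n + rank_le 1 n"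
    by (simp add: rank_ge_def rank_le_def)
  then show ?thesis using False by (simp add: rank_le_eq_rank_ge)
qed

section \<open>The partition function and divisor sums\<close>

lemma sum_mset_eq_sum_count:
  fixes p :: "nat multiset"
  assumes "finite A" "set_mset p \<subseteq> A"
  shows "\<Sum>\<^sub># p = (\<Sum>i\<in>A. i * count p i)"
  using assms(2)
proof (induction p)
  case (add x p)
  have "(\<Sum>i\<in>A. i * count (add_mset x p) i) = (\<Sum>i\<in>A. i * count p i + (if i = x then x else 0))"
    by (intro sum.cong) auto
  then show ?case using add assms(1) by (simp add: sum.distrib)
qed simp

definition sig :: "nat \<Rightarrow> nat \<Rightarrow> nat" where
  "sig k n = (if n = 0 then 0 else \<Sum>d | d dvd n. d ^ k)"

text \<open>Both sides count the parts of all partitions of \<open>n\<close> with their sizes as weights.\<close>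

lemma partitions_sig: "n * card (partitions n) = (\<Sum>k\<le>n. sig 1 k * card (partitions (n - k)))"
proof -
  have cnt: "card {p \<in> partitions n. j \<le> count p i} = (if i * j \<le> n then card (partitions (n - i * j)) else 0)"
    if "0 < i" for i j
  proof (cases "i * j \<le> n")
    case True
    have "bij_betw (\<lambda>p. p + replicate_mset j i) (partitions (n - i * j)) {p \<in> partitions n. j \<le> count p i}"
    proof (rule bij_betw_byWitness[where f' = "\<lambda>p. p - replicate_mset j i"])
      show "(\<lambda>p. p + replicate_mset j i) ` partitions (n -
          i * j) \<subseteq> {p \<in> partitions n. j \<le> count p i}"
        using True that by (auto simp: mem_partitions sum_mset_replicate_mset mult.commute split: if_splits)
      show "\<forall>p\<in>{p \<in> partitions n. j \<le> count p i}. p - replicate_mset j i + replicate_mset j i = p"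
        by (simp add: count_le_replicate_mset_subset_eq)
      show "(\<lambda>p. p - replicate_mset j i) ` {p \<in> partitions n. j \<le> count p i} \<subseteq> partitions (n - i * j)"
      proof clarify
        fix p assume p: "p \<in> partitions n" "j \<le> count p i"
        then have "replicate_mset j i \<subseteq># p" by (simp add: count_le_replicate_mset_subset_eq)
        then obtain r where r: "p = replicate_mset j i + r" by (metis subset_mset.le_iff_add)
        then show "p - replicate_mset j i \<in> partitions (n - i * j)"
          using p(1) by (auto simp: mem_partitions sum_mset_replicate_mset mult.commute)
      qed
    qed simp
    then show ?thesis using True by (simp add: bij_betw_same_card)
  next
    case False
    have "\<not> j \<le> count p i" if "p \<in> partitions n" for p
    proof
      assume "j \<le> count p i"
      then have "replicate_mset j i \<subseteq># p" by (simp add: count_le_replicate_mset_subset_eq)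
      then obtain r where "p = replicate_mset j i + r" by (metis subset_mset.le_iff_add)
      then show False using that False by (auto simp: mem_partitions sum_mset_replicate_mset mult.commute)
    qed
    then have "{p \<in> partitions n. j \<le> count p i} = {}" by blast
    then show ?thesis using False by (simp only: if_False card.empty)
  qed
  have inner: "(\<Sum>p\<in>partitions n. count p i) = (\<Sum>k\<le>n. if 0 < k \<and> i dvd k then card (partitions (n - k)) else 0)"
    if i: "i \<in> {1..n}" for i
  proof -
    have "count p i = (\<Sum>j\<in>{1..n}. if j \<le> count p i then 1 else 0)" if "p \<in> partitions n" for p
    proof -
      have "count p i \<le> n" using that count_le_size[of p i] size_le_sum_mset[of p] by (auto simp: mem_partitions)
      then have "{j \<in> {1..n}. j \<le> count p i} = {1..count p i}" by auto
      then show ?thesis by (simp flip: sum.inter_filter)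
    qed
    then have "(\<Sum>p\<in>partitions n. count p i) = (\<Sum>p\<in>partitions n. \<Sum>j\<in>{1..n}. if j \<le> count p i then 1 else 0)"
      by (intro sum.cong) auto
    also have "\<dots> = (\<Sum>j\<in>{1..n}. \<Sum>p\<in>partitions n. if j \<le> count p i then 1 else 0)"
      by (rule sum.swap)
    also have "\<dots> = (\<Sum>j\<in>{1..n}. card {p \<in> partitions n. j \<le> count p i})"
      by (intro sum.cong refl) (simp add: finite_partitions flip: sum.inter_filter)
    also have "\<dots> = (\<Sum>j\<in>{1..n}. if i * j \<le> n then card (partitions (n - i * j)) else 0)"
      using i cnt by (intro sum.cong) auto
    also have "\<dots> = (\<Sum>j\<in>{j \<in> {1..n}. i * j \<le> n}. card (partitions (n - i * j)))"
      by (rule sum.inter_filter[symmetric]) simp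
    \<comment> \<open>With \<open>k = i * j\<close>, summing over the number \<open>j\<close> of
      copies becomes summing over the multiples \<open>k\<close> of \<open>i\<close>.\<close>
    also have "\<dots> = (\<Sum>k\<in>{k \<in> {..n}. 0 < k \<and> i dvd k}. card (partitions (n - k)))"
    proof (rule sum.reindex_bij_witness[where i = "\<lambda>k. k div i" and j = "\<lambda>j. i * j"])
      show "k div i \<in> {j. j \<in> {1..n} \<and> i * j \<le> n}" if "k \<in> {k \<in> {..n}. 0 < k \<and> i dvd k}" for k
        using that i by (auto simp: Suc_le_eq dvd_imp_le div_greater_zero_iff intro: order_trans[OF div_le_dividend])
    qed (use i in auto)
    also have "\<dots> = (\<Sum>k\<le>n. if 0 < k \<and> i dvd k then card (partitions (n - k)) else 0)"
      by (rule sum.inter_filter) simp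
    finally show ?thesis .
  qed
  have "\<Sum>\<^sub># p = (\<Sum>i\<in>{1..n}. i * count p i)" if "p \<in> partitions n" for p
  proof -
    have "set_mset p \<subseteq> {1..n}" using that mem_le_sum_mset[of _ p] by (auto simp: mem_partitions Suc_le_eq)
    then show ?thesis by (intro sum_mset_eq_sum_count) simp
  qed
  then have "n * card (partitions n) = (\<Sum>p\<in>partitions n. \<Sum>i\<in>{1..n}. i * count p i)"
    by (simp add: mem_partitions mult.commute)
  also have "\<dots> = (\<Sum>i\<in>{1..n}. i * (\<Sum>p\<in>partitions n. count p i))"
    by (subst sum.swap) (simp add: sum_distrib_left)
  also have "\<dots> = (\<Sum>i\<in>{1..n}. \<Sum>k\<le>n. if 0 < k \<and> i dvd k then i *
      card (partitions (n - k)) else 0)"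
    using inner by (intro sum.cong refl) (simp add: sum_distrib_left if_distrib cong: if_cong)
  also have "\<dots> = (\<Sum>k\<le>n. \<Sum>i\<in>{1..n}. if 0 < k \<and> i dvd k then i *
      card (partitions (n - k)) else 0)"
    by (rule sum.swap)
  also have "\<dots> = (\<Sum>k\<le>n. sig 1 k * card (partitions (n - k)))"
  proof (intro sum.cong refl)
    fix k assume "k \<in> {..n}"
    show "(\<Sum>i\<in>{1..n}. if 0 < k \<and> i dvd k then i * card (partitions (n - k)) else 0) =
        sig 1 k * card (partitions (n - k))"
    proof (cases "k = 0")
      case False
      have "{i \<in> {1..n}. i dvd k} = {d. d dvd k}"
        using False \<open>k \<in> {..n}\<close> by (auto dest: dvd_imp_le intro: Suc_leI dvd_pos_nat)
      then show ?thesis using False by (simp add: sig_def sum_distrib_right flip: sum.inter_filter)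
    qed (simp add: sig_def)
  qed
  finally show ?thesis .
qed

section \<open>Generating functions in two variables\<close>

definition qd :: "'a::comm_ring_1 fps \<Rightarrow> 'a fps" where
  "qd f = fps_X * fps_deriv f"

lemma qd_nth [simp]: "qd f $ n = of_nat n * f $ n"
  by (cases n) (simp_all add: qd_def)

lemma qd_mult: "qd (f * g) = qd f * g + f * qd g"
  by (simp add: qd_def algebra_simps)

lemma qd_add: "qd (f + g) = qd f + qd g" and qd_diff: "qd (f - g) = qd f - qd g"
  and qd_uminus: "qd (- f) = - qd f" and qd_0: "qd 0 = 0" and qd_1: "qd 1 = 0"
  and qd_const: "qd (fps_const c) = 0"
  by (simp_all add: qd_def algebra_simps)

lemma qd_numeral: "qd (numeral k) = 0"
  unfolding qd_def by simp

lemma qd_X_power: "qd (fps_X ^ a) = of_nat a * fps_X ^ a"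
  by (rule fps_ext) (auto simp: fps_X_power_nth simp flip: fps_of_nat)

text \<open>The coefficient of \<open>x\<^sup>i y\<^sup>n\<close> of a series in \<open>x\<close> and \<open>y\<close> is \<open>f $ n $ i\<close>. In terms of
  \<open>q = x y\<close> and \<open>z = x\<close> this monomial is \<open>z\<^bsup>i - n\<^esup> q\<^sup>n\<close>; \<open>zcoeff f a\<close> is the coefficient of \<open>z\<^sup>a\<close>.
  Exchanging \<open>x\<close> and \<open>y\<close> is the substitution \<open>z \<mapsto> q / z\<close>.\<close>

definition zcoeff :: "int fps fps \<Rightarrow> int \<Rightarrow> int fps" where
  "zcoeff f a = Abs_fps (\<lambda>n. if a + int n < 0 then 0 else f $ n $ nat (a + int n))"

definition swap :: "int fps fps \<Rightarrow> int fps fps" where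
  "swap f = Abs_fps (\<lambda>i. Abs_fps (\<lambda>n. f $ n $ i))"

text \<open>A series in \<open>int poly fps\<close> has finitely many powers of z at each power of
  q, so it can be evaluated at z = 1. The factor 1 / (1 - z) exists only in the larger ring.\<close>

definition emb :: "int poly fps \<Rightarrow> int fps fps" where
  "emb Y = Abs_fps (\<lambda>n. fps_of_poly (Y $ n))"

text \<open>A series in q = x y alone, hence the equal exponents.\<close>

definition lift :: "int fps \<Rightarrow> int poly fps" where
  "lift k = Abs_fps (\<lambda>n. monom (k $ n) n)"

text \<open>The derivation z d/dz, which multiplies by the exponent \<open>i - n\<close> of
  z.\<close>

definition zd :: "int fps fps \<Rightarrow> int fps fps" where
  "zd f = Abs_fps (\<lambda>n. fps_X * fps_deriv (f $ n) - of_nat n * f $ n)"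

definition zdp :: "int poly fps \<Rightarrow> int poly fps" where
  "zdp Y = Abs_fps (\<lambda>n. [:0, 1:] * pderiv (Y $ n) - of_nat n * Y $ n)"

definition ev1 :: "int poly fps \<Rightarrow> int fps" where
  "ev1 Y = Abs_fps (\<lambda>n. poly (Y $ n) 1)"

definition xx :: "int poly fps" where
  "xx = fps_const [:0, 1:]"

abbreviation row :: "(nat \<Rightarrow> int) \<Rightarrow> int fps fps" where
  "row t \<equiv> fps_const (Abs_fps t)"

lemma swap_nth [simp]: "swap f $ i $ n = f $ n $ i"
  by (simp add: swap_def)

lemma emb_nth [simp]: "emb Y $ n $ i = coeff (Y $ n) i"
  by (simp add: emb_def)

lemma lift_nth [simp]: "coeff (lift k $ n) i = (if i = n then k $ n else 0)"
  by (simp add: lift_def)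

lemma zd_nth [simp]: "zd f $ n $ i = (int i - int n) * f $ n $ i"
  by (cases i) (simp_all add: zd_def algebra_simps flip: fps_of_nat)

lemma zdp_nth [simp]: "coeff (zdp Y $ n) i = (int i - int n) * coeff (Y $ n) i"
  by (cases i) (simp_all add: zdp_def coeff_pderiv algebra_simps of_nat_poly)

lemma ev1_nth [simp]: "ev1 Y $ n = poly (Y $ n) 1"
  by (simp add: ev1_def)

lemma zcoeff_nth: "zcoeff f a $ n = (if a + int n < 0 then 0 else f $ n $ nat (a + int n))"
  by (simp add: zcoeff_def)

lemma nth_zcoeff: "f $ n $ i = zcoeff f (int i - int n) $ n"
  by (simp add: zcoeff_nth)

lemma fps2_eqI: "(\<And>n i. f $ n $ i = g $ n $ i) \<Longrightarrow> f = g" for f g :: "'a::zero fps fps"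
  by (simp add: fps_eq_iff)

lemma fpsp_eqI: "(\<And>n i. coeff (f $ n) i = coeff (g $ n) i) \<Longrightarrow> f = g" for f g :: "'a::zero poly fps"
  by (simp add: fps_eq_iff poly_eq_iff)

lemma zcoeff_eqI: "(\<And>a. zcoeff f a = zcoeff g a) \<Longrightarrow> f = g"
  by (rule fps2_eqI) (simp only: nth_zcoeff[of f] nth_zcoeff[of g])

lemma zcoeff_add: "zcoeff (f + g) a = zcoeff f a + zcoeff g a"
  and zcoeff_diff: "zcoeff (f - g) a = zcoeff f a - zcoeff g a"
  and zcoeff_uminus: "zcoeff (- f) a = - zcoeff f a"
  and zcoeff_0: "zcoeff 0 a = 0"
  by (auto simp: fps_eq_iff zcoeff_nth)

lemma zcoeff_zd: "zcoeff (zd f) a = of_int a * zcoeff f a"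
  by (rule fps_ext) (auto simp: zcoeff_nth simp flip: fps_of_int)

lemma fps2_mult_nth: "(f * g) $ n $ i = (\<Sum>k\<le>n. \<Sum>l\<le>i. f $ k $ l * g $ (n - k) $ (i - l))"
  for f g :: "'a::comm_ring_1 fps fps"
  by (simp add: fps_mult_nth fps_sum_nth atLeast0AtMost)

lemma of_nat_fps_mult_nth: "(of_nat m * f) $ n = of_nat m * f $ n" for f :: "'a::comm_ring_1 fps"
  by (simp flip: fps_of_nat)

lemma numeral_fps_mult_nth: "(numeral m * f) $ n = numeral m * f $ n" for f :: "'a::comm_ring_1 fps"
  by (simp add: numeral_fps_const)

lemma of_int_fps_mult_nth: "(of_int m * f) $ n = of_int m * f $ n" for f :: "'a::comm_ring_1 fps"
  by (simp flip: fps_of_int)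

lemma zcoeff_qd: "zcoeff (qd f) a = qd (zcoeff f a)"
  by (rule fps_ext) (auto simp: zcoeff_nth of_nat_fps_mult_nth)

lemma zcoeff_numeral: "zcoeff (numeral m * f) a = numeral m * zcoeff f a"
  by (rule fps_ext) (auto simp: zcoeff_nth numeral_fps_mult_nth)

lemma swap_mult: "swap (f * g) = swap f * swap g"
  by (rule fps2_eqI) (simp add: fps2_mult_nth, rule sum.swap)

lemma swap_add: "swap (f + g) = swap f + swap g"
  and swap_diff: "swap (f - g) = swap f - swap g"
  and swap_uminus: "swap (- f) = - swap f"
  by (auto intro!: fps2_eqI)

lemma swap_zd: "swap (zd f) = - zd (swap f)"
  by (rule fps2_eqI) (simp add: algebra_simps)

text \<open>The substitution z -> q/z moves q as well, and the chain rule produces the summand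
  \<open>zd\<close>.\<close>

lemma swap_qd: "swap (qd f) = qd (swap f) + zd (swap f)"
  by (rule fps2_eqI) (simp add: algebra_simps of_nat_fps_mult_nth)

lemma swap_numeral: "swap (numeral m * f) = numeral m * swap f"
  by (rule fps2_eqI) (simp add: numeral_fps_mult_nth)

lemma zcoeff_swap: "zcoeff (swap f) (- int a) = fps_X ^ a * zcoeff f (int a)"
  by (rule fps_ext) (auto simp: zcoeff_nth fps_X_power_mult_nth nat_diff_distrib nat_add_distrib)

lemma emb_add: "emb (Y + Z) = emb Y + emb Z"
  and emb_diff: "emb (Y - Z) = emb Y - emb Z"
  and emb_uminus: "emb (- Y) = - emb Y"
  and emb_0: "emb 0 = 0"
  by (auto intro!: fps2_eqI)

lemma emb_1: "emb 1 = 1"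
  by (rule fps_ext) (simp add: emb_def fps_of_poly_1')

lemma emb_mult: "emb (Y * Z) = emb Y * emb Z"
  by (rule fps_ext) (simp add: emb_def fps_mult_nth fps_of_poly_sum fps_of_poly_mult)

lemma emb_numeral: "emb (numeral k) = numeral k"
  by (rule fps_ext) (simp add: emb_def numeral_fps_const fps_of_poly_numeral)

lemma emb_power: "emb (Y ^ k) = emb Y ^ k"
  by (induction k) (simp_all add: emb_1 emb_mult)

lemma emb_inject: "emb Y = emb Z \<longleftrightarrow> Y = Z"
proof
  assume eq: "emb Y = emb Z"
  show "Y = Z"
    by (rule fpsp_eqI) (simp only: emb_nth[symmetric] eq)
qed simp

lemma emb_xx: "emb xx = fps_const fps_X"
  by (rule fps2_eqI) (simp add: xx_def coeff_pCons fps_X_nth split: nat.split)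

lemma emb_zdp: "emb (zdp Y) = zd (emb Y)"
  by (rule fps2_eqI) simp

lemma emb_qd: "emb (qd Y) = qd (emb Y)"
  by (rule fps2_eqI) (simp add: of_nat_poly of_nat_fps_mult_nth)

lemma zd_add: "zd (f + g) = zd f + zd g"
  and zd_diff: "zd (f - g) = zd f - zd g"
  and zd_uminus: "zd (- f) = - zd f"
  by (auto intro!: fps2_eqI simp: algebra_simps)

lemma zd_mult: "zd (f * g) = zd f * g + f * zd g"
proof (rule fps2_eqI)
  fix n i
  have "zd (f * g) $ n $ i = (\<Sum>k\<le>n. \<Sum>l\<le>i. (int i - int n) * (f $ k $ l * g $ (n - k) $ (i - l)))"
    by (simp add: fps2_mult_nth sum_distrib_left)
  also have "\<dots> = (\<Sum>k\<le>n. \<Sum>l\<le>i. ((int l - int k) * f $ k $ l) * g $ (n - k) $ (i - l)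
     + f $ k $ l * ((int (i - l) - int (n - k)) * g $ (n - k) $ (i - l)))"
    by (intro sum.cong refl) (simp add: algebra_simps of_nat_diff)
  also have "\<dots> = (zd f * g + f * zd g) $ n $ i"
    by (simp add: fps2_mult_nth sum.distrib)
  finally show "zd (f * g) $ n $ i = (zd f * g + f * zd g) $ n $ i" .
qed

lemma zd_numeral: "zd (numeral m * f) = numeral m * zd f"
  by (rule fps2_eqI) (simp add: numeral_fps_mult_nth)

lemma zdp_add: "zdp (Y + Z) = zdp Y + zdp Z"
  and zdp_diff: "zdp (Y - Z) = zdp Y - zdp Z"
  by (auto intro!: fpsp_eqI simp: algebra_simps)

lemma zdp_mult: "zdp (Y * Z) = zdp Y * Z + Y * zdp Z"
  by (simp flip: emb_inject add: emb_zdp emb_mult emb_add zd_mult)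

lemma zdp_xx: "zdp xx = xx"
  by (rule fpsp_eqI) (auto simp: xx_def coeff_pCons split: nat.split)

lemma zdp_lift: "zdp (lift k) = 0"
  by (rule fpsp_eqI) simp

lemma zdp_qd: "zdp (qd Y) = qd (zdp Y)"
  by (rule fpsp_eqI) (simp add: of_nat_poly)

lemma zcoeff_lift: "zcoeff (emb (lift k) * f) a = k * zcoeff f a"
proof (rule fps_ext)
  fix n
  have *: "(emb (lift k) * f) $ n $ i = (\<Sum>j\<le>n. if j \<le> i then k $ j * f $ (n - j) $ (i - j) else 0)" for i
    by (simp add: fps2_mult_nth if_distrib if_distribR sum.delta' cong: if_cong)
  have "(if a + int n < 0 then 0 else (emb (lift k) * f) $ n $ nat (a + int n)) =
      (\<Sum>j\<le>n. k $ j * zcoeff f a $ (n - j))"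
  proof (cases "a + int n < 0")
    case True
    then show ?thesis by (auto simp: zcoeff_nth intro!: sum.neutral)
  next
    case False
    define i where "i = nat (a + int n)"
    have i: "a + int n = int i" using False by (simp add: i_def)
    have "(if j \<le> i then k $ j * f $ (n - j) $ (i - j) else 0) = k $ j * zcoeff f a $ (n - j)" if "j \<le> n" for j
    proof -
      have a: "a + int (n - j) = int i - int j" using that i by simp
      show ?thesis unfolding zcoeff_nth a by (auto simp: nat_diff_distrib)
    qed
    then have "(emb (lift k) * f) $ n $ i = (\<Sum>j\<le>n. k $ j * zcoeff f a $ (n - j))"
      unfolding * by (intro sum.cong refl) simp
    then show ?thesis using False by (simp add: i_def)
  qed
  then have "zcoeff (emb (lift k) * f) a $ n = (\<Sum>j\<le>n. k $ j * zcoeff f a $ (n - j))"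
    by (simp add: zcoeff_nth)
  then show "zcoeff (emb (lift k) * f) a $ n = (k * zcoeff f a) $ n"
    by (simp add: fps_mult_nth atLeast0AtMost)
qed

lemma swap_lift: "swap (emb (lift k)) = emb (lift k)"
  by (rule fps2_eqI) simp

lemma zcoeff_xx: "zcoeff (emb xx * f) a = zcoeff f (a - 1)"
proof (rule fps_ext)
  fix n
  have "(emb xx * f) $ n $ i = (if i = 0 then 0 else f $ n $ (i - 1))" for i
    by (simp add: emb_xx)
  then show "zcoeff (emb xx * f) a $ n = zcoeff f (a - 1) $ n"
    by (auto simp: zcoeff_nth intro!: arg_cong[where f = "\<lambda>k. f $ n $ k"])
qed

section \<open>Evaluation at z = 1 and symmetry under z -> 1/z\<close>

lemma ev1_add: "ev1 (Y + Z) = ev1 Y + ev1 Z"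
  and ev1_diff: "ev1 (Y - Z) = ev1 Y - ev1 Z"
  and ev1_uminus: "ev1 (- Y) = - ev1 Y"
  and ev1_0: "ev1 0 = 0"
  by (auto intro!: fps_ext)

lemma ev1_1: "ev1 1 = 1"
  by (rule fps_ext) simp

lemma ev1_mult: "ev1 (Y * Z) = ev1 Y * ev1 Z"
  by (rule fps_ext) (simp add: fps_mult_nth poly_sum)

lemma ev1_numeral: "ev1 (numeral k) = numeral k"
  by (rule fps_ext) (simp add: numeral_fps_const)

lemma ev1_power: "ev1 (Y ^ k) = ev1 Y ^ k"
  by (induction k) (simp_all add: ev1_1 ev1_mult)

lemma ev1_xx: "ev1 xx = 1"
  by (rule fps_ext) (simp add: xx_def)

lemma ev1_lift: "ev1 (lift k) = k"
  by (rule fps_ext) (simp add: lift_def poly_monom)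

lemma ev1_qd: "ev1 (qd Y) = qd (ev1 Y)"
  by (rule fps_ext) simp

lemma poly_1_eq_sum: "degree p \<le> N \<Longrightarrow> poly p 1 =
    (\<Sum>i\<le>N. coeff p i)" for p :: "'a::comm_ring_1 poly"
  by (simp add: poly_altdef sum.mono_neutral_left coeff_eq_0)

text \<open>\<open>sym e Y\<close> says that \<open>Y\<close> is a Laurent series in \<open>z\<close> and \<open>q\<close> with \<open>Y(1/z) = e Y(z)\<close>.\<close>

definition psym :: "int \<Rightarrow> nat \<Rightarrow> int poly \<Rightarrow> bool" where
  "psym e n p \<longleftrightarrow> (\<forall>i. coeff p i = (if i \<le> 2 * n then e * coeff p (2 * n - i) else 0))"

definition sym :: "int \<Rightarrow> int poly fps \<Rightarrow> bool" where
  "sym e Y \<longleftrightarrow> (\<forall>n. psym e n (Y $ n))"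

lemma psym_coeff: "psym e n p \<Longrightarrow> coeff p i = (if i \<le> 2 * n then e * coeff p (2 * n - i) else 0)"
  unfolding psym_def by (rule spec)

lemma psym_zero: "psym e n p \<Longrightarrow> 2 * n < i \<Longrightarrow> coeff p i = 0"
  by (drule psym_coeff[of _ _ _ i]) simp

lemma psym_degree: "psym e n p \<Longrightarrow> degree p \<le> 2 * n"
  using psym_zero by (intro degree_le) blast

lemma psym_reflect: "psym e n p \<Longrightarrow> i \<le> 2 * n \<Longrightarrow> coeff p (2 * n - i) = e * coeff p i"
  unfolding psym_def by (metis diff_diff_cancel diff_le_self)

lemma psym_0: "psym e n 0"
  by (simp add: psym_def)

lemma psym_add:
  assumes "psym e n p" "psym e n r"
  shows "psym e n (p + r)"
  unfolding psym_def
proof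
  fix i
  show "coeff (p + r) i = (if i \<le> 2 * n then e * coeff (p + r) (2 * n - i) else 0)"
    using psym_coeff[OF assms(1), of i] psym_coeff[OF assms(2), of i]
    by (cases "i \<le> 2 * n") (simp_all only: if_True if_False coeff_add distrib_left simp_thms)
qed

lemma psym_sum: "(\<And>i. i \<in> A \<Longrightarrow> psym e n (f i)) \<Longrightarrow> psym e n (\<Sum>i\<in>A. f i)"
  by (induction A rule: infinite_finite_induct) (auto intro: psym_0 psym_add)

lemma psym_mult:
  assumes p: "psym e k p" and r: "psym e' l r"
  shows "psym (e * e') (k + l) (p * r)"
proof -
  \<comment> \<open>Summation over the whole range up to \<open>2 * k\<close>, independent of
    \<open>i\<close>, can be reversed by \<open>s \<mapsto> 2 * k - s\<close>.\<close>
  have box: "coeff (p * r) i = (\<Sum>s\<le>2 * k. if s \<le> i then coeff p s * coeff r (i - s) else 0)" for i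
  proof -
    have "coeff (p * r) i = (\<Sum>s\<le>i. coeff p s * coeff r (i - s))"
      by (simp add: coeff_mult)
    also have "\<dots> = (\<Sum>s\<in>{s \<in> {..2 * k}. s \<le> i}. coeff p s * coeff r (i - s))"
      by (intro sum.mono_neutral_right) (auto, metis not_le psym_zero[OF p])
    finally show ?thesis by (simp flip: sum.inter_filter)
  qed
  have A: "coeff (p * r) i = e * e' * coeff (p * r) (2 * (k + l) - i)" if i: "i \<le> 2 * (k + l)" for i
  proof -
    let ?g = "\<lambda>i s. if s \<le> i then coeff p s * coeff r (i - s) else 0"
    have "(\<Sum>s\<le>2 * k. ?g i s) = (\<Sum>s\<le>2 * k. ?g i (2 * k - s))"
      by (rule sum.reindex_bij_witness[where i = "\<lambda>s. 2 * k - s" and j = "\<lambda>s. 2 * k - s"]) auto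
    also have "\<dots> = (\<Sum>s\<le>2 * k. e * e' * ?g (2 * (k + l) - i) s)"
    proof (intro sum.cong refl)
      fix s assume s: "s \<in> {..2 * k}"
      have ps: "coeff p (2 * k - s) = e * coeff p s" using psym_reflect[OF p] s by simp
      consider "i < 2 * k - s" | "2 * k - s \<le> i" "i - (2 * k - s) \<le> 2 * l" | "2 * k -
          s \<le> i" "2 * l < i - (2 * k - s)"
        by linarith
      then show "?g i (2 * k - s) = e * e' * ?g (2 * (k + l) - i) s"
      proof cases
        case 1
        then have "coeff r (2 * (k + l) - i - s) = 0" using s by (intro psym_zero[OF r]) auto
        then show ?thesis using 1 by simp
      next
        case 2
        have eq: "2 * (k + l) - i - s = 2 * l - (i - (2 * k - s))" using 2 s i by auto
        have le: "s \<le> 2 * (k + l) - i" using 2 s i by auto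
        have r1: "coeff r (i - (2 * k - s)) = e' * coeff r (2 * (k + l) - i - s)"
          unfolding eq using psym_coeff[OF r, of "i - (2 * k - s)"] 2(2) by (simp only: if_True)
        show ?thesis unfolding if_P[OF 2(1)] if_P[OF le] r1 ps by (simp only: mult_ac)
      next
        case 3
        then have "coeff r (i - (2 * k - s)) = 0" by (intro psym_zero[OF r]) auto
        moreover have "\<not> s \<le> 2 * (k + l) - i" using 3 s i by auto
        ultimately show ?thesis by simp
      qed
    qed
    finally show ?thesis by (simp only: box sum_distrib_left)
  qed
  have B: "coeff (p * r) i = 0" if "\<not> i \<le> 2 * (k + l)" for i
    using psym_degree[OF p] psym_degree[OF r] degree_mult_le[of p r] that by (intro coeff_eq_0) simp
  show ?thesis unfolding psym_def
  proof
    fix i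
    show "coeff (p * r) i = (if i \<le> 2 * (k + l) then e * e' * coeff (p * r) (2 * (k + l) - i) else 0)"
      using A[of i] B[of i] by (cases "i \<le> 2 * (k + l)") (simp_all only: if_True if_False simp_thms)
  qed
qed

lemma sym_mult: "sym e Y \<Longrightarrow> sym e' Z \<Longrightarrow> sym (e * e') (Y * Z)"
  unfolding sym_def fps_mult_nth
  by (intro allI psym_sum) (metis (no_types, lifting) atLeastAtMost_iff le_add_diff_inverse psym_mult)

lemma sym_add: "sym e Y \<Longrightarrow> sym e Z \<Longrightarrow> sym e (Y + Z)"
  by (simp add: sym_def psym_add)

lemma sym_uminus:
  assumes "sym e Y"
  shows "sym e (- Y)"
  unfolding sym_def psym_def
proof (intro allI)
  fix n i
  show "coeff ((- Y) $ n) i = (if i \<le> 2 * n then e * coeff ((- Y) $ n) (2 * n - i) else 0)"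
    using psym_coeff[of e n "Y $ n" i] assms unfolding sym_def by (cases "i \<le> 2 * n") auto
qed

lemma sym_diff: "sym e Y \<Longrightarrow> sym e Z \<Longrightarrow> sym e (Y - Z)"
  using sym_add[of e Y "- Z"] sym_uminus[of e Z] by simp

lemma sym_zdp:
  assumes "sym e Y"
  shows "sym (- e) (zdp Y)"
  unfolding sym_def psym_def
proof (intro allI)
  fix n i
  show "coeff (zdp Y $ n) i = (if i \<le> 2 * n then - e * coeff (zdp Y $ n) (2 * n - i) else 0)"
    using psym_coeff[of e n "Y $ n" i] assms unfolding sym_def zdp_nth
    by (cases "i \<le> 2 * n") (auto simp: of_nat_diff algebra_simps)
qed

lemma sym_qd:
  assumes "sym e Y"
  shows "sym e (qd Y)"
  unfolding sym_def psym_def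
proof (intro allI)
  fix n i
  show "coeff (qd Y $ n) i = (if i \<le> 2 * n then e * coeff (qd Y $ n) (2 * n - i) else 0)"
    using psym_coeff[of e n "Y $ n" i] assms unfolding sym_def
    by (cases "i \<le> 2 * n") (auto simp: of_nat_poly)
qed

lemma sym_lift: "sym 1 (lift k)"
  by (auto simp: sym_def psym_def)

lemma sym_zcoeff:
  assumes "sym e Y"
  shows "zcoeff (emb Y) (- a) = of_int e * zcoeff (emb Y) a"
proof (rule fps_ext)
  fix n
  have p: "psym e n (Y $ n)" using assms by (simp add: sym_def)
  show "zcoeff (emb Y) (- a) $ n = (of_int e * zcoeff (emb Y) a) $ n"
  proof (cases "\<bar>a\<bar> \<le> int n")
    case True
    then have "nat (- a + int n) = 2 * n - nat (a + int n)" "nat (a + int n) \<le> 2 * n"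
      "\<not> a + int n < 0" "\<not> - a + int n < 0" by auto
    then show ?thesis using True psym_reflect[OF p, of "nat (a + int n)"]
      by (simp add: zcoeff_nth of_int_fps_mult_nth)
  next
    case False
    then have "2 * n < nat (a + int n) \<or> a + int n < 0" "2 * n < nat (- a + int n) \<or> - a + int n < 0" by auto
    then show ?thesis
      by (auto simp: zcoeff_nth of_int_fps_mult_nth psym_zero[OF p])
  qed
qed

lemma sym_ev1_0: "sym (-1) Y \<Longrightarrow> ev1 Y = 0"
proof (rule fps_ext)
  fix n assume "sym (-1) Y"
  then have p: "psym (-1) n (Y $ n)" by (simp add: sym_def)
  have "(\<Sum>i\<le>2 * n. coeff (Y $ n) i) = (\<Sum>i\<le>2 * n. coeff (Y $ n) (2 * n - i))"
    by (rule sum.reindex_bij_witness[where i = "\<lambda>s. 2 * n - s" and j = "\<lambda>s. 2 * n - s"]) auto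
  also have "\<dots> = - (\<Sum>i\<le>2 * n. coeff (Y $ n) i)"
    using psym_reflect[OF p] by (simp add: sum_negf[symmetric])
  finally show "ev1 Y $ n = 0 $ n"
    using poly_1_eq_sum[OF psym_degree[OF p]] by simp
qed

section \<open>Products with a series in z alone\<close>

definition ext0 :: "(nat \<Rightarrow> int) \<Rightarrow> int \<Rightarrow> int" where
  "ext0 t j = (if j < 0 then 0 else t (nat j))"

lemma zcoeff_row:
  assumes "sym e Y"
  shows "zcoeff (emb Y * row t) a $ n = (\<Sum>i\<le>2 * n. coeff (Y $ n) i * ext0 t (a + int n - int i))"
proof -
  have p: "psym e n (Y $ n)" using assms by (simp add: sym_def)
  have "(emb Y * row t) $ n $ j = (\<Sum>i\<le>2 * n. coeff (Y $ n) i * ext0 t (int j - int i))" for j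
  proof -
    have "(emb Y * row t) $ n $ j = (\<Sum>i\<le>j. coeff (Y $ n) i * t (j - i))"
    proof -
      have "(emb Y * row t) $ n = emb Y $ n * Abs_fps t" by simp
      then show ?thesis by (simp add: fps_mult_nth atLeast0AtMost)
    qed
    also have "\<dots> = (\<Sum>i\<in>{i \<in> {..2 * n}. i \<le> j}. coeff (Y $ n) i * t (j - i))"
      by (intro sum.mono_neutral_right) (auto, metis not_le psym_zero[OF p])
    also have "\<dots> = (\<Sum>i\<le>2 * n. if i \<le> j then coeff (Y $ n) i * t (j - i) else 0)"
      by (simp flip: sum.inter_filter)
    also have "\<dots> = (\<Sum>i\<le>2 * n. coeff (Y $ n) i * ext0 t (int j - int i))"
      by (intro sum.cong refl) (auto simp: ext0_def nat_diff_distrib)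
    finally show ?thesis .
  qed
  note * = this
  show ?thesis
  proof (cases "a + int n < 0")
    case True
    then show ?thesis by (auto simp: zcoeff_nth ext0_def intro!: sum.neutral)
  next
    case False
    then have "int (nat (a + int n)) = a + int n" by simp
    then show ?thesis using *[of "nat (a + int n)"] False by (simp only: zcoeff_nth if_False)
  qed
qed

lemma zcoeff_row_reflect:
  assumes "sym e Y"
  shows "zcoeff (emb Y * row t) (- s - a) $ n
    = e * (\<Sum>i\<le>2 * n. coeff (Y $ n) i * ext0 t (- s - (a + int n - int i)))"
proof -
  have p: "psym e n (Y $ n)" using assms by (simp add: sym_def)
  have "zcoeff (emb Y * row t) (- s - a) $ n = (\<Sum>i\<le>2 * n. coeff (Y $ n) (2 * n - i) * ext0 t (- s -
      a + int n - int (2 * n - i)))"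
    unfolding zcoeff_row[OF assms]
    by (rule sum.reindex_bij_witness[where i = "\<lambda>s. 2 * n - s" and j = "\<lambda>s. 2 * n - s"]) auto
  also have "\<dots> = (\<Sum>i\<le>2 * n. e * (coeff (Y $ n) i * ext0 t (- s - (a + int n - int i))))"
    using psym_reflect[OF p] by (intro sum.cong refl) (simp add: of_nat_diff algebra_simps)
  finally show ?thesis by (simp add: sum_distrib_left)
qed

text \<open>The principle behind all identities below: the two involutions \<open>z \<mapsto> q / z\<close> and \<open>z \<mapsto> 1 / z\<close>
  generate \<open>z \<mapsto> q z\<close>, and a Laurent series invariant under the latter is independent of \<open>z\<close>.\<close>

lemma zcoeff_vanish:
  assumes swap: "\<And>n i. f $ i $ n = e * f $ n $ i"
    and inv: "\<And>b. zcoeff f (- b) = of_int e * zcoeff f b"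
    and e: "e = 1 \<or> e = -1" and "a \<noteq> 0"
  shows "zcoeff f a = 0"
proof -
  \<comment> \<open>The two involutions together tie the coefficient of z^b q^n to that of z^b q^(n
    - b), and this descent ends at negative powers of q, where coefficients vanish.\<close>
  have pos: "f $ n $ (n + b) = 0" if "0 < b" for n b
  proof (induction n rule: less_induct)
    case (less n)
    have "zcoeff f (int b) $ n = e * zcoeff f (- int b) $ n"
      using e by (auto simp: inv of_int_fps_mult_nth)
    also have "zcoeff f (- int b) $ n = 0"
    proof (cases "n < b")
      case False
      then obtain m where n: "n = m + b" by (metis add.commute le_Suc_ex not_less)
      have "f $ n $ m = e * f $ m $ n" by (rule swap)
      also have "f $ m $ n = 0" using less[of m] n that by simp
      finally show ?thesis using n by (simp add: zcoeff_nth)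
    qed (simp add: zcoeff_nth)
    finally show ?case by (simp add: zcoeff_nth nat_add_distrib add.commute)
  qed
  have pos': "zcoeff f (int b) = 0" if "0 < b" for b
    using pos[OF that] by (intro fps_ext) (simp add: zcoeff_nth nat_add_distrib add.commute)
  show ?thesis
  proof (cases "0 < a")
    case True
    then show ?thesis using pos'[of "nat a"] by simp
  next
    case False
    then show ?thesis using pos'[of "nat (- a)"] inv[of "- a"] \<open>a \<noteq> 0\<close> by simp
  qed
qed

section \<open>The logarithmic derivative of the theta function\<close>

definition genP :: "int fps" where
  "genP = Abs_fps (\<lambda>n. int (card (partitions n)))"

definition Phi :: "nat \<Rightarrow> int fps" where
  "Phi k = Abs_fps (\<lambda>n. int (sig k n))"

lemma genP_nth: "genP $ n = int (card (partitions n))"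
  by (simp add: genP_def)

lemma qd_genP: "qd genP = Phi 1 * genP"
proof (rule fps_ext)
  fix n
  have "int (n * card (partitions n)) = int (\<Sum>k\<le>n. sig 1 k * card (partitions (n - k)))"
    by (simp only: partitions_sig)
  then show "qd genP $ n = (Phi 1 * genP) $ n"
    by (simp add: fps_mult_nth Phi_def genP_def atLeast0AtMost)
qed

text \<open>The Lambert series with summands z q^m / (1 - z q^m) for m >= 0 and -(q^m / z) / (1 -
  q^m / z) for m >= 1: z d/dz applied to minus the logarithm of the theta product over the factors 1
  - z q^m and 1 - q^m / z. Since \<open>i - n\<close> divides \<open>n\<close> iff it divides
  \<open>i\<close>, exchanging x and y only changes the sign.\<close>

definition xi :: "int fps fps" where
  "xi = Abs_fps (\<lambda>n. Abs_fps (\<lambda>i. if (int i - int n) dvd int n then sgn (int i - int n) else 0))"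

text \<open>The row \<open>n = 0\<close>, which contains the pole x / (1 - x) at z = 1, is omitted;
  the rest has finitely many powers of z in each row.\<close>

definition Lam :: "int poly fps" where
  "Lam = Abs_fps (\<lambda>n. if n = 0 then 0 else \<Sum>i\<le>2 * n. monom (xi $ n $ i) i)"

definition beta :: "int fps fps" where
  "beta = row (\<lambda>i. if i = 0 then 0 else 1)"

definition geo :: "int fps fps" where
  "geo = row (\<lambda>_. 1)"

lemma xi_nth: "xi $ n $ i = (if (int i - int n) dvd int n then sgn (int i - int n) else 0)"
  by (simp add: xi_def)

lemma coeff_sum_monom: "coeff (\<Sum>i\<le>N. monom (f i) i) j = (if j \<le> N then f j else 0)"
  by (simp add: coeff_sum)

lemma Lam_nth: "coeff (Lam $ n) i = (if n = 0 then 0 else xi $ n $ i)"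
proof (cases "n = 0 \<or> i \<le> 2 * n")
  case True
  then show ?thesis by (auto simp: Lam_def coeff_sum_monom)
next
  case False
  have "\<not> (int i - int n) dvd int n"
  proof
    assume "(int i - int n) dvd int n"
    then have "int i - int n \<le> int n" using False by (intro zdvd_imp_le) auto
    then show False using False by simp
  qed
  then show ?thesis using False by (simp add: Lam_def coeff_sum_monom xi_nth)
qed

lemma xi_eq: "xi = beta + emb Lam"
  by (rule fps2_eqI) (auto simp: Lam_nth xi_nth beta_def)

lemma swap_xi: "swap xi = - xi"
proof (rule fps2_eqI)
  fix n i
  have "(int i - int n) dvd int n \<longleftrightarrow> (int n - int i) dvd int i"
  proof -
    have "(int i - int n) dvd int n \<longleftrightarrow> (int i - int n) dvd (int n + (int i - int n))"
      by (simp only: dvd_add_triv_right_iff)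
    also have "\<dots> \<longleftrightarrow> - (int i - int n) dvd int i" by (simp only: minus_dvd_iff) simp
    finally show ?thesis by simp
  qed
  moreover have "sgn (int n - int i) = - sgn (int i - int n)" by (simp add: sgn_if)
  ultimately show "swap xi $ n $ i = (- xi) $ n $ i" by (simp add: xi_nth)
qed

lemma sym_Lam: "sym (-1) Lam"
  unfolding sym_def psym_def
proof (intro allI)
  fix n i
  show "coeff (Lam $ n) i = (if i \<le> 2 * n then - 1 * coeff (Lam $ n) (2 * n - i) else 0)"
  proof (cases "i \<le> 2 * n")
    case True
    then have e: "int (2 * n - i) - int n = - (int i - int n)" by simp
    have "sgn (- (int i - int n)) = - sgn (int i - int n)" by (simp add: sgn_if)
    then show ?thesis using True unfolding Lam_nth xi_nth e minus_dvd_iff by simp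
  next
    case False
    then show ?thesis by (auto simp: Lam_def coeff_sum_monom)
  qed
qed

lemma geo_inverse: "(1 - emb xx) * geo = 1"
proof -
  have "(1 - fps_X) * Abs_fps (\<lambda>_. 1) = (1 :: int fps)"
    by (rule fps_ext) (simp add: left_diff_distrib)
  then have "fps_const ((1 - fps_X) * Abs_fps (\<lambda>_. 1)) = (1 :: int fps fps)" by simp
  moreover have "(1 :: int fps fps) - fps_const fps_X = fps_const (1 - fps_X)"
    by (simp flip: fps_const_1_eq_1)
  ultimately show ?thesis unfolding emb_xx geo_def by (simp only: fps_const_mult)
qed

lemma zd_emb_xx: "zd (emb xx) = emb xx"
  by (simp flip: emb_zdp add: zdp_xx)

lemma zd_1: "zd 1 = 0"
  by (rule fps2_eqI) (simp add: fps_one_nth)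

lemma zd_numeral_0: "zd (numeral k) = 0"
  using zd_numeral[of k 1] by (simp add: zd_1)

lemma zd_geo: "zd geo = emb xx * geo * geo"
proof -
  have "0 = zd ((1 - emb xx) * geo)" unfolding geo_inverse zd_1 ..
  also have "\<dots> = - emb xx * geo + (1 - emb xx) * zd geo"
    by (simp add: zd_mult zd_diff zd_1 zd_emb_xx)
  finally have h: "(1 - emb xx) * zd geo = emb xx * geo" by (simp add: algebra_simps)
  have "zd geo = ((1 - emb xx) * geo) * zd geo" by (simp add: geo_inverse)
  also have "\<dots> = geo * ((1 - emb xx) * zd geo)" by (simp only: mult_ac)
  also have "\<dots> = emb xx * geo * geo" unfolding h by (simp only: mult_ac)
  finally show ?thesis .
qed

lemma swap_1: "swap 1 = 1"
  by (rule fps2_eqI) (simp add: fps_one_nth)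

lemma swap_numeral_0: "swap (numeral k) = numeral k"
  using swap_numeral[of k 1] by (simp add: swap_1)

lemma beta_eq: "beta = emb xx * geo"
  by (rule fps2_eqI) (simp add: beta_def emb_xx geo_def)

lemma beta_inverse: "(1 - emb xx) * beta = emb xx"
  using geo_inverse by (simp add: beta_eq mult.left_commute)

lemma zd_beta: "zd beta = beta + beta * beta"
  by (simp add: beta_eq zd_mult zd_emb_xx zd_geo algebra_simps)

lemma zd_beta_row: "zd beta = row (\<lambda>i. int i)"
  by (rule fps2_eqI) (auto simp: beta_def)

lemma qd_beta: "qd beta = 0"
  by (simp add: beta_def qd_const)

lemma zd_geo': "zd geo = beta * geo"
  by (simp add: zd_geo beta_eq mult_ac)

text \<open>In all applications the bracket is a polynomial in the exponent, although neither of its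
  summands is. The right-hand side then consists of moments of \<open>Y\<close>, that is, of
  derivatives at z = 1. The centre \<open>- s / 2\<close> of the reflection depends on the order of
  the pole.\<close>

lemma zcoeff_row_pair:
  assumes "sym e Y"
  shows "zcoeff (emb Y * row t) a $ n + c * zcoeff (emb Y * row t) (- s - a) $ n
    = (\<Sum>i\<le>2 * n. coeff (Y $ n) i * (ext0 t (a + int n - int i) + c * e * ext0 t (- s - (a + int n - int i))))"
  unfolding zcoeff_row_reflect[OF assms] unfolding zcoeff_row[OF assms]
  by (simp add: sum_distrib_left sum.distrib algebra_simps)

lemma sym_ev1: "sym e Y \<Longrightarrow> ev1 Y $ n = (\<Sum>i\<le>2 * n. coeff (Y $ n) i)"
  using poly_1_eq_sum[OF psym_degree[of e n "Y $ n"]] by (simp add: sym_def)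

lemma sym_ev1_zdp: "sym e Y \<Longrightarrow> ev1 (zdp Y) $ n = (\<Sum>i\<le>2 * n. coeff (Y $ n) i * (int i - int n))"
  using sym_ev1[OF sym_zdp] by (simp add: mult.commute)

lemma sym_ev1_zdp2: "sym e Y \<Longrightarrow> ev1 (zdp (zdp Y)) $ n =
    (\<Sum>i\<le>2 * n. coeff (Y $ n) i * (int i - int n)\<^sup>2)"
  using sym_ev1_zdp[OF sym_zdp] by (simp add: power2_eq_square mult_ac)

lemma fps_eq_neg_self: "f = - f \<Longrightarrow> f = 0" for f :: "int fps"
  by (simp add: fps_eq_iff)

text \<open>The heat equation of the theta function for its logarithmic derivative \<open>x / (1 - x) + Lam\<close>;
  the factor \<open>(1 - x)\<^sup>2\<close> clears the denominators.\<close>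

lemma heat:
  "(1 - xx)\<^sup>2 * (zdp (zdp Lam) - 2 * Lam * zdp Lam - 2 * qd Lam) = 2 * xx * Lam + (1 - xx\<^sup>2) * zdp Lam"
proof -
  define L where "L = emb Lam"
  define Z where "Z = zd (2 * (beta * L) + L * L) - zd (zd L) + 2 * qd L + zd L"
  \<comment> \<open>The terms in \<open>beta\<close> alone cancel by its Riccati equation
    \<open>zd_beta\<close>, so in \<open>Z\<close> the pole occurs only together with
    \<open>L\<close>.\<close>
  have Z: "Z = zd (xi * xi) - zd (zd xi) + 2 * qd xi + zd xi"
  proof -
    have "zd (beta * beta) = zd (zd beta) - zd beta" using arg_cong[OF zd_beta, of zd] by (simp add: zd_add)
    then have "zd (beta * beta) - zd (zd beta) + 2 * qd beta + zd beta = 0" by (simp add: qd_beta)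
    then show ?thesis
      by (simp add: Z_def xi_eq L_def[symmetric] zd_add qd_add algebra_simps zd_numeral)
  qed
  have "swap Z = - Z"
    unfolding Z by (simp add: swap_add swap_diff swap_zd swap_mult swap_qd swap_numeral_0 swap_xi zd_uminus qd_uminus swap_uminus algebra_simps)
  then have swp: "Z $ i $ n = -1 * Z $ n $ i" for i n
    by (metis fps_neg_nth mult_minus1 swap_nth)
  \<comment> \<open>The row of \<open>2 * beta + 1 = (1 + x) / (1 - x)\<close>, a function that is
    odd under x -> 1/x. The summand \<open>zd L\<close> of \<open>Z\<close> supplies the 1.\<close>
  define t where "t i = (if i = 0 then 1 else 2 :: int)" for i :: nat
  have row: "2 * (beta * L) + L = emb Lam * row t"
  proof -
    have "2 * beta + 1 = row t"
      by (rule fps2_eqI) (auto simp: beta_def t_def numeral_fps_mult_nth fps_one_nth numeral_fps_const)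
    then have "L * (2 * beta + 1) = emb Lam * row t" by (simp add: L_def)
    then show ?thesis by (simp add: algebra_simps)
  qed
  have s1: "zcoeff (emb Lam * row t) (- a) = zcoeff (emb Lam * row t) a" for a
  proof (rule fps_ext)
    fix n
    have "zcoeff (emb Lam * row t) a $ n + (-1) * zcoeff (emb Lam * row t) (- 0 - a) $ n
      = (\<Sum>i\<le>2 * n. coeff (Lam $ n) i * 2)"
      unfolding zcoeff_row_pair[OF sym_Lam]
      by (intro sum.cong refl) (auto simp: ext0_def t_def)
    also have "\<dots> = 2 * ev1 Lam $ n"
      using sym_ev1[OF sym_Lam] by (simp add: sum_distrib_left mult.commute)
    also have "\<dots> = 0" using sym_ev1_0[OF sym_Lam] by simp
    finally show "zcoeff (emb Lam * row t) (- a) $ n = zcoeff (emb Lam * row t) a $ n" by simp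
  qed
  have s2: "zcoeff (L * L) (- a) = zcoeff (L * L) a" for a
    using sym_zcoeff[OF sym_mult[OF sym_Lam sym_Lam], of a] by (simp add: L_def emb_mult)
  have s3: "zcoeff L (- a) = - zcoeff L a" for a
    using sym_zcoeff[OF sym_Lam, of a] by (simp add: L_def)
  have Z': "Z = zd (emb Lam * row t) + zd (L * L) - zd (zd L) + 2 * qd L"
    unfolding row[symmetric] by (simp add: Z_def zd_add)
  have inv: "zcoeff Z (- b) = of_int (-1) * zcoeff Z b" for b
    unfolding Z' by (simp add: zcoeff_add zcoeff_diff zcoeff_zd zcoeff_qd zcoeff_numeral s1 s2 s3 qd_uminus)
  have "zcoeff Z a = 0" for a
  proof (cases "a = 0")
    case True
    have "zcoeff Z 0 = - zcoeff Z 0" using inv[of 0] by simp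
    then show ?thesis using True fps_eq_neg_self by blast
  next
    case False
    then show ?thesis using zcoeff_vanish[OF swp inv] by blast
  qed
  then have "Z = 0" by (intro zcoeff_eqI) (simp add: zcoeff_0)
  then have "0 = 2 * (zd beta * L) + 2 * (beta * zd L) + 2 * (L * zd L) - zd (zd L) + 2 * qd L + zd L"
    unfolding Z_def by (simp add: zd_add zd_mult zd_numeral_0 algebra_simps)
  then have "0 = (1 - emb xx)\<^sup>2 * (2 * (zd beta * L) + 2 * (beta * zd L) + 2 * (L * zd L) - zd (zd L) +
      2 * qd L + zd L)"
    by simp
  also have "\<dots> = 2 * (((1 - emb xx)\<^sup>2 * zd beta) * L) + 2 * (((1 - emb xx)\<^sup>2 * beta) * zd L)
    + (1 - emb xx)\<^sup>2 * (2 * (L * zd L) - zd (zd L) + 2 * qd L + zd L)"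
    by (simp only: distrib_left right_diff_distrib mult_ac) (simp add: algebra_simps)
  also have "(1 - emb xx)\<^sup>2 * beta = (1 - emb xx) * emb xx"
    using beta_inverse by (simp add: power2_eq_square mult.assoc)
  also have "(1 - emb xx)\<^sup>2 * zd beta = emb xx"
  proof -
    have "(1 - emb xx)\<^sup>2 * zd beta = (1 - emb xx) * ((1 - emb xx) * beta) + ((1 -
        emb xx) * beta) * ((1 - emb xx) * beta)"
      by (simp add: zd_beta power2_eq_square algebra_simps)
    then show ?thesis unfolding beta_inverse by (simp add: algebra_simps)
  qed
  finally have "(1 - emb xx)\<^sup>2 * (zd (zd L) - 2 * L * zd L - 2 * qd L) = 2 * emb xx * L + (1 -
      (emb xx)\<^sup>2) * zd L"
    by (simp add: algebra_simps power2_eq_square)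
  then show ?thesis
    by (simp flip: emb_inject add: emb_mult emb_add emb_diff emb_1 emb_power emb_zdp emb_qd emb_numeral L_def)
qed

section \<open>The Weierstrass function\<close>

definition wp :: "int poly fps" where
  "wp = zdp Lam"

lemma sym_wp: "sym 1 wp"
  using sym_zdp[OF sym_Lam] by (simp add: wp_def)

lemma zcoeff_1: "zcoeff 1 a = (if a = 0 then 1 else 0)"
  by (rule fps_ext) (auto simp: zcoeff_nth fps_one_nth)

text \<open>The equation \<open>\<wp>'' = 6 \<wp>\<^sup>2 + const\<close> for a shift of \<open>x / (1 - x)\<^sup>2 + wp\<close>, again with the denominators cleared.\<close>

lemma weierstrass:
  "\<exists>v. 12 * xx * (wp - lift (ev1 wp)) + (1 - xx)\<^sup>2 *
    (6 * wp * wp - zdp (zdp wp) + wp - 12 * lift (ev1 wp) * wp - lift v) = 0"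
proof -
  define S where "S = emb wp"
  define K where "K = zd beta"
  define s where "s = emb (lift (ev1 wp))"
  \<comment> \<open>The terms with \<open>12 * s\<close> are chosen so that the asymmetries
    \<open>sSK\<close> of \<open>S * K\<close> and \<open>sK\<close> of \<open>K\<close> under z ->
    1/z cancel. The square of \<open>K\<close> is absent because
    \<open>zd (zd K) = 6 * (K * K) + K\<close>.\<close>
  define Z where "Z = 12 * (S * K) + 6 * (S * S) - zd (zd S) + S - 12 * (s * K) - 12 * (s * S)"
  have E: "zd xi = K + S" by (simp add: xi_eq zd_add K_def S_def wp_def emb_zdp)
  have K2: "zd (zd K) = 6 * (K * K) + K"
    by (simp add: K_def zd_beta zd_add zd_mult zd_numeral_0 algebra_simps)
  have Z: "Z = 6 * (zd xi * zd xi) - zd (zd (zd xi)) + zd xi - 12 * (s * zd xi)"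
  proof -
    have "6 * ((K + S) * (K + S)) = 6 * (K * K) + 12 * (S * K) + 6 * (S * S)" by (simp add: algebra_simps)
    then show ?thesis unfolding E Z_def using K2 by (simp add: zd_add algebra_simps)
  qed
  have "swap Z = Z"
    unfolding Z by (simp add: swap_add swap_diff swap_zd swap_mult swap_numeral_0 swap_xi zd_uminus s_def swap_lift)
  then have swp: "Z $ i $ n = 1 * Z $ n $ i" for i n
    by (metis mult_1 swap_nth)
  have sK: "zcoeff K a - zcoeff K (- a) = of_int a" for a
    unfolding K_def zd_beta_row by (rule fps_ext) (auto simp: zcoeff_nth simp flip: fps_of_int)
  have sS: "zcoeff S (- a) = zcoeff S a" for a
    using sym_zcoeff[OF sym_wp, of a] by (simp add: S_def)
  have sS2: "zcoeff (S * S) (- a) = zcoeff (S * S) a" for a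
    using sym_zcoeff[OF sym_mult[OF sym_wp sym_wp], of a] by (simp add: S_def emb_mult)
  have sSK: "zcoeff (S * K) a - zcoeff (S * K) (- a) = of_int a * ev1 wp" for a
  proof (rule fps_ext)
    fix n
    have "zcoeff (S * K) a $ n + (-1) * zcoeff (S * K) (- 0 - a) $ n
      = (\<Sum>i\<le>2 * n. coeff (wp $ n) i * (a - (int i - int n)))"
      unfolding S_def K_def zd_beta_row zcoeff_row_pair[OF sym_wp]
      by (intro sum.cong refl) (auto simp: ext0_def)
    also have "\<dots> = a * ev1 wp $ n - ev1 (zdp wp) $ n"
      unfolding sym_ev1_zdp[OF sym_wp] unfolding sym_ev1[OF sym_wp]
      by (simp add: sum_distrib_left sum_subtractf right_diff_distrib mult.commute)
    also have "ev1 (zdp wp) $ n = 0" using sym_ev1_0 sym_zdp[OF sym_wp] by simp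
    finally show "(zcoeff (S * K) a - zcoeff (S * K) (- a)) $ n = (of_int a * ev1 wp) $ n"
      by (simp add: of_int_fps_mult_nth)
  qed
  have inv: "zcoeff Z (- b) = of_int 1 * zcoeff Z b" for b
  proof -
    have "zcoeff Z b - zcoeff Z (- b) = 12 * (zcoeff (S * K) b - zcoeff (S * K) (- b))
      - 12 * (ev1 wp * (zcoeff K b - zcoeff K (- b)))"
      unfolding Z_def by (simp add: zcoeff_add zcoeff_diff zcoeff_zd zcoeff_numeral s_def zcoeff_lift sS sS2) (simp add: algebra_simps)
    then show ?thesis unfolding sSK sK by simp
  qed
  define v where "v = zcoeff Z 0"
  have "Z = emb (lift v)"
  proof (rule zcoeff_eqI)
    fix a show "zcoeff Z a = zcoeff (emb (lift v)) a"
      using zcoeff_vanish[OF swp inv, of a] zcoeff_lift[of v 1 a] by (cases "a = 0") (auto simp: v_def zcoeff_1)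
  qed
  then have "0 = (1 - emb xx)\<^sup>2 * (12 * (S * K) + 6 * (S * S) - zd (zd S) + S - 12 * (s * K) -
      12 * (s * S) - emb (lift v))"
    by (simp add: Z_def)
  also have "\<dots> = 12 * ((1 - emb xx)\<^sup>2 * K) * (S - s) + (1 - emb xx)\<^sup>2 * (6 * (S * S) -
      zd (zd S) + S - 12 * (s * S) - emb (lift v))"
    by (simp add: algebra_simps)
  also have "(1 - emb xx)\<^sup>2 * K = emb xx"
  proof -
    have "(1 - emb xx)\<^sup>2 * K = (1 - emb xx) * ((1 - emb xx) * beta) + ((1 - emb xx) * beta) * ((1 - emb xx) * beta)"
      by (simp add: K_def zd_beta power2_eq_square algebra_simps)
    then show ?thesis unfolding beta_inverse by (simp add: algebra_simps)
  qed
  finally have "emb (12 * xx * (wp - lift (ev1 wp)) + (1 - xx)\<^sup>2 *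
    (6 * wp * wp - zdp (zdp wp) + wp - 12 * lift (ev1 wp) * wp - lift v)) = emb 0"
    by (simp add: emb_mult emb_add emb_diff emb_1 emb_power emb_zdp emb_numeral emb_0 S_def s_def mult.assoc)
  then show ?thesis unfolding emb_inject by blast
qed

section \<open>The generating functions of crank and rank\<close>

definition crank_gf :: "int poly fps" where
  "crank_gf = Abs_fps (\<lambda>n. \<Sum>i\<le>2 * n. monom (crank_count (int i - int n) n) i)"

definition rank_gf :: "int poly fps" where
  "rank_gf = Abs_fps (\<lambda>n. \<Sum>i\<le>2 * n. monom (rank_count (int i - int n) n) i)"

lemma vcount_split: "vcount (int i - int n) i + vcount (int i - int n + 1) n = card (partitions n)"
  by (rule vcount_rec) simp

lemma vcount_reflect: "vcount (int n - int i) n = vcount (int i - int n) i"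
proof (cases "n \<le> i")
  case True
  then obtain s where s: "i = n + s" by (metis le_Suc_ex)
  show ?thesis using vcount_minus[of s n] by (simp add: s)
next
  case False
  then obtain s where s: "n = i + s" by (metis le_Suc_ex nat_le_linear)
  show ?thesis using vcount_minus[of s i] by (simp add: s)
qed

text \<open>For \<open>\<bar>k\<bar> \<le> n\<close> the splitting and reflection of
  \<open>vcount\<close> give \<open>vcount (k + 1) n + vcount (- k) n = card (partitions n)\<close>;
  comparing this equation for \<open>k\<close> and \<open>- k\<close> yields the symmetry. Outside
  this range both sides vanish.\<close>

lemma crank_count_reflect: "crank_count (- k) n = crank_count k n"
proof (cases "0 \<le> k + int n \<and> 0 \<le> int n - k")
  case True
  define i where "i = nat (k + int n)"
  have k: "k = int i - int n" using True by (simp add: i_def)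
  define j where "j = nat (int n - k)"
  have k': "- k = int j - int n" using True by (simp add: j_def)
  have "vcount (k + 1) n + vcount k i = card (partitions n)"
    using vcount_split[of i n] by (simp add: k)
  moreover have "vcount k i = vcount (- k) n"
    using vcount_reflect[of n i] by (simp add: k)
  moreover have "vcount (- k + 1) n + vcount (- k) j = card (partitions n)"
    using vcount_split[of j n] by (simp add: k')
  moreover have "vcount (- k) j = vcount k n"
    using vcount_reflect[of n j] k' by (metis minus_diff_eq minus_minus)
  ultimately show ?thesis by (simp add: crank_count_eq)
next
  case False
  have big: "crank_count k n = 0" if "int n < k" for k
    using that by (simp add: crank_count_eq vcount_eq_0)
  have small: "crank_count k n = 0" if "k < - int n" for k
  proof -
    have "vcount j n = card (partitions n)" if "j \<le> - int n" for j
    proof -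
      have "vcount (- int (nat (- j))) n = vcount (int (nat (- j))) (n + nat (- j))" by (rule vcount_minus)
      moreover have "vcount (int (nat (- j))) (n + nat (- j)) + vcount (int (nat (- j)) + 1) n = card (partitions n)"
        by (rule vcount_rec) simp
      moreover have "vcount (int (nat (- j)) + 1) n = 0" using that by (intro vcount_eq_0) simp
      ultimately show ?thesis using that by simp
    qed
    from this[of k] this[of "k + 1"] show ?thesis using that by (simp add: crank_count_eq)
  qed
  show ?thesis using False big[of k] big[of "- k"] small[of k] small[of "- k"] by linarith
qed

lemma crank_count_big: "int n < \<bar>k\<bar> \<Longrightarrow> crank_count k n = 0"
  using crank_count_reflect[of k n] crank_count_eq[of "\<bar>k\<bar>" n] vcount_eq_0[of n "\<bar>k\<bar>"] vcount_eq_0[of n "\<bar>k\<bar> + 1"]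
  by (cases "0 \<le> k") auto

lemma rank_count_reflect: "rank_count (- k) n = rank_count k n"
  using rank_count_minus[of "nat \<bar>k\<bar>" n] by (cases "0 \<le> k") auto

lemma rank_count_big: "int n < \<bar>k\<bar> \<Longrightarrow> rank_count k n = 0"
  using rank_count_nonneg[of "nat \<bar>k\<bar>" n] rank_count_reflect[of k n]
  by (cases "0 \<le> k") (auto simp: rank_ge_eq_0)

lemma crank_gf_nth: "coeff (crank_gf $ n) i = crank_count (int i - int n) n"
  by (auto simp: crank_gf_def coeff_sum_monom crank_count_big)

lemma rank_gf_nth: "coeff (rank_gf $ n) i = rank_count (int i - int n) n"
  by (auto simp: rank_gf_def coeff_sum_monom rank_count_big)

lemma sym_crank_gf: "sym 1 crank_gf"
  unfolding sym_def psym_def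
proof (intro allI)
  fix n i
  show "coeff (crank_gf $ n) i = (if i \<le> 2 * n then 1 * coeff (crank_gf $ n) (2 * n - i) else 0)"
    using crank_count_reflect[of "int i - int n" n]
    by (auto simp: crank_gf_nth of_nat_diff crank_count_big algebra_simps)
qed

lemma sym_rank_gf: "sym 1 rank_gf"
  unfolding sym_def psym_def
proof (intro allI)
  fix n i
  show "coeff (rank_gf $ n) i = (if i \<le> 2 * n then 1 * coeff (rank_gf $ n) (2 * n - i) else 0)"
    using rank_count_reflect[of "int i - int n" n]
    by (auto simp: rank_gf_nth of_nat_diff rank_count_big algebra_simps)
qed

lemma emb_geo_nth: "(emb Y * geo) $ n $ i = (\<Sum>l\<le>i. coeff (Y $ n) l)"
proof -
  have "(emb Y * geo) $ n = emb Y $ n * Abs_fps (\<lambda>_. 1)" by (simp add: geo_def)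
  then show ?thesis by (simp add: fps_mult_nth atLeast0AtMost)
qed

text \<open>The partial sums of crank counts telescope to
  \<open>card (partitions n) - vcount (int i - int n + 1) n\<close>, and \<open>vcount_split\<close>
  turns this into a count of partitions of \<open>i\<close>. In this form
  \<open>vcount_reflect\<close> exchanges \<open>n\<close> and \<open>i\<close>, which is the
  functional equation of \<open>crank_gf / (1 - z)\<close> under z -> q/z.\<close>

lemma crank_gf_geo_nth: "(emb crank_gf * geo) $ n $ i = int (vcount (int i - int n) i)"
proof -
  have "(\<Sum>l\<le>i. crank_count (int l - int n) n) = int (vcount (- int n) n) - int (vcount (int i - int n + 1) n)"
    by (induction i) (simp_all add: crank_count_eq algebra_simps)
  moreover have "vcount (- int n) n = card (partitions n)"
    using vcount_minus[of n n] vcount_rec[of "n + n" n "int n"] vcount_eq_0[of n "int n + 1"] by simp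
  ultimately show ?thesis
    using vcount_split[of i n] by (simp add: emb_geo_nth crank_gf_nth)
qed

lemma swap_crank_geo: "swap (emb crank_gf * geo) = emb crank_gf * geo"
  by (rule fps2_eqI) (simp add: crank_gf_geo_nth vcount_reflect)

lemma ev1_crank_gf: "ev1 crank_gf = genP"
proof (rule fps_ext)
  fix n
  have "ev1 crank_gf $ n = (emb crank_gf * geo) $ n $ (2 * n)"
    unfolding emb_geo_nth by (rule sym_ev1[OF sym_crank_gf])
  also have "\<dots> = int (card (partitions n))"
    using vcount_split[of "2 * n" n] vcount_eq_0[of n "int n + 1"] by (simp add: crank_gf_geo_nth)
  finally show "ev1 crank_gf $ n = genP $ n" by (simp add: genP_nth)
qed

text \<open>This is the product formula for the generating function of the crank, in differentiated form.\<close>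

lemma zdp_crank_gf: "zdp crank_gf = Lam * crank_gf"
proof -
  define Om where "Om = Lam * crank_gf - zdp crank_gf"
  define F where "F = emb crank_gf * geo"
  have sOm: "sym (-1) Om"
    unfolding Om_def using sym_diff sym_mult[OF sym_Lam sym_crank_gf] sym_zdp[OF sym_crank_gf] by fastforce
  have W: "emb Om * geo = xi * F - zd F"
    by (simp add: Om_def F_def xi_eq emb_mult emb_diff emb_zdp zd_mult zd_geo' algebra_simps)
  have "swap (emb Om * geo) = - (emb Om * geo)"
    unfolding W by (simp add: swap_diff swap_mult swap_zd swap_xi F_def[symmetric] swap_crank_geo[folded F_def])
  then have sw: "zcoeff (emb Om * geo) (- int a) = - (fps_X ^ a * zcoeff (emb Om * geo) (int a))" for a
    using zcoeff_swap[of "emb Om * geo" a] by (simp add: zcoeff_uminus) (metis minus_minus)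
  have inv: "zcoeff (emb Om * geo) (- 1 - a) = zcoeff (emb Om * geo) a" for a
  proof (rule fps_ext)
    fix n
    have "zcoeff (emb Om * geo) a $ n + (-1) * zcoeff (emb Om * geo) (- 1 - a) $ n = (\<Sum>i\<le>2 * n. coeff (Om $ n) i)"
      unfolding geo_def zcoeff_row_pair[OF sOm] by (intro sum.cong refl) (auto simp: ext0_def)
    also have "\<dots> = 0" using sym_ev1[OF sOm, of n] sym_ev1_0[OF sOm] by simp
    finally show "zcoeff (emb Om * geo) (- 1 - a) $ n = zcoeff (emb Om * geo) a $ n" by simp
  qed
  \<comment> \<open>The reflection \<open>a \<mapsto> - 1 - a\<close> has no fixed integer. Together
    with \<open>sw\<close> it ties the coefficient at z^a to minus \<open>fps_X ^ Suc a\<close>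
    times the one at z^(a + 1), so here even the coefficient at z^0 vanishes.\<close>
  have pos: "zcoeff (emb Om * geo) (int a) $ n = 0" for a n
  proof (induction n arbitrary: a rule: less_induct)
    case (less n)
    have "zcoeff (emb Om * geo) (int a) = zcoeff (emb Om * geo) (- int (Suc a))"
      using inv[of "int a"] by simp
    also have "\<dots> $ n = 0"
      unfolding sw using less[of "n - Suc a" "Suc a"] by (simp add: fps_X_power_mult_nth del: power_Suc)
    finally show ?case by simp
  qed
  then have pos': "zcoeff (emb Om * geo) (int a) = 0" for a by (intro fps_ext) simp
  have "zcoeff (emb Om * geo) a = zcoeff 0 a" for a
  proof (cases "0 \<le> a")
    case True
    then show ?thesis using pos'[of "nat a"] by (simp add: zcoeff_0)
  next
    case False
    then show ?thesis using pos'[of "nat (- 1 - a)"] inv[of a] by (simp add: zcoeff_0)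
  qed
  then have "emb Om * geo = 0" by (rule zcoeff_eqI)
  moreover have "(1 - emb xx) * geo * emb Om = (1 - emb xx) * (emb Om * geo)" by (simp only: mult_ac)
  ultimately have "(1 - emb xx) * geo * emb Om = 0" by (simp only: mult_zero_right)
  then have "emb Om = emb 0" by (simp add: geo_inverse emb_0)
  then show ?thesis by (simp add: emb_inject Om_def)
qed

lemma sum_int_centered:
  fixes f :: "int \<Rightarrow> 'a::comm_monoid_add"
  shows "(\<Sum>i\<le>2 * n. f (int i - int n)) = f 0 + (\<Sum>m=1..n. f (int m) + f (- int m))"
proof (induction n)
  case (Suc n)
  have "(\<Sum>i\<le>2 * Suc n. f (int i - int (Suc n))) = (\<Sum>i\<le>Suc (Suc (2 * n)). f (int i - int (Suc n)))"
    by simp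
  also have "\<dots> = f (- int (Suc n)) + (\<Sum>i\<le>Suc (2 * n). f (int (Suc i) - int (Suc n)))"
    by (subst sum.atMost_Suc_shift) simp
  also have "(\<Sum>i\<le>Suc (2 * n). f (int (Suc i) - int (Suc n))) = (\<Sum>i\<le>2 * n. f (int i -
      int n)) + f (int (Suc n))"
    by (simp add: algebra_simps)
  finally show ?case using Suc by (simp add: algebra_simps)
qed simp

lemma ev1_rank_gf: "ev1 rank_gf = genP"
proof (rule fps_ext)
  fix n
  have "ev1 rank_gf $ n = (\<Sum>i\<le>2 * n. rank_count (int i - int n) n)"
    unfolding sym_ev1[OF sym_rank_gf] rank_gf_nth ..
  also have "\<dots> = rank_count 0 n + 2 * (\<Sum>m=1..n. rank_count (int m) n)"
    by (simp add: sum_int_centered[of "\<lambda>k. rank_count k n"] rank_count_reflect sum.distrib sum_distrib_left)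
  also have "(\<Sum>m=1..n. rank_count (int m) n) = int (rank_ge 1 n) - int (rank_ge (Suc n) n)"
  proof -
    have "(\<Sum>m=1..k. rank_count (int m) n) = int (rank_ge 1 n) - int (rank_ge (Suc k) n)" for k
      by (induction k) (simp_all add: rank_count_nonneg)
    then show ?thesis .
  qed
  also have "rank_ge (Suc n) n = 0" by (simp add: rank_ge_eq_0)
  also have "rank_count 0 n + 2 * (int (rank_ge 1 n) - int 0) = genP $ n"
    using rank_count_nonneg[of 0 n] card_partitions_rank[of n] by (simp add: genP_nth)
  finally show "ev1 rank_gf $ n = genP $ n" .
qed

section \<open>Moments as derivatives at z = 1\<close>

definition mom :: "nat \<Rightarrow> int poly fps \<Rightarrow> int fps" where
  "mom j Y = ev1 ((zdp ^^ j) Y)"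

lemma zdp_power_nth: "coeff ((zdp ^^ j) Y $ n) i = (int i - int n) ^ j * coeff (Y $ n) i"
  by (induction j) (simp_all add: algebra_simps)

lemma mom_nth: "sym e Y \<Longrightarrow> mom j Y $ n = (\<Sum>i\<le>2 * n. (int i - int n) ^ j * coeff (Y $ n) i)"
proof -
  assume Y: "sym e Y"
  have "degree ((zdp ^^ j) Y $ n) \<le> 2 * n"
    using Y psym_zero[of e n "Y $ n"] by (intro degree_le) (auto simp: zdp_power_nth sym_def)
  then show ?thesis by (simp add: mom_def poly_1_eq_sum zdp_power_nth)
qed

lemma Sum_any_centered:
  fixes f :: "int \<Rightarrow> int"
  assumes "\<And>k. int n < \<bar>k\<bar> \<Longrightarrow> f k = 0"
  shows "Sum_any f = (\<Sum>i\<le>2 * n. f (int i - int n))"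
proof -
  have "{k. f k \<noteq> 0} \<subseteq> (\<lambda>i. int i - int n) ` {..2 * n}"
  proof
    fix k assume "k \<in> {k. f k \<noteq> 0}"
    then have "\<bar>k\<bar> \<le> int n" using assms[of k] by force
    then show "k \<in> (\<lambda>i. int i - int n) ` {..2 * n}"
      by (intro image_eqI[of _ _ "nat (k + int n)"]) auto
  qed
  then have "Sum_any f = sum f ((\<lambda>i. int i - int n) ` {..2 * n})"
    by (intro Sum_any.expand_superset) auto
  also have "\<dots> = (\<Sum>i\<le>2 * n. f (int i - int n))"
    by (subst sum.reindex) (auto simp: inj_on_def)
  finally show ?thesis .
qed

lemma mom_crank_gf: "mom j crank_gf $ n = crank_moment j n"
  unfolding crank_moment_def mom_nth[OF sym_crank_gf]
  by (subst Sum_any_centered[of n]) (simp_all add: crank_count_big crank_gf_nth)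

lemma mom_rank_gf: "mom j rank_gf $ n = rank_moment j n"
  unfolding rank_moment_def mom_nth[OF sym_rank_gf]
  by (subst Sum_any_centered[of n]) (simp_all add: rank_count_big rank_gf_nth)

text \<open>For odd \<open>j\<close> the divisors \<open>d\<close> and \<open>- d\<close> contribute
  the same amount, whence the factor 2.\<close>

lemma mom_Lam:
  assumes "odd j"
  shows "mom j Lam = 2 * Phi j"
proof (rule fps_ext)
  fix n
  show "mom j Lam $ n = (2 * Phi j) $ n"
  proof (cases "n = 0")
    case True
    then show ?thesis by (simp add: mom_nth[OF sym_Lam] Lam_nth Phi_def sig_def numeral_fps_mult_nth)
  next
    case False
    define f where "f k = k ^ j * (if k dvd int n then sgn k else 0)" for k :: int
    have "mom j Lam $ n = (\<Sum>i\<le>2 * n. f (int i - int n))"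
      using False by (simp add: mom_nth[OF sym_Lam] Lam_nth xi_nth f_def)
    also have "\<dots> = (\<Sum>m=1..n. 2 * (if m dvd n then int (m ^ j) else 0))"
    proof -
      have "f (int m) + f (- int m) = 2 * (if m dvd n then int (m ^ j) else 0)" if "m \<in> {1..n}" for m
        using that assms by (auto simp: f_def sgn_if)
      moreover have "f 0 = 0" by (simp add: f_def)
      ultimately show ?thesis unfolding sum_int_centered by simp
    qed
    also have "\<dots> = 2 * (\<Sum>m\<in>{m \<in> {1..n}. m dvd n}. int (m ^ j))"
      by (subst sum.inter_filter) (simp_all add: sum_distrib_left)
    also have "{m \<in> {1..n}. m dvd n} = {d. d dvd n}"
      using False by (auto dest: dvd_imp_le intro: Suc_leI dvd_pos_nat)
    also have "(\<Sum>m | m dvd n. int (m ^ j)) = int (sig j n)" using False by (simp add: sig_def)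
    finally show ?thesis by (simp add: Phi_def numeral_fps_mult_nth)
  qed
qed

lemma mom_even_Lam: "even j \<Longrightarrow> mom j Lam = 0"
proof -
  have "sym (if even j then -1 else 1) ((zdp ^^ j) Lam)" for j
    by (induction j) (use sym_Lam sym_zdp in force)+
  then show "even j \<Longrightarrow> mom j Lam = 0"
    unfolding mom_def by (metis sym_ev1_0)
qed

lemma ev1_wp: "ev1 wp = 2 * Phi 1"
  using mom_Lam[of 1] by (simp add: mom_def wp_def)

section \<open>The rank-crank differential equation\<close>

definition crank3 :: "int poly fps" where
  "crank3 = crank_gf * crank_gf * crank_gf"

definition rankG :: "nat \<Rightarrow> int fps" where
  "rankG r = Abs_fps (\<lambda>n. int (rank_ge r n))"

text \<open>The coefficients of 2 / (1 - x)^3, so that \<open>emb crank3 * geo3\<close> is twice the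
  cube of the series fixed by \<open>swap\<close>.\<close>

definition geo3 :: "int fps fps" where
  "geo3 = row (\<lambda>j. (int j + 1) * (int j + 2))"

lemma geo3_eq: "geo3 = 2 * (geo * geo * geo)"
proof -
  have 1: "(Abs_fps (\<lambda>_. 1) :: int fps) * Abs_fps (\<lambda>_. 1) = Abs_fps (\<lambda>n. int n + 1)"
    by (rule fps_ext) (simp add: fps_mult_nth)
  have "2 * (\<Sum>j\<le>n. int j + 1) = (int n + 1) * (int n + 2)" for n
    by (induction n) (simp_all add: algebra_simps)
  then have 2: "2 * (Abs_fps (\<lambda>n. int n + 1) * Abs_fps (\<lambda>_. 1)) =
      Abs_fps (\<lambda>j. (int j + 1) * (int j + 2))"
    by (intro fps_ext) (simp only: numeral_fps_mult_nth, simp add: fps_mult_nth atLeast0AtMost)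
  have two: "(2 :: int fps fps) = fps_const 2" by (rule numeral_fps_const)
  have "2 * (geo * geo * geo) = fps_const (2 * (Abs_fps (\<lambda>_. 1) * Abs_fps (\<lambda>_. 1) *
      Abs_fps (\<lambda>_. 1)))"
    unfolding two geo_def by (simp only: fps_const_mult)
  then show ?thesis unfolding 1 2 geo3_def by simp
qed

lemma sym_crank3: "sym 1 crank3"
  using sym_mult[OF sym_mult[OF sym_crank_gf sym_crank_gf] sym_crank_gf] by (simp add: crank3_def)

lemma ev1_crank3: "ev1 crank3 = genP ^ 3"
  by (simp add: crank3_def ev1_mult ev1_crank_gf power3_eq_cube)

lemma zdp_crank3: "zdp crank3 = 3 * Lam * crank3"
  by (simp add: crank3_def zdp_mult zdp_crank_gf algebra_simps)

lemma zdp_numeral_0: "zdp (numeral k) = 0"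
  by (simp flip: emb_inject add: emb_zdp emb_numeral zd_numeral_0 emb_0)

lemma ev1_zdp2_crank3: "ev1 (zdp (zdp crank3)) = 6 * Phi 1 * genP ^ 3"
proof -
  have "zdp (zdp crank3) = 3 * wp * crank3 + 9 * Lam * Lam * crank3"
    by (simp add: zdp_crank3 zdp_mult zdp_numeral_0 wp_def algebra_simps)
  then show ?thesis
    by (simp add: ev1_add ev1_mult ev1_numeral ev1_crank3 ev1_wp sym_ev1_0[OF sym_Lam])
qed

text \<open>The polynomial \<open>(j + 1) * (j + 2)\<close> is invariant under
  \<open>j \<mapsto> - 3 - j\<close> and vanishes at -1 and -2, so the row and its reflection add up
  to it for every integer \<open>j\<close>. Being quadratic, it brings in moments of
  \<open>crank3\<close> up to order 2, and the first one is 0.\<close>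

lemma zcoeff_crank3_reflect:
  "zcoeff (emb crank3 * geo3) a + zcoeff (emb crank3 * geo3) (- 3 - a)
    = genP ^ 3 * (of_int ((a + 1) * (a + 2)) + 6 * Phi 1)"
proof (rule fps_ext)
  fix n
  have z: "ev1 (zdp crank3) $ n = 0" using sym_ev1_0[of "zdp crank3"] sym_zdp[OF sym_crank3] by simp
  have "zcoeff (emb crank3 * geo3) a $ n + 1 * zcoeff (emb crank3 * geo3) (- 3 - a) $ n
    = (\<Sum>i\<le>2 * n. coeff (crank3 $ n) i * ((a - (int i - int n) + 1) * (a - (int i - int n) + 2)))"
    unfolding geo3_def zcoeff_row_pair[OF sym_crank3]
  proof (intro sum.cong refl arg_cong2[where f = "(*)"])
    fix i
    have "ext0 (\<lambda>j. (int j + 1) * (int j + 2)) j + 1 * 1 * ext0 (\<lambda>j. (int j + 1) * (int j +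
        2)) (- 3 - j) = (j + 1) * (j + 2)" for j
    proof -
      consider "0 \<le> j" | "j = -1" | "j = -2" | "j \<le> -3" by linarith
      then show ?thesis by cases (auto simp: ext0_def algebra_simps)
    qed
    from this[of "a + int n - int i"]
    show "ext0 (\<lambda>j. (int j + 1) * (int j + 2)) (a + int n - int i) +
        1 * 1 * ext0 (\<lambda>j. (int j + 1) * (int j + 2)) (- 3 - (a + int n - int i))
      = (a - (int i - int n) + 1) * (a - (int i - int n) + 2)" by (simp add: algebra_simps)
  qed
  also have "\<dots> = (\<Sum>i\<le>2 * n. coeff (crank3 $ n) i * ((a + 1) * (a + 2))
    - (2 * a + 3) * (coeff (crank3 $ n) i * (int i - int n)) + coeff (crank3 $ n) i * (int i - int n)\<^sup>2)"
    by (intro sum.cong refl) (simp add: algebra_simps power2_eq_square)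
  also have "\<dots> = (\<Sum>i\<le>2 * n. coeff (crank3 $ n) i) * ((a + 1) * (a + 2))
    - (2 * a + 3) * (\<Sum>i\<le>2 * n. coeff (crank3 $ n) i * (int i - int n))
    + (\<Sum>i\<le>2 * n. coeff (crank3 $ n) i * (int i - int n)\<^sup>2)"
    by (simp only: sum.distrib sum_subtractf sum_distrib_left sum_distrib_right)
  also have "\<dots> = ev1 crank3 $ n * ((a + 1) * (a + 2)) - (2 * a + 3) * ev1 (zdp crank3) $ n +
      ev1 (zdp (zdp crank3)) $ n"
    by (simp only: sym_ev1[OF sym_crank3] sym_ev1_zdp[OF sym_crank3] sym_ev1_zdp2[OF sym_crank3])
  also have "\<dots> = (genP ^ 3 * (of_int ((a + 1) * (a + 2)) + 6 * Phi 1)) $ n"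
    unfolding z ev1_crank3 ev1_zdp2_crank3
    by (simp only: distrib_left fps_add_nth mult.commute[of _ "of_int _"] of_int_fps_mult_nth) (simp add: algebra_simps)
  finally show "(zcoeff (emb crank3 * geo3) a + zcoeff (emb crank3 * geo3) (- 3 - a)) $ n
    = (genP ^ 3 * (of_int ((a + 1) * (a + 2)) + 6 * Phi 1)) $ n" by simp
qed

lemma swap_crank3: "swap (emb crank3 * geo3) = emb crank3 * geo3"
proof -
  define F where "F = emb crank_gf * geo"
  have "swap F = F" unfolding F_def by (rule swap_crank_geo)
  moreover have "emb crank3 * geo3 = 2 * (F * F * F)"
    by (simp add: crank3_def emb_mult geo3_eq F_def mult_ac)
  ultimately show ?thesis by (simp only: swap_mult swap_numeral_0)
qed

lemma rankG_rec: "rankG r = fps_X ^ Suc r * (genP - rankG (r + 3))"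
proof (rule fps_ext)
  fix n
  show "rankG r $ n = (fps_X ^ Suc r * (genP - rankG (r + 3))) $ n"
  proof (cases "n \<le> r")
    case True
    then show ?thesis by (simp add: rankG_def rank_ge_eq_0 fps_X_power_mult_nth del: power_Suc)
  next
    case False
    then obtain m where n: "n = m + r + 1" by (metis add.assoc add.commute less_iff_Suc_add not_le Suc_eq_plus1)
    show ?thesis using rank_ge_rec[of r m]
      by (simp add: rankG_def genP_def fps_X_power_mult_nth n del: power_Suc)
  qed
qed

text \<open>The core of the rank-crank equation. Both sides satisfy
  \<open>H r = fps_X ^ Suc r * (c r - H (r + 3))\<close> with the same \<open>c\<close>, and this
  determines them. For the cube the recursion comes from the two involutions, for the ranks from
  Dyson's recursion and \<open>qd_genP\<close>.\<close>

lemma zcoeff_crank3_rankG: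
  "zcoeff (emb crank3 * geo3) (- int (Suc r))
    = genP\<^sup>2 * (6 * qd (rankG r) + of_nat r * (of_nat r - 1) * rankG r)"
proof -
  define H where "H r = zcoeff (emb crank3 * geo3) (- int (Suc r))" for r
  define K where "K r = genP\<^sup>2 * (6 * qd (rankG r) + of_nat r * (of_nat r - 1) * rankG r)" for r
  define c where "c r = genP ^ 3 * ((of_nat r + 2) * (of_nat r + 3) + 6 * Phi 1)" for r :: nat
  have H: "H r = fps_X ^ Suc r * (c r - H (r + 3))" for r
  proof -
    have "H r = fps_X ^ Suc r * zcoeff (emb crank3 * geo3) (int (Suc r))"
      using zcoeff_swap[of "emb crank3 * geo3" "Suc r"] unfolding H_def swap_crank3 .
    also have "zcoeff (emb crank3 * geo3) (int (Suc r)) = c r - H (r + 3)"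
    proof -
      have e: "- 3 - int (Suc r) = - int (Suc (r + 3))" by simp
      have "zcoeff (emb crank3 * geo3) (int (Suc r)) + H (r + 3) = genP ^ 3 * (of_int ((int (Suc r) +
          1) * (int (Suc r) + 2)) + 6 * Phi 1)"
        using zcoeff_crank3_reflect[of "int (Suc r)"] unfolding e H_def .
      also have "\<dots> = c r" by (simp add: c_def algebra_simps)
      finally show ?thesis by (simp add: eq_diff_eq)
    qed
    finally show ?thesis .
  qed
  have K: "K r = fps_X ^ Suc r * (c r - K (r + 3))" for r
  proof -
    define u where "u = genP - rankG (r + 3)"
    have G: "rankG r = fps_X ^ Suc r * u" unfolding u_def by (rule rankG_rec)
    have qG: "qd (rankG r) = fps_X ^ Suc r * ((of_nat r + 1) * u + qd u)"
      unfolding G qd_mult qd_X_power by (simp add: algebra_simps)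
    have qu: "qd u = Phi 1 * genP - qd (rankG (r + 3))" by (simp add: u_def qd_diff qd_genP)
    show ?thesis unfolding K_def unfolding qG unfolding qu G
      by (simp add: c_def u_def algebra_simps power2_eq_square power3_eq_cube)
  qed
  have "H r $ n = K r $ n" for n
  proof (induction n arbitrary: r rule: less_induct)
    case (less n)
    show ?case
      unfolding H[of r] K[of r] using less[of "n - Suc r" "r + 3"]
      by (simp add: fps_X_power_mult_nth del: power_Suc)
  qed
  then show ?thesis unfolding H_def K_def by (rule fps_ext)
qed

lemma zcoeff_rank_gf: "zcoeff (emb rank_gf) (- int m) = rankG m - rankG (Suc m) + (if m = 0 then 1 else 0)"
proof (rule fps_ext)
  fix n
  have "zcoeff (emb rank_gf) (- int m) $ n = rank_count (- int m) n"
    by (auto simp: zcoeff_nth rank_gf_nth rank_count_big)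
  then show "zcoeff (emb rank_gf) (- int m) $ n = (rankG m - rankG (Suc m) + (if m = 0 then 1 else 0)) $ n"
    unfolding rank_count_reflect rank_count_nonneg by (simp add: rankG_def fps_one_nth)
qed

text \<open>Multiplication by (1 - x)^3 undoes the pole in \<open>geo3\<close>, so the coefficients
  of the equation are third differences of \<open>zcoeff_crank3_rankG\<close>, except for the middle
  one at z^1. The latter follows by evaluation at z = 1.\<close>

lemma rank_crank:
  "(1 - xx)\<^sup>2 * (lift (genP\<^sup>2) * (6 * qd rank_gf + zdp (zdp rank_gf))) + (1 -
      xx\<^sup>2) * (lift (genP\<^sup>2) * zdp rank_gf)
    + xx * (2 * lift (genP\<^sup>2) * rank_gf - 2 * crank3) = 0"
proof -
  define A where "A = lift (genP\<^sup>2) * (6 * qd rank_gf + zdp (zdp rank_gf))"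
  define B where "B = lift (genP\<^sup>2) * zdp rank_gf"
  define K where "K = 2 * lift (genP\<^sup>2) * rank_gf - 2 * crank3"
  define D where "D = (1 - xx)\<^sup>2 * A + (1 - xx\<^sup>2) * B + xx * K"
  define r where "r a = zcoeff (emb rank_gf) a" for a
  define y where "y a = zcoeff (emb crank3) a" for a
  have r_neg: "r (- a) = r a" for a using sym_zcoeff[OF sym_rank_gf, of a] by (simp add: r_def)
  have y_neg: "y (- a) = y a" for a using sym_zcoeff[OF sym_crank3, of a] by (simp add: y_def)
  have zA: "zcoeff (emb A) a = genP\<^sup>2 * (6 * qd (r a) + of_int (a\<^sup>2) * r a)" for a
    unfolding A_def r_def emb_mult zcoeff_lift emb_add emb_zdp emb_numeral emb_qd
    by (simp add: zcoeff_add zcoeff_numeral zcoeff_qd zcoeff_zd power2_eq_square)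
  have zB: "zcoeff (emb B) a = genP\<^sup>2 * (of_int a * r a)" for a
    unfolding B_def r_def emb_mult zcoeff_lift emb_zdp by (simp add: zcoeff_zd)
  have zK: "zcoeff (emb K) a = 2 * (genP\<^sup>2 * r a) - 2 * y a" for a
    unfolding K_def r_def y_def emb_mult emb_diff emb_numeral mult.assoc zcoeff_diff zcoeff_numeral zcoeff_lift ..
  have zD: "zcoeff (emb D) (1 + a) = zcoeff (emb A) (1 + a) - 2 * zcoeff (emb A) a + zcoeff (emb A) (a - 1)
      + zcoeff (emb B) (1 + a) - zcoeff (emb B) (a - 1) + zcoeff (emb K) a" for a
  proof -
    have "emb D = emb A - 2 * (emb xx * emb A) + emb xx * (emb xx * emb A) + emb B -
        emb xx * (emb xx * emb B) + emb xx * emb K"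
      by (simp add: D_def emb_add emb_diff emb_mult emb_1 emb_power emb_numeral algebra_simps power2_eq_square)
    then show ?thesis by (simp add: zcoeff_add zcoeff_diff zcoeff_numeral zcoeff_xx)
  qed
  \<comment> \<open>The factors \<open>1 - xx\<close> and \<open>xx\<close> move the centre of
    symmetry from z^0 to z^1.\<close>
  have D_neg: "zcoeff (emb D) (1 - a) = zcoeff (emb D) (1 + a)" for a
  proof -
    have e: "1 - a = 1 + - a" "- a - 1 = - (1 + a)" "1 + - a = - (a - 1)" by simp_all
    show ?thesis
      unfolding e(1) zD unfolding zA zB zK unfolding e(2) e(3) r_neg y_neg by (simp add: algebra_simps power2_eq_square)
  qed
  have D_pos: "zcoeff (emb D) (1 - int (Suc m)) = 0" for m
  proof -
    have y: "2 * y (- int (Suc m)) = zcoeff (emb crank3 * geo3) (- int (Suc m)) -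
        3 * zcoeff (emb crank3 * geo3) (- int (Suc (Suc m)))
      + 3 * zcoeff (emb crank3 * geo3) (- int (Suc (Suc (Suc m)))) -
          zcoeff (emb crank3 * geo3) (- int (Suc (Suc (Suc (Suc m)))))"
    proof -
      let ?x = "emb xx" and ?g = "emb crank3 * geo3"
      have "?g - 3 * (?x * ?g) + 3 * (?x * (?x * ?g)) - ?x * (?x * (?x * ?g)) = emb crank3 * (2 * (((1 -
          ?x) * geo) * ((1 - ?x) * geo) * ((1 - ?x) * geo)))"
        unfolding geo3_eq by (simp add: algebra_simps)
      also have "\<dots> = 2 * emb crank3" unfolding geo_inverse by simp
      finally have "zcoeff (2 * emb crank3) (- int (Suc m)) = zcoeff (?g - 3 * (?x * ?g) +
          3 * (?x * (?x * ?g)) - ?x * (?x * (?x * ?g))) (- int (Suc m))"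
        by simp
      then have "2 * y (- int (Suc m)) = zcoeff ?g (- int (Suc m)) - 3 * zcoeff ?g (- int (Suc m) - 1)
        + 3 * zcoeff ?g (- int (Suc m) - 1 - 1) - zcoeff ?g (- int (Suc m) - 1 - 1 - 1)"
        by (simp only: zcoeff_add zcoeff_diff zcoeff_numeral zcoeff_xx y_def)
      moreover have "- int (Suc m) - 1 = - int (Suc (Suc m))" "- int (Suc (Suc m)) - 1 = - int (Suc (Suc (Suc m)))"
        "- int (Suc (Suc (Suc m))) - 1 = - int (Suc (Suc (Suc (Suc m))))" by simp_all
      ultimately show ?thesis by (simp only:)
    qed
    have e: "1 - int (Suc m) = 1 + (- int (Suc m))" "1 + (- int (Suc m)) = - int m" "- int (Suc m) - 1 = -
        int (Suc (Suc m))" by simp_all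
    have rr: "r (- int k) = rankG k - rankG (Suc k) + (if k = 0 then 1 else 0)" for k
      unfolding r_def by (rule zcoeff_rank_gf)
    have "zcoeff (emb D) (1 - int (Suc m)) = genP\<^sup>2 * (6 * qd (r (- int m)) + of_int ((- int m)\<^sup>2) * r (- int m))
       - 2 * (genP\<^sup>2 * (6 * qd (r (- int (Suc m))) + of_int ((- int (Suc m))\<^sup>2) * r (- int (Suc m))))
       + genP\<^sup>2 * (6 * qd (r (- int (Suc (Suc m)))) + of_int ((- int (Suc (Suc m)))\<^sup>2) * r (- int (Suc (Suc m))))
       + genP\<^sup>2 * (of_int (- int m) * r (- int m)) - genP\<^sup>2 * (of_int (- int (Suc (Suc m))) *
           r (- int (Suc (Suc m))))
       + (2 * (genP\<^sup>2 * r (- int (Suc m))) - 2 * y (- int (Suc m)))"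
      unfolding e(1) zD unfolding zA zB zK unfolding e(2) e(3) ..
    also have "\<dots> = 0"
      unfolding y zcoeff_crank3_rankG rr
      by (cases "m = 0") (simp_all add: qd_add qd_diff qd_1 algebra_simps power2_eq_square numeral_eq_Suc)
    finally show ?thesis .
  qed
  have nz: "zcoeff (emb D) (1 + a) = 0" if "a \<noteq> 0" for a
  proof (cases "0 < a")
    case True
    then have "1 + a = 1 + int (Suc (nat (a - 1)))" by simp
    then show ?thesis using D_pos[of "nat (a - 1)"] D_neg by metis
  next
    case False
    then have "1 + a = 1 - int (Suc (nat (- a - 1)))" using that by simp
    then show ?thesis using D_pos[of "nat (- a - 1)"] by metis
  qed
  define k where "k = zcoeff (emb D) 1"
  have "emb D = emb (xx * lift k)"
  proof (rule zcoeff_eqI)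
    fix a
    have "zcoeff (emb (xx * lift k)) a = k * zcoeff 1 (a - 1)"
      using zcoeff_lift[of k 1 "a - 1"] by (simp add: emb_mult zcoeff_xx)
    then show "zcoeff (emb D) a = zcoeff (emb (xx * lift k)) a"
      using nz[of "a - 1"] by (cases "a = 1") (simp_all add: zcoeff_1 k_def)
  qed
  then have D: "D = xx * lift k" by (simp only: emb_inject)
  \<comment> \<open>At z = 1 only the bracket \<open>K\<close> survives, where both terms are
    \<open>2 * genP ^ 3\<close>.\<close>
  have "ev1 D = 0"
    by (simp add: D_def K_def ev1_add ev1_diff ev1_mult ev1_power ev1_1 ev1_xx ev1_lift ev1_numeral ev1_rank_gf ev1_crank3
        power2_eq_square power3_eq_cube)
  then have "k = 0" unfolding D ev1_mult ev1_xx ev1_lift by simp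
  then have "emb D = 0" unfolding D by (intro zcoeff_eqI) (simp add: emb_mult zcoeff_xx zcoeff_0 zcoeff_lift[of 0 1, simplified])
  then show ?thesis using emb_inject[of D 0] by (simp add: emb_0 D_def A_def B_def K_def)
qed

section \<open>Moments of products and of equations\<close>

lemma mom_Suc: "mom (Suc j) Y = mom j (zdp Y)"
  by (simp add: mom_def funpow_swap1)

lemma mom_add: "mom j (Y + Z) = mom j Y + mom j Z"
  and mom_diff: "mom j (Y - Z) = mom j Y - mom j Z"
proof -
  have "(zdp ^^ j) (Y + Z) = (zdp ^^ j) Y + (zdp ^^ j) Z" "(zdp ^^ j) (Y - Z) = (zdp ^^ j) Y - (zdp ^^ j) Z"
    by (rule fpsp_eqI, simp add: zdp_power_nth algebra_simps)+
  then show "mom j (Y + Z) = mom j Y + mom j Z" "mom j (Y - Z) = mom j Y - mom j Z"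
    by (simp_all add: mom_def ev1_add ev1_diff)
qed

lemma mom_numeral: "mom j (numeral k * Y) = numeral k * mom j Y"
proof -
  have "(zdp ^^ j) (numeral k * Y) = numeral k * (zdp ^^ j) Y"
    by (rule fpsp_eqI) (simp add: zdp_power_nth numeral_fps_mult_nth numeral_poly)
  then show ?thesis by (simp add: mom_def ev1_mult ev1_numeral)
qed

lemma zdp_power_lift: "(zdp ^^ j) (lift k * Y) = lift k * (zdp ^^ j) Y"
  by (induction j) (simp_all add: zdp_mult zdp_lift)

lemma mom_lift: "mom j (lift k * Y) = k * mom j Y"
  by (simp add: mom_def zdp_power_lift ev1_mult ev1_lift)

lemma mom_lift_const: "mom j (lift k) = (if j = 0 then k else 0)"
proof (cases j)
  case (Suc i)
  have "(zdp ^^ i) 0 = 0" by (rule fpsp_eqI) (simp add: zdp_power_nth)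
  then show ?thesis using Suc by (simp add: mom_Suc zdp_lift) (simp add: mom_def ev1_0)
qed (simp add: mom_def ev1_lift)

lemma mom_qd: "mom j (qd Y) = qd (mom j Y)"
proof -
  have "(zdp ^^ j) (qd Y) = qd ((zdp ^^ j) Y)"
    by (induction j) (simp_all add: zdp_qd)
  then show ?thesis by (simp add: mom_def ev1_qd)
qed

lemma zdp_sum: "zdp (\<Sum>i\<in>A. f i) = (\<Sum>i\<in>A. zdp (f i))"
  by (induction A rule: infinite_finite_induct) (auto simp: zdp_add intro!: fpsp_eqI)

lemma zdp_of_nat: "zdp (of_nat c * Y) = of_nat c * zdp Y"
  by (rule fpsp_eqI) (simp add: of_nat_fps_mult_nth of_nat_poly)

lemma ev1_sum: "ev1 (\<Sum>i\<in>A. f i) = (\<Sum>i\<in>A. ev1 (f i))"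
  by (induction A rule: infinite_finite_induct) (auto simp: ev1_add ev1_0)

lemma ev1_of_nat: "ev1 (of_nat c) = of_nat c"
  by (induction c) (simp_all add: ev1_add ev1_1 ev1_0)

lemma zdp_power_mult:
  "(zdp ^^ j) (Y * Z) = (\<Sum>i\<le>j. of_nat (j choose i) * ((zdp ^^ i) Y * (zdp ^^ (j - i)) Z))"
proof (induction j)
  case (Suc j)
  let ?a = "\<lambda>i. (zdp ^^ i) Y" and ?b = "\<lambda>i. (zdp ^^ i) Z"
  have "(zdp ^^ Suc j) (Y * Z) = (\<Sum>i\<le>j. of_nat (j choose i) * (?a (Suc i) * ?b (j - i)))
      + (\<Sum>i\<le>j. of_nat (j choose i) * (?a i * ?b (Suc j - i)))"
    unfolding sum.distrib[symmetric]
    by (simp add: Suc zdp_sum zdp_of_nat, intro sum.cong refl) (simp add: zdp_mult distrib_left Suc_diff_le)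
  also have "(\<Sum>i\<le>j. of_nat (j choose i) * (?a i * ?b (Suc j - i)))
      = (\<Sum>i\<le>Suc j. of_nat (j choose i) * (?a i * ?b (Suc j - i)))"
    by simp
  also have "\<dots> = ?a 0 * ?b (Suc j) + (\<Sum>i\<le>j. of_nat (j choose Suc i) * (?a (Suc i) * ?b (j - i)))"
    by (subst sum.atMost_Suc_shift) simp
  also have "(\<Sum>i\<le>j. of_nat (j choose i) * (?a (Suc i) * ?b (j - i))) + \<dots>
      = ?a 0 * ?b (Suc j) + (\<Sum>i\<le>j. of_nat (Suc j choose Suc i) * (?a (Suc i) * ?b (j - i)))"
    by (simp add: sum.distrib distrib_right)
  also have "\<dots> = (\<Sum>i\<le>Suc j. of_nat (Suc j choose i) * (?a i * ?b (Suc j - i)))"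
    by (subst sum.atMost_Suc_shift) simp
  finally show ?case .
qed simp

lemma mom_mult: "mom j (Y * Z) = (\<Sum>i\<le>j. of_nat (j choose i) * (mom i Y * mom (j - i) Z))"
  by (simp add: mom_def zdp_power_mult ev1_sum ev1_mult ev1_of_nat)

text \<open>The operator (z d/dz + c)^j, written out by the binomial theorem. The constant
  \<open>c\<close> records a factor z^c that has been moved past it, see
  \<open>shift_xx\<close>.\<close>

definition shift :: "int \<Rightarrow> nat \<Rightarrow> int poly fps \<Rightarrow> int poly fps" where
  "shift c j Y = Abs_fps (\<lambda>n. \<Sum>i\<le>j. smult (int (j choose i) * c ^ (j - i)) ((zdp ^^ i) Y $ n))"

lemma shift_nth: "coeff (shift c j Y $ n) i = (int i - int n + c) ^ j * coeff (Y $ n) i"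
  by (simp add: shift_def coeff_sum zdp_power_nth binomial_ring sum_distrib_left sum_distrib_right mult_ac)

lemma shift_add: "shift c j (Y + Z) = shift c j Y + shift c j Z"
  and shift_diff: "shift c j (Y - Z) = shift c j Y - shift c j Z"
  and shift_0: "shift c j 0 = 0"
  by (auto intro!: fpsp_eqI simp: shift_nth algebra_simps)

lemma shift_numeral: "shift c j (numeral k * Y) = numeral k * shift c j Y"
  by (rule fpsp_eqI) (simp add: shift_nth numeral_fps_mult_nth numeral_poly)

lemma xx_mult_nth: "coeff ((xx * Y) $ n) i = (case i of 0 \<Rightarrow> 0 | Suc l \<Rightarrow> coeff (Y $ n) l)"
  by (simp add: xx_def coeff_pCons)

lemma shift_xx: "shift c j (xx * Y) = xx * shift (c + 1) j Y"
  by (rule fpsp_eqI) (auto simp: shift_nth xx_mult_nth algebra_simps split: nat.split)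

lemma ev1_shift: "ev1 (shift c j Y) = (\<Sum>i\<le>j. of_int (int (j choose i) * c ^ (j - i)) * mom i Y)"
  by (rule fps_ext) (simp add: shift_def poly_sum mom_def fps_sum_nth of_int_fps_mult_nth del: of_int_mult)

text \<open>Taking moments of an equation of this form amounts to dividing it by \<open>z\<close> and comparing the
  coefficients of \<open>u\<^sup>j\<close> for \<open>z = exp u\<close>.\<close>

lemma mom_equation:
  assumes "(1 - xx)\<^sup>2 * A + (1 - xx\<^sup>2) * B + xx * K = 0"
  shows "(\<Sum>i\<le>j. of_int (int (j choose i) * ((-1) ^ (j - i) + 1)) * mom i A) - 2 * mom j A
    + (\<Sum>i\<le>j. of_int (int (j choose i) * ((-1) ^ (j - i) - 1)) * mom i B) + mom j K = 0"
proof -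
  have "A - 2 * (xx * A) + xx * (xx * A) + B - xx * (xx * B) + xx * K = 0"
    using assms by (simp add: algebra_simps power2_eq_square)
  then have "ev1 (shift (-1) j (A - 2 * (xx * A) + xx * (xx * A) + B - xx * (xx * B) + xx * K)) = 0"
    by (simp add: shift_0 ev1_0)
  then have F: "ev1 (shift (-1) j A) - 2 * ev1 (shift 0 j A) + ev1 (shift 1 j A)
    + ev1 (shift (-1) j B) - ev1 (shift 1 j B) + ev1 (shift 0 j K) = 0"
    by (simp add: shift_add shift_diff shift_numeral shift_xx ev1_add ev1_diff ev1_mult ev1_xx ev1_numeral)
  have s0: "ev1 (shift 0 j Y) = mom j Y" for Y
  proof -
    have "ev1 (shift 0 j Y) = (\<Sum>i\<le>j. if i = j then mom i Y else 0)"
      unfolding ev1_shift by (intro sum.cong refl) (auto simp: power_0_left)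
    then show ?thesis by simp
  qed
  have sA: "(\<Sum>i\<le>j. of_int (int (j choose i) * ((-1) ^ (j - i) + 1)) * mom i A) =
      ev1 (shift (-1) j A) + ev1 (shift 1 j A)"
    unfolding ev1_shift sum.distrib[symmetric] by (intro sum.cong refl) (simp add: algebra_simps)
  have sB: "(\<Sum>i\<le>j. of_int (int (j choose i) * ((-1) ^ (j - i) - 1)) * mom i B) =
      ev1 (shift (-1) j B) - ev1 (shift 1 j B)"
    unfolding ev1_shift sum_subtractf[symmetric] by (intro sum.cong refl) (simp add: algebra_simps)
  have "ev1 (shift (-1) j A) + ev1 (shift 1 j A) - 2 * mom j A + (ev1 (shift (-1) j B) - ev1 (shift 1 j B)) + mom j K = 0"
    using F unfolding s0 by (simp only: algebra_simps)
  then show ?thesis unfolding sA sB .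
qed

lemma choose_row_3:
  "3 choose 2 = (3 :: nat)"
  by (simp_all add: choose_reduce_nat[of 3])

lemma choose_row_4:
  "4 choose 2 = (6 :: nat)"
  "4 choose 3 = (4 :: nat)"
  by (simp_all add: choose_reduce_nat[of 4] choose_row_3)

lemma choose_row_5:
  "5 choose 2 = (10 :: nat)"
  "5 choose 3 = (10 :: nat)"
  "5 choose 4 = (5 :: nat)"
  by (simp_all add: choose_reduce_nat[of 5] choose_row_4)

lemma choose_row_6:
  "6 choose 2 = (15 :: nat)"
  "6 choose 3 = (20 :: nat)"
  "6 choose 4 = (15 :: nat)"
  "6 choose 5 = (6 :: nat)"
  by (simp_all add: choose_reduce_nat[of 6] choose_row_5)

lemma choose_row_7:
  "7 choose 2 = (21 :: nat)"
  "7 choose 3 = (35 :: nat)"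
  "7 choose 4 = (35 :: nat)"
  "7 choose 5 = (21 :: nat)"
  "7 choose 6 = (7 :: nat)"
  by (simp_all add: choose_reduce_nat[of 7] choose_row_6)

lemma choose_row_8:
  "8 choose 2 = (28 :: nat)"
  "8 choose 3 = (56 :: nat)"
  "8 choose 4 = (70 :: nat)"
  "8 choose 5 = (56 :: nat)"
  "8 choose 6 = (28 :: nat)"
  "8 choose 7 = (8 :: nat)"
  by (simp_all add: choose_reduce_nat[of 8] choose_row_7)

lemma choose_row_9:
  "9 choose 2 = (36 :: nat)"
  "9 choose 3 = (84 :: nat)"
  "9 choose 4 = (126 :: nat)"
  "9 choose 5 = (126 :: nat)"
  "9 choose 6 = (84 :: nat)"
  "9 choose 7 = (36 :: nat)"
  "9 choose 8 = (9 :: nat)"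
  by (simp_all add: choose_reduce_nat[of 9] choose_row_8)

lemma choose_row_10:
  "10 choose 2 = (45 :: nat)"
  "10 choose 3 = (120 :: nat)"
  "10 choose 4 = (210 :: nat)"
  "10 choose 5 = (252 :: nat)"
  "10 choose 6 = (210 :: nat)"
  "10 choose 7 = (120 :: nat)"
  "10 choose 8 = (45 :: nat)"
  "10 choose 9 = (10 :: nat)"
  by (simp_all add: choose_reduce_nat[of 10] choose_row_9)

lemma choose_row_11:
  "11 choose 2 = (55 :: nat)"
  "11 choose 3 = (165 :: nat)"
  "11 choose 4 = (330 :: nat)"
  "11 choose 5 = (462 :: nat)"
  "11 choose 6 = (462 :: nat)"
  "11 choose 7 = (330 :: nat)"
  "11 choose 8 = (165 :: nat)"
  "11 choose 9 = (55 :: nat)"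
  "11 choose 10 = (11 :: nat)"
  by (simp_all add: choose_reduce_nat[of 11] choose_row_10)

lemma choose_row_12:
  "12 choose 2 = (66 :: nat)"
  "12 choose 3 = (220 :: nat)"
  "12 choose 4 = (495 :: nat)"
  "12 choose 5 = (792 :: nat)"
  "12 choose 6 = (924 :: nat)"
  "12 choose 7 = (792 :: nat)"
  "12 choose 8 = (495 :: nat)"
  "12 choose 9 = (220 :: nat)"
  "12 choose 10 = (66 :: nat)"
  "12 choose 11 = (12 :: nat)"
  by (simp_all add: choose_reduce_nat[of 12] choose_row_11)

lemmas choose_rows = choose_row_3 choose_row_4 choose_row_5 choose_row_6 choose_row_7 choose_row_8 choose_row_9 choose_row_10 choose_row_11 choose_row_12

section \<open>Recursions for the moments\<close>

lemma mom_odd: "sym 1 Y \<Longrightarrow> odd j \<Longrightarrow> mom j Y = 0"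
proof -
  assume Y: "sym 1 Y"
  have "sym (if even j then 1 else -1) ((zdp ^^ j) Y)" for j
    by (induction j) (use Y sym_zdp in force)+
  then show "odd j \<Longrightarrow> mom j Y = 0"
    unfolding mom_def by (metis sym_ev1_0)
qed

lemma mom_0: "mom 0 Y = ev1 Y"
  by (simp add: mom_def)

lemma mom_wp: "even j \<Longrightarrow> mom j wp = 2 * Phi (Suc j)"
  using mom_Lam[of "Suc j"] by (simp add: wp_def mom_Suc)

lemma mom_wp_odd: "odd j \<Longrightarrow> mom j wp = 0"
  using mom_even_Lam[of "Suc j"] by (simp add: wp_def mom_Suc)

lemmas mom_simps = mom_mult mom_add mom_diff mom_lift_const mom_qd
  mom_Lam mom_even_Lam mom_wp mom_wp_odd mom_Suc[symmetric] atMost_nat_numeral choose_rows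

lemma sym_numeral: "sym e Y \<Longrightarrow> sym e (numeral k * Y)"
proof -
  assume Y: "sym e Y"
  have "sym 1 (numeral k :: int poly fps)"
    by (auto simp: sym_def psym_def numeral_fps_const numeral_poly coeff_pCons split: nat.splits)
  from sym_mult[OF this Y] show ?thesis by simp
qed

lemma qd_two: "qd (2 * f) = 2 * qd f"
  by (simp add: qd_mult qd_numeral)

text \<open>Leibniz' rule for \<open>zdp crank_gf = Lam * crank_gf\<close>: the moment of order
  \<open>j\<close> contains \<open>Phi i\<close> with the factor
  \<open>2 * (j - 1 choose i)\<close>. For \<open>crank3\<close> below, the factor is three times as
  large.\<close>

lemma crank_rec:
  "mom 2 crank_gf = 2 * (Phi 1 * mom 0 crank_gf)"
  "mom 4 crank_gf = 6 * (Phi 1 * mom 2 crank_gf) + 2 * (Phi 3 * mom 0 crank_gf)"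
  "mom 6 crank_gf = 10 * (Phi 1 * mom 4 crank_gf) + 20 * (Phi 3 * mom 2 crank_gf) + 2 * (Phi 5 * mom 0 crank_gf)"
  "mom 8 crank_gf = 14 * (Phi 1 * mom 6 crank_gf) + 70 * (Phi 3 * mom 4 crank_gf) +
      42 * (Phi 5 * mom 2 crank_gf) + 2 * (Phi 7 * mom 0 crank_gf)"
  "mom 10 crank_gf = 18 * (Phi 1 * mom 8 crank_gf) + 168 * (Phi 3 * mom 6 crank_gf) +
      252 * (Phi 5 * mom 4 crank_gf) + 72 * (Phi 7 * mom 2 crank_gf) + 2 * (Phi 9 * mom 0 crank_gf)"
  "mom 12 crank_gf = 22 * (Phi 1 * mom 10 crank_gf) + 330 * (Phi 3 * mom 8 crank_gf) +
      924 * (Phi 5 * mom 6 crank_gf) + 660 * (Phi 7 * mom 4 crank_gf) + 110 * (Phi 9 * mom 2 crank_gf) +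
      2 * (Phi 11 * mom 0 crank_gf)"
proof -
  have *: "mom k crank_gf = (\<Sum>i\<le>j. of_nat (j choose i) * (mom i Lam * mom (j - i) crank_gf))" if "k = Suc j" for j k
    unfolding that mom_Suc zdp_crank_gf mom_mult ..
  note odd = mom_odd[OF sym_crank_gf]
  show "mom 2 crank_gf = 2 * (Phi 1 * mom 0 crank_gf)"
    using *[of 2 1] by (simp add: mom_Lam mom_even_Lam atMost_nat_numeral choose_rows odd algebra_simps)
  show "mom 4 crank_gf = 6 * (Phi 1 * mom 2 crank_gf) + 2 * (Phi 3 * mom 0 crank_gf)"
    using *[of 4 3] by (simp add: mom_Lam mom_even_Lam atMost_nat_numeral choose_rows odd algebra_simps)
  show "mom 6 crank_gf = 10 * (Phi 1 * mom 4 crank_gf) + 20 * (Phi 3 * mom 2 crank_gf) + 2 * (Phi 5 * mom 0 crank_gf)"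
    using *[of 6 5] by (simp add: mom_Lam mom_even_Lam atMost_nat_numeral choose_rows odd algebra_simps)
  show "mom 8 crank_gf = 14 * (Phi 1 * mom 6 crank_gf) + 70 * (Phi 3 * mom 4 crank_gf) +
      42 * (Phi 5 * mom 2 crank_gf) + 2 * (Phi 7 * mom 0 crank_gf)"
    using *[of 8 7] by (simp add: mom_Lam mom_even_Lam atMost_nat_numeral choose_rows odd algebra_simps)
  show "mom 10 crank_gf = 18 * (Phi 1 * mom 8 crank_gf) + 168 * (Phi 3 * mom 6 crank_gf) +
      252 * (Phi 5 * mom 4 crank_gf) + 72 * (Phi 7 * mom 2 crank_gf) + 2 * (Phi 9 * mom 0 crank_gf)"
    using *[of 10 9] by (simp add: mom_Lam mom_even_Lam atMost_nat_numeral choose_rows odd algebra_simps)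
  show "mom 12 crank_gf = 22 * (Phi 1 * mom 10 crank_gf) + 330 * (Phi 3 * mom 8 crank_gf) +
      924 * (Phi 5 * mom 6 crank_gf) + 660 * (Phi 7 * mom 4 crank_gf) + 110 * (Phi 9 * mom 2 crank_gf) +
      2 * (Phi 11 * mom 0 crank_gf)"
    using *[of 12 11] by (simp add: mom_Lam mom_even_Lam atMost_nat_numeral choose_rows odd algebra_simps)
qed

lemma crank3_rec:
  "mom 2 crank3 = 6 * (Phi 1 * mom 0 crank3)"
  "mom 4 crank3 = 18 * (Phi 1 * mom 2 crank3) + 6 * (Phi 3 * mom 0 crank3)"
  "mom 6 crank3 = 30 * (Phi 1 * mom 4 crank3) + 60 * (Phi 3 * mom 2 crank3) + 6 * (Phi 5 * mom 0 crank3)"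
  "mom 8 crank3 = 42 * (Phi 1 * mom 6 crank3) + 210 * (Phi 3 * mom 4 crank3) + 126 * (Phi 5 * mom 2 crank3) +
      6 * (Phi 7 * mom 0 crank3)"
  "mom 10 crank3 = 54 * (Phi 1 * mom 8 crank3) + 504 * (Phi 3 * mom 6 crank3) +
      756 * (Phi 5 * mom 4 crank3) + 216 * (Phi 7 * mom 2 crank3) + 6 * (Phi 9 * mom 0 crank3)"
  "mom 12 crank3 = 66 * (Phi 1 * mom 10 crank3) + 990 * (Phi 3 * mom 8 crank3) +
      2772 * (Phi 5 * mom 6 crank3) + 1980 * (Phi 7 * mom 4 crank3) + 330 * (Phi 9 * mom 2 crank3) +
      6 * (Phi 11 * mom 0 crank3)"
proof -
  have *: "mom k crank3 = (\<Sum>i\<le>j. of_nat (j choose i) * (3 * mom i Lam * mom (j - i) crank3))" if "k = Suc j" for j k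
    unfolding that mom_Suc zdp_crank3 mult.assoc mom_numeral unfolding mom_mult sum_distrib_left by (simp add: mult_ac)
  note odd = mom_odd[OF sym_crank3]
  show "mom 2 crank3 = 6 * (Phi 1 * mom 0 crank3)"
    using *[of 2 1] by (simp add: mom_Lam mom_even_Lam atMost_nat_numeral choose_rows odd algebra_simps)
  show "mom 4 crank3 = 18 * (Phi 1 * mom 2 crank3) + 6 * (Phi 3 * mom 0 crank3)"
    using *[of 4 3] by (simp add: mom_Lam mom_even_Lam atMost_nat_numeral choose_rows odd algebra_simps)
  show "mom 6 crank3 = 30 * (Phi 1 * mom 4 crank3) + 60 * (Phi 3 * mom 2 crank3) + 6 * (Phi 5 * mom 0 crank3)"
    using *[of 6 5] by (simp add: mom_Lam mom_even_Lam atMost_nat_numeral choose_rows odd algebra_simps)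
  show "mom 8 crank3 = 42 * (Phi 1 * mom 6 crank3) + 210 * (Phi 3 * mom 4 crank3) +
      126 * (Phi 5 * mom 2 crank3) + 6 * (Phi 7 * mom 0 crank3)"
    using *[of 8 7] by (simp add: mom_Lam mom_even_Lam atMost_nat_numeral choose_rows odd algebra_simps)
  show "mom 10 crank3 = 54 * (Phi 1 * mom 8 crank3) + 504 * (Phi 3 * mom 6 crank3) +
      756 * (Phi 5 * mom 4 crank3) + 216 * (Phi 7 * mom 2 crank3) + 6 * (Phi 9 * mom 0 crank3)"
    using *[of 10 9] by (simp add: mom_Lam mom_even_Lam atMost_nat_numeral choose_rows odd algebra_simps)
  show "mom 12 crank3 = 66 * (Phi 1 * mom 10 crank3) + 990 * (Phi 3 * mom 8 crank3) +
      2772 * (Phi 5 * mom 6 crank3) + 1980 * (Phi 7 * mom 4 crank3) + 330 * (Phi 9 * mom 2 crank3) +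
      6 * (Phi 11 * mom 0 crank3)"
    using *[of 12 11] by (simp add: mom_Lam mom_even_Lam atMost_nat_numeral choose_rows odd algebra_simps)
qed

section \<open>Relations between Eisenstein series\<close>

lemma mom_uminus: "mom j (- Y) = - mom j Y"
  using mom_diff[of j 0 Y] mom_diff[of j 0 0] by simp

lemma mom_zdp: "mom j (zdp Y) = mom (j + 1) Y"
  by (simp add: mom_Suc)

lemma mom_numeral_const: "mom j (numeral k) = (if j = 0 then numeral k else 0)"
proof -
  have "mom j 1 = (if j = 0 then 1 else 0)" for j
  proof (cases j)
    case (Suc i)
    have "zdp 1 = 0" using zdp_mult[of 1 1] by simp
    moreover have "(zdp ^^ i) 0 = 0" by (rule fpsp_eqI) (simp add: zdp_power_nth)
    ultimately show ?thesis using Suc by (simp add: mom_Suc) (simp add: mom_def ev1_0)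
  qed (simp add: mom_def ev1_1)
  then show ?thesis using mom_numeral[of j k 1] by simp
qed

lemmas Suc_2 = numeral_2_eq_2[symmetric]

lemma numeral_cancel: "numeral k * f = numeral k * g \<Longrightarrow> f = g" for f g :: "int fps"
  by simp

text \<open>In terms of Eisenstein series these are E8 = E4^2, E10 = E4 E6 and 691 E12 = 441 E4^3 +
  250 E6^2. They are the equations of orders 6, 8 and 10 obtained from the Weierstrass
  equation.\<close>

lemma Phi_rec:
  "Phi 7 = Phi 3 + 120 * Phi 3 ^ 2"
  "11 * Phi 9 = 21 * Phi 5 - 10 * Phi 3 + 5040 * Phi 3 * Phi 5"
  "13 * Phi 11 = 63 * Phi 3 - 50 * Phi 5 + 15120 * Phi 3 ^ 2 + 1209600 * Phi 3 ^ 3 + 12600 * Phi 5 ^ 2"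
proof -
  obtain v where v: "12 * xx * (wp - lift (ev1 wp)) + (1 - xx)\<^sup>2 *
    (6 * wp * wp - zdp (zdp wp) + wp - 12 * lift (ev1 wp) * wp - lift v) = 0"
    using weierstrass by blast
  define A where "A = 6 * (wp * wp) - zdp (zdp wp) + wp - 12 * (lift (ev1 wp) * wp) - lift v"
  define K where "K = 12 * (wp - lift (ev1 wp))"
  have e: "(1 - xx)\<^sup>2 * A + (1 - xx\<^sup>2) * 0 + xx * K = 0"
    using v by (simp add: A_def K_def mult_ac add.commute)
  have mom0: "mom j 0 = 0" for j using mom_diff[of j 0 0] by simp
  note eval = mom_simps mom_numeral_const mom_zdp mom0 Suc_2
  have a2: "mom 2 A = 2 * Phi 3 - 2 * Phi 5"
    by (simp add: A_def eval ev1_wp algebra_simps)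
  have a4: "mom 4 A = 144 * Phi 3 ^ 2 - 2 * Phi 7 + 2 * Phi 5"
    by (simp add: A_def eval ev1_wp algebra_simps power2_eq_square)
  have a6: "mom 6 A = 720 * Phi 3 * Phi 5 - 2 * Phi 9 + 2 * Phi 7"
    by (simp add: A_def eval ev1_wp algebra_simps)
  have a8: "mom 8 A = 1344 * Phi 3 * Phi 7 + 1680 * Phi 5 ^ 2 - 2 * Phi 11 + 2 * Phi 9"
    by (simp add: A_def eval ev1_wp algebra_simps power2_eq_square)
  have odd: "mom j A = 0" if "odd j" for j
  proof -
    have "sym 1 A" unfolding A_def
      using sym_mult[OF sym_wp sym_wp] sym_zdp[OF sym_zdp[OF sym_wp]] sym_mult[OF sym_lift sym_wp] sym_wp sym_lift sym_numeral
      by (intro sym_diff sym_add sym_numeral) simp_all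
    then show ?thesis using that by (rule mom_odd)
  qed
  have k: "mom j K = 24 * Phi (Suc j)" if "even j" "j \<noteq> 0" for j
    using that by (simp add: K_def mom_numeral mom_diff mom_lift_const mom_wp)
  \<comment> \<open>The unknown constant \<open>v\<close> enters only \<open>mom 0 A\<close>, so the
    equation of order 2 eliminates it.\<close>
  have e2: "mom 0 A = - 12 * Phi 3"
  proof -
    have "2 * mom 0 A + 24 * Phi 3 = 0"
      using mom_equation[OF e, of 2] k[of 2] odd by (simp add: atMost_nat_numeral choose_rows mom0 Suc_2 algebra_simps)
    then have "2 * mom 0 A = 2 * (- 12 * Phi 3)"
      by (simp add: eq_neg_iff_add_eq_0)
    then show ?thesis by (rule numeral_cancel)
  qed
  have "2 * mom 0 A + 30 * mom 2 A + 30 * mom 4 A + 24 * Phi 7 = 0"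
    using mom_equation[OF e, of 6] k[of 6] odd by (simp add: atMost_nat_numeral choose_rows mom0 Suc_2 algebra_simps)
  then have "36 * Phi 7 = 36 * (Phi 3 + 120 * Phi 3 ^ 2)"
    unfolding e2 a2 a4 by (simp add: algebra_simps power2_eq_square)
  then show f7: "Phi 7 = Phi 3 + 120 * Phi 3 ^ 2" by (rule numeral_cancel)
  have "2 * mom 0 A + 56 * mom 2 A + 140 * mom 4 A + 56 * mom 6 A + 24 * Phi 9 = 0"
    using mom_equation[OF e, of 8] k[of 8] odd by (simp add: atMost_nat_numeral choose_rows mom0 Suc_2 algebra_simps)
  then have "8 * (11 * Phi 9) = 8 * (21 * Phi 5 - 10 * Phi 3 + 5040 * Phi 3 * Phi 5)"
    unfolding e2 a2 a4 a6 f7 by (simp add: algebra_simps power2_eq_square)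
  then show f9: "11 * Phi 9 = 21 * Phi 5 - 10 * Phi 3 + 5040 * Phi 3 * Phi 5" by (rule numeral_cancel)
  have "2 * mom 0 A + 90 * mom 2 A + 420 * mom 4 A + 420 * mom 6 A + 90 * mom 8 A + 24 * Phi 11 = 0"
    using mom_equation[OF e, of 10] k[of 10] odd by (simp add: atMost_nat_numeral choose_rows mom0 Suc_2 algebra_simps)
  then have "156 * Phi 11 = 156 * Phi 3 + 660 * Phi 5 + 60480 * Phi 3 ^ 2 + 302400 * Phi 3 * Phi 5 - 60 * (11 * Phi 9)
      + 120960 * Phi 3 * Phi 7 + 151200 * Phi 5 ^ 2"
    unfolding e2 a2 a4 a6 a8 by (simp add: algebra_simps power2_eq_square)
  then have "12 * (13 * Phi 11) = 12 * (63 * Phi 3 - 50 * Phi 5 + 15120 * Phi 3 ^ 2 + 1209600 * Phi 3 ^ 3 +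
      12600 * Phi 5 ^ 2)"
    unfolding f9 f7 by (simp add: algebra_simps power2_eq_square power3_eq_cube)
  then show "13 * Phi 11 = 63 * Phi 3 - 50 * Phi 5 + 15120 * Phi 3 ^ 2 + 1209600 * Phi 3 ^ 3 + 12600 * Phi 5 ^ 2"
    by (rule numeral_cancel)
qed

text \<open>Ramanujan's differential equations for \<open>E\<^sub>2 = 1 - 24 \<Phi>\<^sub>1\<close>, \<open>E\<^sub>4 = 1 + 240 \<Phi>\<^sub>3\<close> and \<open>E\<^sub>6 = 1 - 504 \<Phi>\<^sub>5\<close>.\<close>

lemma qd_Phi:
  "6 * qd (Phi 1) = Phi 1 - 12 * Phi 1 ^ 2 + 5 * Phi 3"
  "30 * qd (Phi 3) = 10 * Phi 3 + 21 * Phi 5 - 240 * Phi 1 * Phi 3 - Phi 1"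
  "42 * qd (Phi 5) = Phi 1 + 20 * Phi 3 + 21 * Phi 5 - 504 * Phi 1 * Phi 5 + 2400 * Phi 3 ^ 2"
proof -
  define A where "A = zdp (zdp Lam) - 2 * (Lam * zdp Lam) - 2 * qd Lam"
  have e: "(1 - xx)\<^sup>2 * A + (1 - xx\<^sup>2) * (- zdp Lam) + xx * (- (2 * Lam)) = 0"
    using heat by (simp add: A_def mult_ac)
  note eval = mom_simps mom_numeral_const mom_zdp mom_uminus qd_two qd_0 Suc_2
  have b1: "mom 1 A = 2 * Phi 3 - 8 * Phi 1 ^ 2 - 4 * qd (Phi 1)"
    by (simp add: A_def eval algebra_simps power2_eq_square)
  have b3: "mom 3 A = 2 * Phi 5 - 32 * Phi 1 * Phi 3 - 4 * qd (Phi 3)"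
    by (simp add: A_def eval algebra_simps)
  have b5: "mom 5 A = 2 * Phi 7 - 48 * Phi 1 * Phi 5 - 80 * Phi 3 ^ 2 - 4 * qd (Phi 5)"
    by (simp add: A_def eval algebra_simps power2_eq_square)
  have even: "mom j A = 0" if "even j" for j
  proof -
    have "sym (-1) A" unfolding A_def
      using sym_zdp[OF sym_zdp[OF sym_Lam]] sym_mult[OF sym_Lam sym_zdp[OF sym_Lam]] sym_qd[OF sym_Lam]
      by (intro sym_diff sym_numeral) simp_all
    then have "sym (if even j then -1 else 1) ((zdp ^^ j) A)" for j
      by (induction j) (use sym_zdp in force)+
    then show ?thesis using that unfolding mom_def by (metis sym_ev1_0)
  qed
  have j3: "6 * mom 1 A + 4 * Phi 1 + 8 * Phi 3 = 0"
    using mom_equation[OF e, of 3] even by (simp add: eval algebra_simps)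
  then have "4 * (6 * qd (Phi 1)) = 4 * (Phi 1 - 12 * Phi 1 ^ 2 + 5 * Phi 3)"
    unfolding b1 by (simp add: algebra_simps)
  then show q1: "6 * qd (Phi 1) = Phi 1 - 12 * Phi 1 ^ 2 + 5 * Phi 3" by (rule numeral_cancel)
  have "10 * mom 1 A + 20 * mom 3 A + 4 * Phi 1 + 40 * Phi 3 + 16 * Phi 5 = 0"
    using mom_equation[OF e, of 5] even by (simp add: eval algebra_simps)
  \<comment> \<open>The factor 3 makes the coefficient of \<open>qd (Phi 1)\<close> a multiple of 6,
    so that \<open>q1\<close> can be inserted without division.\<close>
  then have "3 * (10 * mom 1 A + 20 * mom 3 A + 4 * Phi 1 + 40 * Phi 3 + 16 * Phi 5) = 0"
    by simp
  then have "240 * qd (Phi 3) = 180 * Phi 3 - 240 * Phi 1 ^ 2 + 168 * Phi 5 - 1920 * Phi 1 * Phi 3 +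
      12 * Phi 1 - 20 * (6 * qd (Phi 1))"
    unfolding b1 b3 by (simp add: algebra_simps)
  then have "8 * (30 * qd (Phi 3)) = 8 * (10 * Phi 3 + 21 * Phi 5 - 240 * Phi 1 * Phi 3 - Phi 1)"
    unfolding q1 by (simp add: algebra_simps)
  then show q3: "30 * qd (Phi 3) = 10 * Phi 3 + 21 * Phi 5 - 240 * Phi 1 * Phi 3 - Phi 1" by (rule numeral_cancel)
  have "14 * mom 1 A + 70 * mom 3 A + 42 * mom 5 A + 4 * Phi 1 + 84 * Phi 3 + 140 * Phi 5 + 24 * Phi 7 = 0"
    using mom_equation[OF e, of 7] even by (simp add: eval algebra_simps)
  then have "3 * (14 * mom 1 A + 70 * mom 3 A + 42 * mom 5 A + 4 * Phi 1 + 84 * Phi 3 + 140 * Phi 5 + 24 * Phi 7) = 0"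
    by simp
  then have "504 * qd (Phi 5) = 336 * Phi 3 - 336 * Phi 1 ^ 2 + 840 * Phi 5 - 6720 * Phi 1 * Phi 3 + 324 * Phi 7
      - 6048 * Phi 1 * Phi 5 - 10080 * Phi 3 ^ 2 + 12 * Phi 1 - 28 * (6 * qd (Phi 1)) - 28 * (30 * qd (Phi 3))"
    unfolding b1 b3 b5 by (simp add: algebra_simps)
  then have "12 * (42 * qd (Phi 5)) = 12 * (Phi 1 + 20 * Phi 3 + 21 * Phi 5 - 504 * Phi 1 * Phi 5 + 2400 * Phi 3 ^ 2)"
    unfolding q1 q3 Phi_rec(1) by (simp add: algebra_simps)
  then show "42 * qd (Phi 5) = Phi 1 + 20 * Phi 3 + 21 * Phi 5 - 504 * Phi 1 * Phi 5 + 2400 * Phi 3 ^ 2"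
    by (rule numeral_cancel)
qed

text \<open>The moments of \<open>rank_crank\<close> of order \<open>j\<close>, divided by 2. The
  total coefficient of \<open>mom j rank_gf\<close> inside the bracket is
  \<open>(j - 1) * (j - 2) / 2\<close>. It vanishes for \<open>j = 2\<close>, so the equation says
  nothing about the second rank moment.\<close>

lemma rank_rec:
  "mom 4 crank3 = genP\<^sup>2 * (1 * (6 * qd (mom 0 rank_gf) + mom 2 rank_gf) +
      6 * (6 * qd (mom 2 rank_gf) + mom 4 rank_gf) + - 4 * mom 2 rank_gf + - 4 * mom 4 rank_gf + mom 4 rank_gf)"
  "mom 6 crank3 = genP\<^sup>2 * (1 * (6 * qd (mom 0 rank_gf) + mom 2 rank_gf) +
      15 * (6 * qd (mom 2 rank_gf) + mom 4 rank_gf) + 15 * (6 * qd (mom 4 rank_gf) + mom 6 rank_gf) + -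
      6 * mom 2 rank_gf + - 20 * mom 4 rank_gf + - 6 * mom 6 rank_gf + mom 6 rank_gf)"
  "mom 8 crank3 = genP\<^sup>2 * (1 * (6 * qd (mom 0 rank_gf) + mom 2 rank_gf) +
      28 * (6 * qd (mom 2 rank_gf) + mom 4 rank_gf) + 70 * (6 * qd (mom 4 rank_gf) + mom 6 rank_gf) +
      28 * (6 * qd (mom 6 rank_gf) + mom 8 rank_gf) + - 8 * mom 2 rank_gf + - 56 * mom 4 rank_gf + -
      56 * mom 6 rank_gf + - 8 * mom 8 rank_gf + mom 8 rank_gf)"
  "mom 10 crank3 = genP\<^sup>2 * (1 * (6 * qd (mom 0 rank_gf) + mom 2 rank_gf) +
      45 * (6 * qd (mom 2 rank_gf) + mom 4 rank_gf) + 210 * (6 * qd (mom 4 rank_gf) + mom 6 rank_gf) +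
      210 * (6 * qd (mom 6 rank_gf) + mom 8 rank_gf) + 45 * (6 * qd (mom 8 rank_gf) + mom 10 rank_gf) + -
      10 * mom 2 rank_gf + - 120 * mom 4 rank_gf + - 252 * mom 6 rank_gf + - 120 * mom 8 rank_gf + -
      10 * mom 10 rank_gf + mom 10 rank_gf)"
  "mom 12 crank3 = genP\<^sup>2 * (1 * (6 * qd (mom 0 rank_gf) + mom 2 rank_gf) +
      66 * (6 * qd (mom 2 rank_gf) + mom 4 rank_gf) + 495 * (6 * qd (mom 4 rank_gf) + mom 6 rank_gf) +
      924 * (6 * qd (mom 6 rank_gf) + mom 8 rank_gf) + 495 * (6 * qd (mom 8 rank_gf) + mom 10 rank_gf) +
      66 * (6 * qd (mom 10 rank_gf) + mom 12 rank_gf) + - 12 * mom 2 rank_gf + - 220 * mom 4 rank_gf + -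
      792 * mom 6 rank_gf + - 792 * mom 8 rank_gf + - 220 * mom 10 rank_gf + - 12 * mom 12 rank_gf + mom 12 rank_gf)"
proof -
  define A where "A = lift (genP\<^sup>2) * (6 * qd rank_gf + zdp (zdp rank_gf))"
  define B where "B = lift (genP\<^sup>2) * zdp rank_gf"
  define K where "K = 2 * (lift (genP\<^sup>2) * rank_gf) - 2 * crank3"
  have e: "(1 - xx)\<^sup>2 * A + (1 - xx\<^sup>2) * B + xx * K = 0"
    using rank_crank by (simp add: A_def B_def K_def mult.assoc)
  note odd = mom_odd[OF sym_rank_gf]
  have A: "mom j A = (if even j then genP\<^sup>2 * (6 * qd (mom j rank_gf) + mom (j + 2) rank_gf) else 0)" for j
    using odd[of j] odd[of "j + 2"] by (simp add: A_def mom_lift mom_add mom_numeral mom_qd mom_zdp qd_0)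
  have B: "mom j B = (if odd j then genP\<^sup>2 * mom (j + 1) rank_gf else 0)" for j
    using odd[of "j + 1"] by (simp add: B_def mom_lift mom_zdp)
  have K: "mom j K = 2 * (genP\<^sup>2 * mom j rank_gf) - 2 * mom j crank3" for j
    by (simp add: K_def mom_diff mom_numeral mom_lift)

  have "2 * mom 4 crank3 = 2 * (genP\<^sup>2 * (1 * (6 * qd (mom 0 rank_gf) + mom 2 rank_gf) +
      6 * (6 * qd (mom 2 rank_gf) + mom 4 rank_gf) + - 4 * mom 2 rank_gf + - 4 * mom 4 rank_gf + mom 4 rank_gf))"
    using mom_equation[OF e, of 4] by (simp add: A B K atMost_nat_numeral choose_rows Suc_2 algebra_simps)
  then show "mom 4 crank3 = genP\<^sup>2 * (1 * (6 * qd (mom 0 rank_gf) + mom 2 rank_gf) +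
      6 * (6 * qd (mom 2 rank_gf) + mom 4 rank_gf) + - 4 * mom 2 rank_gf + - 4 * mom 4 rank_gf + mom 4 rank_gf)"
    by (rule numeral_cancel)
  have "2 * mom 6 crank3 = 2 * (genP\<^sup>2 * (1 * (6 * qd (mom 0 rank_gf) + mom 2 rank_gf) +
      15 * (6 * qd (mom 2 rank_gf) + mom 4 rank_gf) + 15 * (6 * qd (mom 4 rank_gf) + mom 6 rank_gf) + -
      6 * mom 2 rank_gf + - 20 * mom 4 rank_gf + - 6 * mom 6 rank_gf + mom 6 rank_gf))"
    using mom_equation[OF e, of 6] by (simp add: A B K atMost_nat_numeral choose_rows Suc_2 algebra_simps)
  then show "mom 6 crank3 = genP\<^sup>2 * (1 * (6 * qd (mom 0 rank_gf) + mom 2 rank_gf) +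
      15 * (6 * qd (mom 2 rank_gf) + mom 4 rank_gf) + 15 * (6 * qd (mom 4 rank_gf) + mom 6 rank_gf) + -
      6 * mom 2 rank_gf + - 20 * mom 4 rank_gf + - 6 * mom 6 rank_gf + mom 6 rank_gf)"
    by (rule numeral_cancel)
  have "2 * mom 8 crank3 = 2 * (genP\<^sup>2 * (1 * (6 * qd (mom 0 rank_gf) + mom 2 rank_gf) +
      28 * (6 * qd (mom 2 rank_gf) + mom 4 rank_gf) + 70 * (6 * qd (mom 4 rank_gf) + mom 6 rank_gf) +
      28 * (6 * qd (mom 6 rank_gf) + mom 8 rank_gf) + - 8 * mom 2 rank_gf + - 56 * mom 4 rank_gf + -
      56 * mom 6 rank_gf + - 8 * mom 8 rank_gf + mom 8 rank_gf))"
    using mom_equation[OF e, of 8] by (simp add: A B K atMost_nat_numeral choose_rows Suc_2 algebra_simps)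
  then show "mom 8 crank3 = genP\<^sup>2 * (1 * (6 * qd (mom 0 rank_gf) + mom 2 rank_gf) +
      28 * (6 * qd (mom 2 rank_gf) + mom 4 rank_gf) + 70 * (6 * qd (mom 4 rank_gf) + mom 6 rank_gf) +
      28 * (6 * qd (mom 6 rank_gf) + mom 8 rank_gf) + - 8 * mom 2 rank_gf + - 56 * mom 4 rank_gf + -
      56 * mom 6 rank_gf + - 8 * mom 8 rank_gf + mom 8 rank_gf)"
    by (rule numeral_cancel)
  have "2 * mom 10 crank3 = 2 * (genP\<^sup>2 * (1 * (6 * qd (mom 0 rank_gf) + mom 2 rank_gf) +
      45 * (6 * qd (mom 2 rank_gf) + mom 4 rank_gf) + 210 * (6 * qd (mom 4 rank_gf) + mom 6 rank_gf) +
      210 * (6 * qd (mom 6 rank_gf) + mom 8 rank_gf) + 45 * (6 * qd (mom 8 rank_gf) + mom 10 rank_gf) + -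
      10 * mom 2 rank_gf + - 120 * mom 4 rank_gf + - 252 * mom 6 rank_gf + - 120 * mom 8 rank_gf + -
      10 * mom 10 rank_gf + mom 10 rank_gf))"
    using mom_equation[OF e, of 10] by (simp add: A B K atMost_nat_numeral choose_rows Suc_2 algebra_simps)
  then show "mom 10 crank3 = genP\<^sup>2 * (1 * (6 * qd (mom 0 rank_gf) + mom 2 rank_gf) +
      45 * (6 * qd (mom 2 rank_gf) + mom 4 rank_gf) + 210 * (6 * qd (mom 4 rank_gf) + mom 6 rank_gf) +
      210 * (6 * qd (mom 6 rank_gf) + mom 8 rank_gf) + 45 * (6 * qd (mom 8 rank_gf) + mom 10 rank_gf) + -
      10 * mom 2 rank_gf + - 120 * mom 4 rank_gf + - 252 * mom 6 rank_gf + - 120 * mom 8 rank_gf + -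
      10 * mom 10 rank_gf + mom 10 rank_gf)"
    by (rule numeral_cancel)
  have "2 * mom 12 crank3 = 2 * (genP\<^sup>2 * (1 * (6 * qd (mom 0 rank_gf) + mom 2 rank_gf) +
      66 * (6 * qd (mom 2 rank_gf) + mom 4 rank_gf) + 495 * (6 * qd (mom 4 rank_gf) + mom 6 rank_gf) +
      924 * (6 * qd (mom 6 rank_gf) + mom 8 rank_gf) + 495 * (6 * qd (mom 8 rank_gf) + mom 10 rank_gf) +
      66 * (6 * qd (mom 10 rank_gf) + mom 12 rank_gf) + - 12 * mom 2 rank_gf + - 220 * mom 4 rank_gf + -
      792 * mom 6 rank_gf + - 792 * mom 8 rank_gf + - 220 * mom 10 rank_gf + - 12 * mom 12 rank_gf + mom 12 rank_gf))"
    using mom_equation[OF e, of 12] by (simp add: A B K atMost_nat_numeral choose_rows Suc_2 algebra_simps)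
  then show "mom 12 crank3 = genP\<^sup>2 * (1 * (6 * qd (mom 0 rank_gf) + mom 2 rank_gf) +
      66 * (6 * qd (mom 2 rank_gf) + mom 4 rank_gf) + 495 * (6 * qd (mom 4 rank_gf) + mom 6 rank_gf) +
      924 * (6 * qd (mom 6 rank_gf) + mom 8 rank_gf) + 495 * (6 * qd (mom 8 rank_gf) + mom 10 rank_gf) +
      66 * (6 * qd (mom 10 rank_gf) + mom 12 rank_gf) + - 12 * mom 2 rank_gf + - 220 * mom 4 rank_gf + -
      792 * mom 6 rank_gf + - 792 * mom 8 rank_gf + - 220 * mom 10 rank_gf + - 12 * mom 12 rank_gf + mom 12 rank_gf)"
    by (rule numeral_cancel)
qed

section \<open>Euler's pentagonal numbers and the discriminant\<close>

text \<open>The sum of \<open>r + 1 + 3 * i\<close> over \<open>i \<le> j\<close>, the exponent that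
  results from iterating \<open>rankG_rec\<close>. For \<open>k = Suc j\<close> it equals k(3k -
  1)/2 + k r, so \<open>r = 0\<close> and \<open>r = 1\<close> give the two families of pentagonal
  numbers.\<close>

definition pexp :: "nat \<Rightarrow> nat \<Rightarrow> nat" where
  "pexp r j = Suc j * (3 * j + 2) div 2 + Suc j * r"

definition gam :: "nat \<Rightarrow> int fps" where
  "gam r = Abs_fps (\<lambda>n. \<Sum>j<n. if n = pexp r j then (-1) ^ j else 0)"

lemma pexp_0 [simp]: "pexp r 0 = Suc r"
  by (simp add: pexp_def)

lemma pexp_Suc: "pexp r (Suc j) = pexp r j + 3 * j + 4 + r"
proof -
  have *: "Suc (Suc j) * (3 * Suc j + 2) = Suc j * (3 * j + 2) + (3 * j + 4) * 2"
    by (simp add: algebra_simps)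
  show ?thesis
    unfolding pexp_def * by (simp add: algebra_simps)
qed

lemma pexp_shift: "Suc r + pexp (r + 3) j = pexp r (Suc j)"
  by (induction j) (simp_all add: pexp_Suc)

lemma pexp_1: "pexp 1 j = pexp 0 j + Suc j"
  by (simp add: pexp_def)

lemma strict_mono_pexp: "strict_mono (pexp r)"
  by (simp add: strict_mono_Suc_iff pexp_Suc)

lemma pexp_gt: "j < pexp r j"
  by (induction j) (simp_all add: pexp_Suc)

lemma gam_nth: "n \<le> N \<Longrightarrow> gam r $ n = (\<Sum>j<N. if n = pexp r j then (-1) ^ j else 0)"
  unfolding gam_def fps_nth_Abs_fps
proof (rule sum.mono_neutral_left)
  show "\<forall>j \<in> {..<N} - {..<n}. (if n = pexp r j then (-1) ^ j else 0) = (0::int)"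
  proof
    fix j assume "j \<in> {..<N} - {..<n}"
    then show "(if n = pexp r j then (-1) ^ j else 0) = (0::int)"
      using pexp_gt[of j r] by auto
  qed
qed auto

lemma gam_pexp: "gam r $ pexp r j = (-1) ^ j"
proof -
  have "gam r $ pexp r j = (\<Sum>i<pexp r j. if i = j then (-1) ^ j else 0)"
    unfolding gam_nth[OF order_refl] using strict_mono_pexp[of r]
    by (intro sum.cong) (auto simp: strict_mono_eq)
  then show ?thesis using pexp_gt[of j r] by simp
qed

lemma gam_nth_0: "n \<notin> range (pexp r) \<Longrightarrow> gam r $ n = 0"
  by (auto simp: gam_def intro!: sum.neutral)

lemma gam_rec: "gam r = fps_X ^ Suc r * (1 - gam (r + 3))"
proof (rule fps_ext)
  fix n
  show "gam r $ n = (fps_X ^ Suc r * (1 - gam (r + 3))) $ n"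
  proof (cases "n < Suc r")
    case True
    have "n \<noteq> pexp r j" for j
      using strict_mono_less_eq[OF strict_mono_pexp, of r 0 j] True by simp
    then show ?thesis using True gam_nth_0[of n r] by (auto simp: fps_X_power_mult_nth simp del: power_Suc)
  next
    case False
    then obtain m where n: "n = Suc r + m" by (metis le_Suc_ex not_less)
    have "gam r $ n = (\<Sum>j<Suc n. if n = pexp r j then (-1) ^ j else 0)"
      by (rule gam_nth) simp
    also have "\<dots> = (if m = 0 then 1 else 0) + (\<Sum>j<n. if n = pexp r (Suc j) then (-1) ^ Suc j else 0)"
      unfolding sum.lessThan_Suc_shift by (simp add: n)
    also have "(\<Sum>j<n. if n = pexp r (Suc j) then (-1) ^ Suc j else 0) =
        - (\<Sum>j<n. if m = pexp (r + 3) j then (-1) ^ j else (0::int))"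
      unfolding sum_negf[symmetric] n pexp_shift[symmetric] by (rule sum.cong) simp_all
    also have "\<dots> = - (gam (r + 3) $ m)"
      by (subst gam_nth[of m n]) (simp_all add: n)
    finally show ?thesis
      using False by (simp add: fps_X_power_mult_nth n del: power_Suc)
  qed
qed

text \<open>Both sides satisfy the recursion \<open>rankG_rec\<close>, and \<open>gam r\<close> is
  its solution for the constant 1 in place of \<open>genP\<close>.\<close>

lemma genP_gam: "genP * gam r = rankG r"
proof (rule fps_ext)
  fix n
  show "(genP * gam r) $ n = rankG r $ n"
  proof (induction n arbitrary: r rule: less_induct)
    case (less n)
    have "genP * gam r = fps_X ^ Suc r * (genP - genP * gam (r + 3))"
      by (subst gam_rec) (simp add: algebra_simps)
    then show ?case
      by (subst rankG_rec) (use less[of "n - Suc r" "r + 3"] in \<open>simp add: fps_X_power_mult_nth del: power_Suc\<close>)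
  qed
qed

definition pent :: "int fps" where
  "pent = 1 - gam 0 - gam 1"

text \<open>Euler's pentagonal number theorem as a statement on ranks: \<open>rankG 0\<close> counts
  the nonempty partitions of rank at least 0, \<open>rankG 1\<close> those of negative rank, and 1
  is the empty partition.\<close>

lemma genP_pent: "genP * pent = 1"
proof -
  have *: "genP = 1 + rankG 0 + rankG 1"
    by (rule fps_ext) (simp add: genP_nth rankG_def card_partitions_rank)
  have "genP * pent = genP - rankG 0 - rankG 1"
    by (simp only: pent_def right_diff_distrib genP_gam mult_1_right)
  then show ?thesis by (subst (asm) (2) *) simp
qed

lemma pexp_0_neq_pexp_1: "pexp 0 i \<noteq> pexp 1 j"
proof (cases "i \<le> j")
  case True
  then have "pexp 0 i \<le> pexp 0 j" using strict_mono_less_eq[OF strict_mono_pexp] by blast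
  then show ?thesis unfolding pexp_1 by simp
next
  case False
  then have "pexp 0 (Suc j) \<le> pexp 0 i" using strict_mono_less_eq[OF strict_mono_pexp] by simp
  then show ?thesis unfolding pexp_1 pexp_Suc by simp
qed

lemma pent_nth_0: "pent $ 0 = 1"
  by (simp add: pent_def gam_def)

lemma pent_nth_pexp: "r \<in> {0, 1} \<Longrightarrow> pent $ pexp r j = (-1) ^ Suc j"
proof -
  assume "r \<in> {0, 1}"
  moreover have "gam 1 $ pexp 0 j = 0" "gam 0 $ pexp 1 j = 0"
    using pexp_0_neq_pexp_1 by (metis gam_nth_0 imageE)+
  moreover have "pexp r j \<noteq> 0" using pexp_gt[of j r] by simp
  ultimately show ?thesis by (auto simp: pent_def gam_pexp)
qed

lemma int_pexp: "int (pexp 0 j) = (int (Suc j) * (3 * int (Suc j) - 1)) div 2"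
    "int (pexp 1 j) = (int (Suc j) * (3 * int (Suc j) + 1)) div 2"
proof -
  have 0: "int (pexp 0 j) = (int (Suc j) * (3 * int (Suc j) - 1)) div 2"
    by (simp add: pexp_def zdiv_int algebra_simps)
  have "int (Suc j) * (3 * int (Suc j) + 1) = int (Suc j) * (3 * int (Suc j) - 1) + int (Suc j) * 2"
    by (simp add: algebra_simps)
  then show "int (pexp 1 j) = (int (Suc j) * (3 * int (Suc j) + 1)) div 2"
    using 0 unfolding pexp_1 by simp
  show "int (pexp 0 j) = (int (Suc j) * (3 * int (Suc j) - 1)) div 2" by (fact 0)
qed

lemma pent_nth:
  fixes k s :: int
  assumes s: "s \<in> {1, -1}" and m: "int m = (k * (3 * k + s)) div 2"
  shows "pent $ m = (-1) ^ nat \<bar>k\<bar>"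
proof -
  have *: "pent $ m = (-1) ^ nat k"
    if "k \<ge> 0" and s: "s \<in> {1, -1}" and m: "int m = (k * (3 * k + s)) div 2" for k s :: int
  proof (cases "nat k")
    case 0
    then show ?thesis using that by (simp add: pent_nth_0)
  next
    case (Suc j)
    then have k: "k = int (Suc j)" using that by simp
    have "int m = int (pexp 0 j) \<or> int m = int (pexp 1 j)"
      using s m unfolding int_pexp k by auto
    then have "m = pexp 0 j \<or> m = pexp 1 j" by simp
    then show ?thesis unfolding Suc using pent_nth_pexp by auto
  qed
  show ?thesis
  proof (cases "k \<ge> 0")
    case True
    then show ?thesis using *[of k s] s m by simp
  next
    case False
    have "(- k) * (3 * (- k) + (- s)) = k * (3 * k + s)"
      by (simp add: algebra_simps)
    then show ?thesis using *[of "- k" "- s"] s m False by auto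
  qed
qed

lemma pent_nth_cases:
  "pent $ m = 0 \<or> (\<exists>k s. s \<in> {1, -1} \<and> int m = (k * (3 * k + s)) div 2)"
proof (cases "m = 0 \<or> m \<in> range (pexp 0) \<union> range (pexp 1)")
  case True
  then consider "m = 0" | j where "m = pexp 0 j" | j where "m = pexp 1 j" by blast
  then show ?thesis
  proof cases
    case 1
    then show ?thesis by (intro disjI2 exI[of _ 0] exI[of _ 1]) simp
  next
    case 2
    then show ?thesis
      by (intro disjI2 exI[of _ "int (Suc j)"] exI[of _ "-1"]) (simp add: int_pexp)
  next
    case 3
    then show ?thesis
      by (intro disjI2 exI[of _ "int (Suc j)"] exI[of _ 1]) (use int_pexp(2)[of j] in simp)
  qed
next
  case False
  then show ?thesis using gam_nth_0 by (simp add: pent_def)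
qed

lemma pent_nth_range: "pent $ m \<in> {-1, 0, 1}"
  using pent_nth_cases[of m] pent_nth by (metis insertCI minus_one_power_iff)

section \<open>The discriminant\<close>

definition Delta :: "int fps" where
  "Delta = genP ^ 24 * ((1 + 240 * Phi 3) ^ 3 - (1 - 504 * Phi 5)\<^sup>2)"

text \<open>The logarithmic derivative of \<open>genP ^ 24\<close> is \<open>24 * Phi 1\<close> and
  that of \<open>W\<close> is \<open>E2 = 1 - 24 * Phi 1\<close>. They add up to 1, so
  \<open>qd Delta = Delta\<close>, which leaves only the coefficient of q. Its value is 3 * 240 + 2
  * 504.\<close>

lemma Delta_eq: "Delta = 1728 * fps_X"
proof -
  define E2 E4 E6 where "E2 = 1 - 24 * Phi 1" and "E4 = 1 + 240 * Phi 3" and "E6 = 1 - 504 * Phi 5"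
  have "3 * qd E4 = 24 * (30 * qd (Phi 3))"
    by (simp add: E4_def qd_add qd_mult qd_numeral qd_1)
  then have E4: "3 * qd E4 = E2 * E4 - E6"
    unfolding qd_Phi by (simp add: E2_def E4_def E6_def algebra_simps)
  have "2 * qd E6 = - 24 * (42 * qd (Phi 5))"
    by (simp add: E6_def qd_diff qd_mult qd_numeral qd_1)
  then have E6: "2 * qd E6 = E2 * E6 - E4 * E4"
    unfolding qd_Phi by (simp add: E2_def E4_def E6_def algebra_simps power2_eq_square)
  define W where "W = E4 * E4 * E4 - E6 * E6"
  have "qd W = E4 * E4 * (3 * qd E4) - E6 * (2 * qd E6)"
    by (simp add: W_def qd_diff qd_mult algebra_simps)
  then have W: "qd W = E2 * W"
    unfolding E4 E6 by (simp add: W_def algebra_simps)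
  have pow: "qd (genP ^ k) = of_nat k * Phi 1 * genP ^ k" for k
    by (induction k) (simp_all add: qd_mult qd_genP qd_1 algebra_simps)
  have D: "Delta = genP ^ 24 * W"
    by (simp add: Delta_def W_def E4_def E6_def power2_eq_square power3_eq_cube)
  have "qd Delta = Delta"
    unfolding D qd_mult W pow by (simp add: E2_def algebra_simps)
  then have 0: "n \<noteq> 1 \<Longrightarrow> Delta $ n = 0" for n
    by (metis mult_cancel_right1 of_nat_eq_1_iff qd_nth)
  have Phi: "Phi k $ 0 = 0" "Phi k $ Suc 0 = 1" for k
    by (simp_all add: Phi_def sig_def)
  have E: "E4 $ 0 = 1" "E4 $ Suc 0 = 240" "E6 $ 0 = 1" "E6 $ Suc 0 = - 504"
    by (simp_all add: E4_def E6_def numeral_fps_mult_nth Phi)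
  have "W $ 0 = 0" "W $ 1 = 1728"
    using E by (simp_all add: W_def fps_mult_nth_1 fps_mult_nth_0)
  moreover have "(genP ^ 24) $ 0 = 1"
    by (simp add: fps_nth_power_0 genP_nth partitions_0)
  ultimately have "Delta $ 1 = 1728"
    by (simp add: D fps_mult_nth_1)
  then show ?thesis
    using 0 by (intro fps_ext) (auto simp: numeral_fps_mult_nth fps_X_def)
qed

section \<open>Reduction modulo 23\<close>

lemma eq_mod_23:
  fixes a b c :: "'a::comm_ring_1"
  shows "a = b + 23 * c \<Longrightarrow> (23 :: 'a) = 0 \<Longrightarrow> a = b"
  by simp

text \<open>\<open>X\<close>, \<open>Y\<close>, \<open>Z\<close> stand for \<open>E\<^sub>2\<close>, \<open>E\<^sub>4\<close>, \<open>E\<^sub>6\<close> modulo 23. The polynomial identities below hold over the integers up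
  to a multiple of 23, which is passed to \<open>eq_mod_23\<close>.\<close>

locale qm23 =
  fixes d :: "'a::comm_ring_1 \<Rightarrow> 'a" and P X Y Z :: 'a
  assumes m23: "(23 :: 'a) = 0"
    and d_add: "d (f + g) = d f + d g"
    and d_mult: "d (f * g) = d f * g + f * d g"
    and dP: "d P = P + 22 * (X * P)"
    and dX: "d X = 2 * (X * X) + 21 * Y"
    and dY: "d Y = 8 * (X * Y) + 15 * Z"
    and dZ: "d Z = 12 * (X * Z) + 11 * (Y * Y)"
begin

lemma d_0: "d 0 = 0"
  using d_add[of 0 0] by simp

lemma d_1: "d 1 = 0"
  using d_mult[of 1 1] by simp

lemma d_numeral: "d (numeral k) = 0"
proof -
  have "d (of_nat n) = 0" for n
    by (induction n) (simp_all add: d_add d_0 d_1)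
  from this[of "numeral k"] show ?thesis by simp
qed

lemma d_numeral_mult: "d (numeral k * f) = numeral k * d f"
  by (simp add: d_mult d_numeral)

lemma d_one_mult: "d (1 * f) = 1 * d f"
  by simp

lemmas d_simps = d_add d_numeral d_numeral_mult d_1 d_0 d_mult dP dX dY dZ

text \<open>From here to \<open>M12_id\<close>: the recursions \<open>crank_rec\<close> with the
  earlier moments inserted. Each moment becomes \<open>P\<close> times a polynomial in
  \<open>X\<close>, \<open>Y\<close>, \<open>Z\<close> whose coefficients are reduced modulo 23 at
  every stage.\<close>

lemma M2_id: "2 * ((1 + 22*X) * P) = P * (2 + 21*X)"
  by (rule eq_mod_23[of _ _ "P * X"], simp add: algebra_simps, rule m23)

lemma M4_id: "6 * ((1 + 22*X) * (P * (2 + 21*X))) + 2 * ((16 + 7*Y) * P) = P * (21 + 14*Y + 22*X + 12*(X*X))"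
  by (rule eq_mod_23[of _ _ "P * (1 + 16*X + 120*(X*X))"], simp add: algebra_simps, rule m23)

lemma M6_id: "10 * ((1 + 22*X) * (P * (21 + 14*Y + 22*X + 12*(X*X)))) + 20 * ((16 + 7*Y) * (P * (2 +
    21*X))) + 2 * ((11 + 12*Z) * P) = P * (21 + Z + 6*Y + 14*X + 17*(X*Y) + 15*(X*X) + 18*(X*X*X))"
  by (rule eq_mod_23[of _ _ "P * (37 + Z + 18*Y + 502*X + 261*(X*Y) + 215*(X*X) +
      114*(X*X*X))"], simp add: algebra_simps, rule m23)

lemma M8_id: "14 * ((1 + 22*X) * (P * (21 + Z + 6*Y + 14*X + 17*(X*Y) + 15*(X*X) + 18*(X*X*X)))) +
    70 * ((16 + 7*Y) * (P * (21 + 14*Y + 22*X + 12*(X*X)))) + 42 * ((11 + 12*Z) * (P * (2 + 21*X))) +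
    2 * ((8 + 15*(Y*Y)) * P) = P * (6 + 10*Z + 18*Y + 13*(Y*Y) + 20*X + 13*(X*Z) + 9*(X*Y) + 22*(X*X) +
    7*(X*X*Y) + 19*(X*X*X) + X*X*X*X)"
  by (rule eq_mod_23[of _ _ "P * (1076 + 44*Z + 1132*Y + 299*(Y*Y) + 1782*X + 473*(X*Z) + 559*(X*Y) +
      780*(X*X) + 483*(X*X*Y) + 211*(X*X*X) + 241*(X*X*X*X))"], simp add: algebra_simps, rule m23)

lemma M10_id: "18 * ((1 + 22*X) * (P * (6 + 10*Z + 18*Y + 13*(Y*Y) + 20*X + 13*(X*Z) + 9*(X*Y) + 22*(X*X) +
    7*(X*X*Y) + 19*(X*X*X) + X*X*X*X))) + 168 * ((16 + 7*Y) * (P * (21 + Z + 6*Y + 14*X + 17*(X*Y) +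
    15*(X*X) + 18*(X*X*X)))) + 252 * ((11 + 12*Z) * (P * (21 + 14*Y + 22*X + 12*(X*X)))) + 72 * ((8 +
    15*(Y*Y)) * (P * (2 + 21*X))) + 2 * ((21 + 2*(Y*Z)) * P) = P * (19 + 17*Z + 8*Y + 20*(Y*Y) + 12*X +
    20*(X*Z) + 13*(X*Y) + 3*(X*Y*Y) + 20*(X*X) + 13*(X*X*Z) + 9*(X*X*Y) + 7*(X*X*X) + 20*(X*X*X*Y) +
    21*(X*X*X*X) + 5*(X*X*X*X*X))"
  by (rule eq_mod_23[of _ _ "P * (5041 + 2885*Z + 3476*Y + 1892*(Y*Z) + 410*(Y*Y) + 4932*X + 3074*(X*Z) +
      3019*(X*Y) + 2079*(X*Y*Y) + 3560*(X*X) + 1801*(X*X*Z) + 927*(X*X*Y) + 2497*(X*X*X) + 1040*(X*X*X*Y) +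
      327*(X*X*X*X) + 17*(X*X*X*X*X))"], simp add: algebra_simps, rule m23)

lemma M12_id: "22 * ((1 + 22*X) * (P * (19 + 17*Z + 8*Y + 20*(Y*Y) + 12*X + 20*(X*Z) + 13*(X*Y) + 3*(X*Y*Y) +
    20*(X*X) + 13*(X*X*Z) + 9*(X*X*Y) + 7*(X*X*X) + 20*(X*X*X*Y) + 21*(X*X*X*X) + 5*(X*X*X*X*X)))) +
    330 * ((16 + 7*Y) * (P * (6 + 10*Z + 18*Y + 13*(Y*Y) + 20*X + 13*(X*Z) + 9*(X*Y) + 22*(X*X) + 7*(X*X*Y) +
    19*(X*X*X) + X*X*X*X))) + 924 * ((11 + 12*Z) * (P * (21 + Z + 6*Y + 14*X + 17*(X*Y) + 15*(X*X) +
    18*(X*X*X)))) + 660 * ((8 + 15*(Y*Y)) * (P * (21 + 14*Y + 22*X + 12*(X*X)))) + 110 * ((21 +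
    2*(Y*Z)) * (P * (2 + 21*X))) + 2 * ((10 + 7*(Z*Z) + 6*(Y*Y*Y)) * P) = P * (8 + 15*Z + 16*(Z*Z) + 19*Y +
    10*(Y*Y) + 6*(Y*Y*Y) + 22*X + 10*(X*Z) + 2*(X*Y) + 5*(X*Y*Y) + 13*(X*X) + 14*(X*X*Z) + 16*(X*X*Y) +
    9*(X*X*Y*Y) + 17*(X*X*X) + 3*(X*X*X*Z) + 18*(X*X*X*Y) + 22*(X*X*X*X) + 7*(X*X*X*X*Y) + 16*(X*X*X*X*X) + 5*(X*X*X*X*X*X))"
  by (rule eq_mod_23[of _ _ "P * (15698 + 12877*Z + 482*(Z*Z) + 10607*Y + 3916*(Y*Z) + 13850*(Y*Y) +
      7332*(Y*Y*Y) + 18348*X + 10110*(X*Z) + 11768*(X*Y) + 9702*(X*Y*Z) + 10797*(X*Y*Y) + 14705*(X*X) +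
      7664*(X*X*Z) + 4098*(X*X*Y) + 5931*(X*X*Y*Y) + 12743*(X*X*X) + 8951*(X*X*X*Z) + 2116*(X*X*X*Y) +
      396*(X*X*X*X) + 521*(X*X*X*X*Y) + 446*(X*X*X*X*X) + 105*(X*X*X*X*X*X))"], simp add: algebra_simps, rule m23)

text \<open>From here to \<open>M10_1\<close>: iterated derivatives of the polynomials found above,
  \<open>i\<close>-fold in \<open>M2_i\<close> and likewise for the others, as far as powers of
  \<open>n\<close> multiply that moment in the theorem.\<close>

lemma M2_1: "d (P * (2 + 21*X)) = P * (2 + 4*Y + 19*X + 21*(X*X))"
  by (rule eq_mod_23[of _ _ "P * (19*Y + 2*X + 21*(X*X))"], simp add: d_simps algebra_simps, rule m23)

lemma M2_2: "d (P * (2 + 4*Y + 19*X + 21*(X*X))) = P * (2 + 14*Z + 12*Y + 17*X + 13*(X*Y) + 17*(X*X) + 17*(X*X*X))"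
  by (rule eq_mod_23[of _ _ "P * (2*Z + 17*Y + 2*X + 43*(X*Y) + 20*(X*X) +
      23*(X*X*X))"], simp add: d_simps algebra_simps, rule m23)

lemma M2_3: "d (P * (2 + 14*Z + 12*Y + 17*X + 13*(X*Y) + 17*(X*X) + 17*(X*X*X))) = P * (2 + 10*Z + Y +
    13*(Y*Y) + 15*X + 4*(X*Z) + 6*(X*Y) + 11*(X*X) + 15*(X*X*Y) + 22*(X*X*X) + 16*(X*X*X*X))"
  by (rule eq_mod_23[of _ _ "P * (8*Z + 16*Y + 18*(Y*Y) + 2*X + 29*(X*Z) + 47*(X*Y) + 18*(X*X) + 64*(X*X*Y) +
      19*(X*X*X) + 20*(X*X*X*X))"], simp add: d_simps algebra_simps, rule m23)

lemma M2_4: "d (P * (2 + 10*Z + Y + 13*(Y*Y) + 15*X + 4*(X*Z) + 6*(X*Y) + 11*(X*X) + 15*(X*X*Y) +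
    22*(X*X*X) + 16*(X*X*X*X))) = P * (2 + 2*Z + 17*Y + 14*(Y*Z) + 19*(Y*Y) + 13*X + 20*(X*Z) + 15*(X*Y) +
    18*(X*Y*Y) + 3*(X*X) + X*X*Z + 6*(X*X*Y) + 9*(X*X*X) + 14*(X*X*X*Y) + 11*(X*X*X*X) + 20*(X*X*X*X*X))"
  by (rule eq_mod_23[of _ _ "P * (Z + 13*Y + 20*(Y*Z) + 10*(Y*Y) + 2*X + 18*(X*Z) + 21*(X*Y) + 50*(X*Y*Y) +
      16*(X*X) + 16*(X*X*Z) + 69*(X*X*Y) + 13*(X*X*X) + 80*(X*X*X*Y) + 27*(X*X*X*X) +
      20*(X*X*X*X*X))"], simp add: d_simps algebra_simps, rule m23)

lemma M2_5: "d (P * (2 + 2*Z + 17*Y + 14*(Y*Z) + 19*(Y*Y) + 13*X + 20*(X*Z) + 15*(X*Y) + 18*(X*Y*Y) +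
    3*(X*X) + X*X*Z + 6*(X*X*Y) + 9*(X*X*X) + 14*(X*X*X*Y) + 11*(X*X*X*X) + 20*(X*X*X*X*X))) = P * (2 + 4*Z +
    3*(Z*Z) + 14*Y + 15*(Y*Z) + 11*(Y*Y) + 3*(Y*Y*Y) + 11*X + 14*(X*Z) + 7*(X*Y) + 20*(X*Y*Z) + 16*(X*Y*Y) +
    16*(X*X) + 6*(X*X*Z) + 18*(X*X*Y) + 3*(X*X*Y*Y) + 18*(X*X*X) + 18*(X*X*X*Z) + 15*(X*X*X*Y) +
    10*(X*X*X*X) + 5*(X*X*X*X*Y) + 5*(X*X*X*X*X) + 19*(X*X*X*X*X*X))"
  by (rule eq_mod_23[of _ _ "P * (11*Z + 9*(Z*Z) + 12*Y + 43*(Y*Z) + 15*(Y*Y) + 23*(Y*Y*Y) + 2*X + 13*(X*Z) +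
      28*(X*Y) + 50*(X*Y*Z) + 52*(X*Y*Y) + 13*(X*X) + 35*(X*X*Z) + 45*(X*X*Y) + 70*(X*X*Y*Y) + 3*(X*X*X) +
      10*(X*X*X*Z) + 49*(X*X*X*Y) + 11*(X*X*X*X) + 113*(X*X*X*X*Y) + 15*(X*X*X*X*X) +
      27*(X*X*X*X*X*X))"], simp add: d_simps algebra_simps, rule m23)

lemma M4_1: "d (P * (21 + 14*Y + 22*X + 12*(X*X))) = P * (21 + 3*Z + 16*Y + X + 4*(X*Y) + 11*(X*X) + 13*(X*X*X))"
  by (rule eq_mod_23[of _ _ "P * (9*Z + 20*Y + 21*X + 40*(X*Y) + 23*(X*X) +
      13*(X*X*X))"], simp add: d_simps algebra_simps, rule m23)

lemma M4_2: "d (P * (21 + 3*Z + 16*Y + X + 4*(X*Y) + 11*(X*X) + 13*(X*X*X))) = P * (21 + 13*Z + 14*Y +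
    2*(Y*Y) + 3*X + X*Z + 3*(X*Y) + 12*(X*X) + 4*(X*X*Y) + 19*(X*X*X*X))"
  by (rule eq_mod_23[of _ _ "P * (10*Z + Y + 5*(Y*Y) + 20*X + 7*(X*Z) + 41*(X*Y) + X*X + 41*(X*X*Y) +
      13*(X*X*X) + 15*(X*X*X*X))"], simp add: d_simps algebra_simps, rule m23)

lemma M4_3: "d (P * (21 + 13*Z + 14*Y + 2*(Y*Y) + 3*X + X*Z + 3*(X*Y) + 12*(X*X) + 4*(X*X*Y) +
    19*(X*X*X*X))) = P * (21 + 16*Z + 8*Y + 12*(Y*Z) + Y*Y + 5*X + 5*(X*Z) + 7*(X*Y) + 2*(X*Y*Y) + 15*(X*X) +
    4*(X*X*Z) + 8*(X*X*Y) + 13*(X*X*X) + 7*(X*X*X*Y) + 19*(X*X*X*X) + 18*(X*X*X*X*X))"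
  by (rule eq_mod_23[of _ _ "P * (9*Z + 3*Y + 3*(Y*Z) + 9*(Y*Y) + 20*X + 21*(X*Z) + 40*(X*Y) + 11*(X*Y*Y) +
      3*(X*X) + 4*(X*X*Z) + 4*(X*X*Y) + 13*(X*X*X) + 75*(X*X*X*Y) +
      24*(X*X*X*X*X))"], simp add: d_simps algebra_simps, rule m23)

lemma M4_4: "d (P * (21 + 16*Z + 8*Y + 12*(Y*Z) + Y*Y + 5*X + 5*(X*Z) + 7*(X*Y) + 2*(X*Y*Y) + 15*(X*X) +
    4*(X*X*Z) + 8*(X*X*Y) + 13*(X*X*X) + 7*(X*X*X*Y) + 19*(X*X*X*X) + 18*(X*X*X*X*X))) = P * (21 + 21*Z +
    19*(Z*Z) + 21*Y + 9*(Y*Z) + 2*(Y*Y) + 13*(Y*Y*Y) + 7*X + 10*(X*Z) + 3*(X*Y) + 19*(X*Y*Z) + 17*(X*Y*Y) +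
    20*(X*X) + 5*(X*X*Z) + 16*(X*X*Y) + 13*(X*X*Y*Y) + 12*(X*X*X) + 4*(X*X*X*Z) + 12*(X*X*X*Y) +
    15*(X*X*X*X) + 3*(X*X*X*X*Y) + 13*(X*X*X*X*X) + X*X*X*X*X*X)"
  by (rule eq_mod_23[of _ _ "P * (5*Z + 7*(Z*Z) + 4*Y + 6*(Y*Z) + 14*(Y*Y) + 7*(Y*Y*Y) + 20*X + 28*(X*Z) +
      38*(X*Y) + 31*(X*Y*Z) + 18*(X*Y*Y) + 5*(X*X) + 13*(X*X*Z) + 45*(X*X*Y) + 24*(X*X*Y*Y) + 17*(X*X*X) +
      11*(X*X*X*Z) + 81*(X*X*X*Y) + 16*(X*X*X*X) + 93*(X*X*X*X*Y) + 25*(X*X*X*X*X) +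
      25*(X*X*X*X*X*X))"], simp add: d_simps algebra_simps, rule m23)

lemma M6_1: "d (P * (21 + Z + 6*Y + 14*X + 17*(X*Y) + 15*(X*X) + 18*(X*X*X))) = P * (21 + 22*Z + Y + 16*X +
    13*(X*Z) + 22*(X*Y) + 6*(X*X) + 22*(X*X*Y) + 17*(X*X*X) + 21*(X*X*X*X))"
  by (rule eq_mod_23[of _ _ "P * (3*Z + 13*Y + 16*(Y*Y) + 20*X + 12*(X*Z) + 35*(X*Y) + 15*(X*X) +
      72*(X*X*Y) + 17*(X*X*X) + 21*(X*X*X*X))"], simp add: d_simps algebra_simps, rule m23)

lemma M6_2: "d (P * (21 + 22*Z + Y + 16*X + 13*(X*Z) + 22*(X*Y) + 6*(X*X) + 22*(X*X*Y) + 17*(X*X*X) +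
    21*(X*X*X*X))) = P * (21 + 14*Z + 15*Y + 20*(Y*Z) + 14*(Y*Y) + 18*X + 10*(X*Z) + 5*(X*Y) + 9*(X*Y*Y) +
    22*(X*X) + 16*(X*X*Z) + 3*(X*X*Y) + 12*(X*X*X) + 5*(X*X*X*Y) + 14*(X*X*X*X) + 9*(X*X*X*X*X))"
  by (rule eq_mod_23[of _ _ "P * (Z + 14*Y + 11*(Y*Z) + 30*(Y*Y) + 20*X + 47*(X*Z) + 13*(X*Y) + 46*(X*Y*Y) +
      16*(X*X) + 34*(X*X*Z) + 78*(X*X*Y) + 7*(X*X*X) + 109*(X*X*X*Y) + 21*(X*X*X*X) +
      27*(X*X*X*X*X))"], simp add: d_simps algebra_simps, rule m23)

lemma M6_3: "d (P * (21 + 14*Z + 15*Y + 20*(Y*Z) + 14*(Y*Y) + 18*X + 10*(X*Z) + 5*(X*Y) + 9*(X*Y*Y) +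
    22*(X*X) + 16*(X*X*Z) + 3*(X*X*Y) + 12*(X*X*X) + 5*(X*X*X*Y) + 14*(X*X*X*X) + 9*(X*X*X*X*X))) = P * (21 +
    9*Z + Z*Z + 2*Y + 6*(Y*Z) + 20*(Y*Y) + 18*(Y*Y*Y) + 20*X + 9*(X*Z) + 22*(X*Y) + 11*(X*Y*Z) + 18*(X*Y*Y) +
    17*(X*X) + 7*(X*X*Z) + 22*(X*X*Y) + 9*(X*X*X) + 16*(X*X*X*Z) + 18*(X*X*X*Y) + 5*(X*X*X*X) +
    21*(X*X*X*X*Y) + 15*(X*X*X*X*X) + 12*(X*X*X*X*X*X))"
  by (rule eq_mod_23[of _ _ "P * (10*Z + 13*(Z*Z) + 17*Y + 28*(Y*Z) + 11*(Y*Y) + 17*(Y*Y*Y) + 20*X +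
      24*(X*Z) + 59*(X*Y) + 77*(X*Y*Z) + 33*(X*Y*Y) + 19*(X*X) + 18*(X*X*Z) + 39*(X*X*Y) + 37*(X*X*Y*Y) +
      25*(X*X*X) + 29*(X*X*X*Z) + 55*(X*X*X*Y) + 15*(X*X*X*X) + 48*(X*X*X*X*Y) + 18*(X*X*X*X*X) +
      12*(X*X*X*X*X*X))"], simp add: d_simps algebra_simps, rule m23)

lemma M8_1: "d (P * (6 + 10*Z + 18*Y + 13*(Y*Y) + 20*X + 13*(X*Z) + 9*(X*Y) + 22*(X*X) + 7*(X*X*Y) +
    19*(X*X*X) + X*X*X*X)) = P * (6 + 4*Z + Y + 19*(Y*Z) + 13*(Y*Y) + 14*X + 5*(X*Z) + X*Y + 11*(X*Y*Y) +
    19*(X*X) + 21*(X*X*Z) + 20*(X*X*Y) + 16*(X*X*X) + 4*(X*X*X*X) + 7*(X*X*X*X*X))"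
  by (rule eq_mod_23[of _ _ "P * (12*Z + 19*Y + 28*(Y*Z) + 13*(Y*Y) + 6*X + 21*(X*Z) + 64*(X*Y) +
      40*(X*Y*Y) + 21*(X*X) + 24*(X*X*Z) + 64*(X*X*Y) + 25*(X*X*X) + 14*(X*X*X*Y) + 23*(X*X*X*X) +
      X*X*X*X*X)"], simp add: d_simps algebra_simps, rule m23)

lemma M8_2: "d (P * (6 + 4*Z + Y + 19*(Y*Z) + 13*(Y*Y) + 14*X + 5*(X*Z) + X*Y + 11*(X*Y*Y) + 19*(X*X) +
    21*(X*X*Z) + 20*(X*X*Y) + 16*(X*X*X) + 4*(X*X*X*X) + 7*(X*X*X*X*X))) = P * (6 + 19*Z + 9*(Z*Z) + 19*Y +
    8*(Y*Z) + 9*(Y*Y) + 3*(Y*Y*Y) + 8*X + 18*(X*Z) + X*Y + 9*(X*Y*Z) + 20*(X*Y*Y) + 10*(X*X) + 18*(X*X*Z) +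
    2*(X*X*Y) + 4*(X*X*Y*Y) + 4*(X*X*X) + 16*(X*X*X*Z) + 4*(X*X*X*Y) + 15*(X*X*X*X) + 22*(X*X*X*X*Y) +
    12*(X*X*X*X*X) + 17*(X*X*X*X*X*X))"
  by (rule eq_mod_23[of _ _ "P * (12*(Z*Z) + 12*Y + 22*(Y*Z) + 3*(Y*Y) + 19*(Y*Y*Y) + 6*X + 6*(X*Z) +
      36*(X*Y) + 87*(X*Y*Z) + 60*(X*Y*Y) + 15*(X*X) + 21*(X*X*Z) + 46*(X*X*Y) + 29*(X*X*Y*Y) + 22*(X*X*X) +
      34*(X*X*X*Z) + 44*(X*X*X*Y) + 19*(X*X*X*X) + 31*(X*X*X*X*Y) + 5*(X*X*X*X*X) +
      9*(X*X*X*X*X*X))"], simp add: d_simps algebra_simps, rule m23)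

lemma M10_1: "d (P * (19 + 17*Z + 8*Y + 20*(Y*Y) + 12*X + 20*(X*Z) + 13*(X*Y) + 3*(X*Y*Y) + 20*(X*X) +
    13*(X*X*Z) + 9*(X*X*Y) + 7*(X*X*X) + 20*(X*X*X*Y) + 21*(X*X*X*X) + 5*(X*X*X*X*X))) = P * (19 + 22*Z +
    7*Y + 8*(Y*Z) + 20*(Y*Y) + 17*(Y*Y*Y) + 16*X + 11*(X*Z) + 12*(X*Y) + 15*(X*Y*Z) + 4*(X*Y*Y) + 9*(X*X) +
    17*(X*X*Z) + 15*(X*X*Y) + 5*(X*X*Y*Y) + 21*(X*X*X) + 12*(X*X*X*Z) + 20*(X*X*X*Y) + 10*(X*X*X*X) +
    3*(X*X*X*X*Y) + 14*(X*X*X*X*X) + 22*(X*X*X*X*X*X))"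
  by (rule eq_mod_23[of _ _ "P * (5*Z + 11*Y + 44*(Y*Z) + 20*(Y*Y) + 2*(Y*Y*Y) + 18*X + 34*(X*Z) + 47*(X*Y) +
      27*(X*Y*Z) + 59*(X*Y*Y) + 13*(X*X) + 37*(X*X*Z) + 37*(X*X*Y) + 66*(X*X*Y*Y) + 22*(X*X*X) +
      34*(X*X*X*Z) + 90*(X*X*X*Y) + 9*(X*X*X*X) + 54*(X*X*X*X*Y) + 27*(X*X*X*X*X) +
      6*(X*X*X*X*X*X))"], simp add: d_simps algebra_simps, rule m23)

text \<open>From here to \<open>y12_id\<close>: the moments of \<open>crank3\<close> divided by
  \<open>genP ^ 3\<close>, by the same recursions with tripled factors.\<close>

lemma y2_id: "6 * (1 + 22*X) = (6 + 17*X)"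
  by (rule eq_mod_23[of _ _ "(5*X)"], simp add: algebra_simps, rule m23)

lemma y4_id: "18 * ((1 + 22*X) * (6 + 17*X)) + 6 * (16 + 7*Y) = (20 + 19*Y + 14*X + 16*(X*X))"
  by (rule eq_mod_23[of _ _ "(8 + Y + 116*X + 292*(X*X))"], simp add: algebra_simps, rule m23)

lemma y6_id: "30 * ((1 + 22*X) * (20 + 19*Y + 14*X + 16*(X*X))) + 60 * ((16 + 7*Y) * (6 + 17*X)) + 6 * (11 +
    12*Z) = (9 + 3*Z + 8*Y + 17*X + 15*(X*Y) + 14*(X*X) + 3*(X*X*X))"
  by (rule eq_mod_23[of _ _ "(279 + 3*Z + 134*Y + 1301*X + 855*(X*Y) + 422*(X*X) +
      459*(X*X*X))"], simp add: algebra_simps, rule m23)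

lemma y8_id: "42 * ((1 + 22*X) * (9 + 3*Z + 8*Y + 17*X + 15*(X*Y) + 14*(X*X) + 3*(X*X*X))) + 210 * ((16 +
    7*Y) * (20 + 19*Y + 14*X + 16*(X*X))) + 126 * ((11 + 12*Z) * (6 + 17*X)) + 6 * (8 + 15*(Y*Y)) = (19 +
    21*Z + 12*Y + 6*(Y*Y) + 6*X + 2*(X*Z) + 13*(X*Y) + 21*(X*X) + 5*(X*X*Y) + 21*(X*X*X) + 12*(X*X*X*X))"
  by (rule eq_mod_23[of _ _ "(3301 + 399*Z + 4068*Y + 1218*(Y*Y) + 3462*X + 1238*(X*Z) + 1243*(X*Y) +
      3045*(X*X) + 1625*(X*X*Y) + 567*(X*X*X) + 120*(X*X*X*X))"], simp add: algebra_simps, rule m23)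

lemma y10_id: "54 * ((1 + 22*X) * (19 + 21*Z + 12*Y + 6*(Y*Y) + 6*X + 2*(X*Z) + 13*(X*Y) + 21*(X*X) +
    5*(X*X*Y) + 21*(X*X*X) + 12*(X*X*X*X))) + 504 * ((16 + 7*Y) * (9 + 3*Z + 8*Y + 17*X + 15*(X*Y) +
    14*(X*X) + 3*(X*X*X))) + 756 * ((11 + 12*Z) * (20 + 19*Y + 14*X + 16*(X*X))) + 216 * ((8 +
    15*(Y*Y)) * (6 + 17*X)) + 6 * (21 + 2*(Y*Z)) = (15 + 19*Z + 7*Y + 22*(Y*Z) + 10*(Y*Y) + 22*X + 11*(X*Z) +
    3*(X*Y) + 13*(X*Y*Y) + 18*(X*X) + 6*(X*X*Z) + 16*(X*X*Y) + 19*(X*X*X) + 10*(X*X*X*Y) + 20*(X*X*X*X) + 19*(X*X*X*X*X))"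
  by (rule eq_mod_23[of _ _ "(10887 + 8989*Z + 11083*Y + 7954*(Y*Z) + 2086*(Y*Y) + 13294*X + 6611*(X*Z) +
      8517*(X*Y) + 5005*(X*Y*Y) + 11052*(X*X) + 6414*(X*X*Z) + 2830*(X*X*Y) + 2185*(X*X*X) + 718*(X*X*X*Y) +
      1112*(X*X*X*X) + 619*(X*X*X*X*X))"], simp add: algebra_simps, rule m23)

lemma y12_id: "66 * ((1 + 22*X) * (15 + 19*Z + 7*Y + 22*(Y*Z) + 10*(Y*Y) + 22*X + 11*(X*Z) + 3*(X*Y) +
    13*(X*Y*Y) + 18*(X*X) + 6*(X*X*Z) + 16*(X*X*Y) + 19*(X*X*X) + 10*(X*X*X*Y) + 20*(X*X*X*X) +
    19*(X*X*X*X*X))) + 990 * ((16 + 7*Y) * (19 + 21*Z + 12*Y + 6*(Y*Y) + 6*X + 2*(X*Z) + 13*(X*Y) +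
    21*(X*X) + 5*(X*X*Y) + 21*(X*X*X) + 12*(X*X*X*X))) + 2772 * ((11 + 12*Z) * (9 + 3*Z + 8*Y + 17*X +
    15*(X*Y) + 14*(X*X) + 3*(X*X*X))) + 1980 * ((8 + 15*(Y*Y)) * (20 + 19*Y + 14*X + 16*(X*X))) +
    330 * ((21 + 2*(Y*Z)) * (6 + 17*X)) + 6 * (10 + 7*(Z*Z) + 6*(Y*Y*Y)) = (6 + 16*Z + 14*(Z*Z) + 8*Y +
    18*(Y*Z) + 14*(Y*Y) + 4*(Y*Y*Y) + 17*X + 20*(X*Z) + 11*(X*Y) + 5*(X*Y*Z) + 19*(X*Y*Y) + 14*(X*X) +
    7*(X*X*Z) + 4*(X*X*Y) + 2*(X*X*Y*Y) + 16*(X*X*X) + 13*(X*X*X*Z) + 4*(X*X*X*Y) + 5*(X*X*X*X) +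
    22*(X*X*X*X*Y) + 3*(X*X*X*X*X) + 11*(X*X*X*X*X*X))"
  by (rule eq_mod_23[of _ _ "(40644 + 31510*Z + 4340*(Z*Z) + 37700*Y + 18132*(Y*Z) + 33602*(Y*Y) +
      26344*(Y*Y*Y) + 42443*X + 27194*(X*Z) + 31097*(X*Y) + 24173*(X*Y*Z) + 22663*(X*Y*Y) + 45482*(X*X) +
      20959*(X*X*Z) + 10006*(X*X*Y) + 22988*(X*X*Y*Y) + 19630*(X*X*X) + 4717*(X*X*X*Z) + 7366*(X*X*X*Y) +
      9521*(X*X*X*X) + 4246*(X*X*X*X*Y) + 1317*(X*X*X*X*X) + 1199*(X*X*X*X*X*X))"], simp add: algebra_simps, rule m23)

lemma V0_d: "d P = P * (1 + 22*X)"
  by (rule eq_mod_23[of _ _ "P * 0"], simp add: d_simps algebra_simps, rule m23)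

text \<open>In the identities for rank moments, \<open>n0\<close>, ..., \<open>n5\<close> stand for
  the second rank moment and its iterated derivatives, about which nothing is assumed. The leading 8
  is the inverse of 3 modulo 23. Factors 1 and nested brackets are kept in the form in which
  substitution in \<open>combination\<close> produces them.\<close>

lemma N4_id: "8 * (P * (20 + 19*Y + 14*X + 16*(X*X)) - 6 * (P * (1 + 22*X)) - 36 * (n1) - (- 3) * n0) =
    1 * n0 + 11 * n1 + P * (20 + 14*Y + 22*X + 13*(X*X))"
  by (rule eq_mod_23[of _ _ "1 * n0 + (- 13) * n1 + P * (4 + 6*Y + (- 42)*X + 5*(X*X))"], simp add: algebra_simps, rule m23)

lemma V4_d: "d (P * (20 + 14*Y + 22*X + 13*(X*X))) = P * (20 + 3*Z + 16*Y + 2*X + 12*(X*X) + 16*(X*X*X))"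
  by (rule eq_mod_23[of _ _ "P * (9*Z + 20*Y + 20*X + 42*(X*Y) + 23*(X*X) +
      14*(X*X*X))"], simp add: d_simps algebra_simps, rule m23)

lemma N6_id: "7 * (P * (9 + 3*Z + 8*Y + 17*X + 15*(X*Y) + 14*(X*X) + 3*(X*X*X)) - 6 * (P * (1 + 22*X)) -
    90 * (n1) - 90 * ((1 * n1 + 11 * n2 + P * (20 + 3*Z + 16*Y + 2*X + 12*(X*X) + 16*(X*X*X)))) -
    (- 5) * n0 - (- 5) * (1 * n0 + 11 * n1 + P * (20 + 14*Y + 22*X + 13*(X*X)))) = 1 * n0 + 22 * n1 +
    16 * n2 + P * (12 + 17*Z + 11*Y + 16*X + 13*(X*Y) + 8*(X*X) + 15*(X*X*X))"
  by (rule eq_mod_23[of _ _ "3 * n0 + (- 39) * n1 + (- 302) * n2 + P * ((- 517) + (- 82)*Z + (- 415)*Y +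
      (- 57)*X + 4*(X*Y) + (- 305)*(X*X) + (- 438)*(X*X*X))"], simp add: algebra_simps, rule m23)

lemma V6_d: "d (P * (12 + 17*Z + 11*Y + 16*X + 13*(X*Y) + 8*(X*X) + 15*(X*X*X))) = P * (12 + 21*Z + 2*Y +
    4*X + 14*(X*Z) + 12*(X*Y) + X*X + 4*(X*X*Y) + 16*(X*X*X) + 6*(X*X*X*X))"
  by (rule eq_mod_23[of _ _ "P * (7*Z + 15*Y + 20*(Y*Y) + 12*X + 33*(X*Z) + 29*(X*Y) + 17*(X*X) +
      59*(X*X*Y) + 9*(X*X*X) + 18*(X*X*X*X))"], simp add: d_simps algebra_simps, rule m23)

lemma N8_id: "11 * (P * (19 + 21*Z + 12*Y + 6*(Y*Y) + 6*X + 2*(X*Z) + 13*(X*Y) + 21*(X*X) + 5*(X*X*Y) +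
    21*(X*X*X) + 12*(X*X*X*X)) - 6 * (P * (1 + 22*X)) - 168 * (n1) - 420 * ((1 * n1 + 11 * n2 + P * (20 +
    3*Z + 16*Y + 2*X + 12*(X*X) + 16*(X*X*X)))) - 168 * ((1 * n1 + 22 * n2 + 16 * n3 + P * (12 + 21*Z + 2*Y +
    4*X + 14*(X*Z) + 12*(X*Y) + X*X + 4*(X*X*Y) + 16*(X*X*X) + 6*(X*X*X*X)))) - (- 7) * n0 -
    (- 28) * (1 * n0 + 11 * n1 + P * (20 + 14*Y + 22*X + 13*(X*X))) - 14 * (1 * n0 + 22 * n1 + 16 * n2 +
    P * (12 + 17*Z + 11*Y + 16*X + 13*(X*Y) + 8*(X*X) + 15*(X*X*X)))) = 1 * n0 + 10 * n1 + 15 * n2 +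
    10 * n3 + P * (3 + 7*Z + 22*Y + 20*(Y*Y) + 2*X + 2*(X*Z) + 18*(X*X) + 3*(X*X*X) + 15*(X*X*X*X))"
  by (rule eq_mod_23[of _ _ "10 * n0 + (- 362) * n1 + (- 4085) * n2 + (- 1286) * n3 + P * ((- 4788) +
      (- 2394)*Z + (- 3256)*Y + 2*(Y*Y) + (- 596)*X + (- 1124)*(X*Z) + (- 1045)*(X*Y) + (- 2361)*(X*X) +
      (- 319)*(X*X*Y) + (- 4590)*(X*X*X) + (- 477)*(X*X*X*X))"], simp add: algebra_simps, rule m23)

lemma V8_d: "d (P * (3 + 7*Z + 22*Y + 20*(Y*Y) + 2*X + 2*(X*Z) + 18*(X*X) + 3*(X*X*X) + 15*(X*X*X*X))) =
    P * (3 + 15*Z + 18*Y + 21*(Y*Z) + 5*(Y*Y) + 22*X + 10*(X*Z) + 13*(X*Y) + 20*(X*X) + 3*(X*X*Z) +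
    5*(X*X*Y) + 11*(X*X*X) + 18*(X*X*X*Y) + 7*(X*X*X*X) + 13*(X*X*X*X*X))"
  by (rule eq_mod_23[of _ _ "P * (14*Z + 2*Y + 27*(Y*Z) + 4*(Y*Y) + 2*X + 10*(X*Z) + 61*(X*Y) + 34*(X*Y*Y) +
      2*(X*X) + 3*(X*X*Z) + 8*(X*X*Y) + 20*(X*X*X) + 54*(X*X*X*Y) + 4*(X*X*X*X) +
      19*(X*X*X*X*X))"], simp add: d_simps algebra_simps, rule m23)

lemma N10_id: "16 * (P * (15 + 19*Z + 7*Y + 22*(Y*Z) + 10*(Y*Y) + 22*X + 11*(X*Z) + 3*(X*Y) + 13*(X*Y*Y) +
    18*(X*X) + 6*(X*X*Z) + 16*(X*X*Y) + 19*(X*X*X) + 10*(X*X*X*Y) + 20*(X*X*X*X) + 19*(X*X*X*X*X)) -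
    6 * (P * (1 + 22*X)) - 270 * (n1) - 1260 * ((1 * n1 + 11 * n2 + P * (20 + 3*Z + 16*Y + 2*X + 12*(X*X) +
    16*(X*X*X)))) - 1260 * ((1 * n1 + 22 * n2 + 16 * n3 + P * (12 + 21*Z + 2*Y + 4*X + 14*(X*Z) + 12*(X*Y) +
    X*X + 4*(X*X*Y) + 16*(X*X*X) + 6*(X*X*X*X)))) - 270 * ((1 * n1 + 10 * n2 + 15 * n3 + 10 * n4 + P * (3 +
    15*Z + 18*Y + 21*(Y*Z) + 5*(Y*Y) + 22*X + 10*(X*Z) + 13*(X*Y) + 20*(X*X) + 3*(X*X*Z) + 5*(X*X*Y) +
    11*(X*X*X) + 18*(X*X*X*Y) + 7*(X*X*X*X) + 13*(X*X*X*X*X)))) - (- 9) * n0 - (- 75) * (1 * n0 + 11 * n1 +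
    P * (20 + 14*Y + 22*X + 13*(X*X))) - (- 42) * (1 * n0 + 22 * n1 + 16 * n2 + P * (12 + 17*Z + 11*Y +
    16*X + 13*(X*Y) + 8*(X*X) + 15*(X*X*X))) - 90 * (1 * n0 + 10 * n1 + 15 * n2 + 10 * n3 + P * (3 + 7*Z +
    22*Y + 20*(Y*Y) + 2*X + 2*(X*Z) + 18*(X*X) + 3*(X*X*X) + 15*(X*X*X*X)))) = 1 * n0 + 21 * n1 + 20 * n2 +
    4 * n3 + 17 * n4 + P * (8 + 17*Z + Y + 22*(Y*Z) + 15*(Y*Y) + 6*X + 20*(X*Z) + 21*(X*Y) + X*Y*Y +
    6*(X*X) + 16*(X*X*Z) + 21*(X*X*Y) + 20*(X*X*X) + 2*(X*X*X*Y) + 20*(X*X*X*X) + 11*(X*X*X*X*X))"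
  by (rule eq_mod_23[of _ _ "25 * n0 + (- 1539) * n1 + (- 31276) * n2 + (- 17468) * n3 + (- 1879) * n4 +
      P * ((- 27400) + (- 23783)*Z + (- 19479)*Y + (- 3930)*(Y*Z) + (- 2185)*(Y*Y) + (- 7978)*X +
      (- 14268)*(X*Z) + (- 12579)*(X*Y) + 9*(X*Y*Y) + (- 15354)*(X*X) + (- 560)*(X*X*Z) + (- 4435)*(X*X*Y) +
      (- 29852)*(X*X*X) + (- 3374)*(X*X*X*Y) + (- 7500)*(X*X*X*X) +
      (- 2429)*(X*X*X*X*X))"], simp add: algebra_simps, rule m23)

lemma V10_d: "d (P * (8 + 17*Z + Y + 22*(Y*Z) + 15*(Y*Y) + 6*X + 20*(X*Z) + 21*(X*Y) + X*Y*Y + 6*(X*X) +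
    16*(X*X*Z) + 21*(X*X*Y) + 20*(X*X*X) + 2*(X*X*X*Y) + 20*(X*X*X*X) + 11*(X*X*X*X*X))) = P * (8 + 9*Z +
    8*(Z*Z) + 12*Y + 18*(Y*Z) + 22*(Y*Y) + 10*(Y*Y*Y) + 21*X + 16*(X*Z) + 4*(X*Y) + 16*(X*Y*Z) + 17*(X*Y*Y) +
    12*(X*X) + 16*(X*X*Z) + 21*(X*X*Y) + 20*(X*X*Y*Y) + 15*(X*X*X) + 17*(X*X*X*Z) + 4*(X*X*X*Y) +
    5*(X*X*X*X) + 8*(X*X*X*X*Y) + 13*(X*X*X*X*X) + 7*(X*X*X*X*X*X))"
  by (rule eq_mod_23[of _ _ "P * (Z + 14*(Z*Z) + 5*Y + 38*(Y*Z) + 27*(Y*Y) + 11*(Y*Y*Y) + 7*X + 39*(X*Z) +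
      13*(X*Y) + 70*(X*Y*Z) + 72*(X*Y*Y) + 6*(X*X) + 45*(X*X*Z) + 84*(X*X*Y) + 14*(X*X*Y*Y) + 7*(X*X*X) +
      27*(X*X*X*Z) + 104*(X*X*X*Y) + 25*(X*X*X*X) + 53*(X*X*X*X*Y) + 26*(X*X*X*X*X) +
      15*(X*X*X*X*X*X))"], simp add: d_simps algebra_simps, rule m23)

lemma N12_id: "18 * (P * (6 + 16*Z + 14*(Z*Z) + 8*Y + 18*(Y*Z) + 14*(Y*Y) + 4*(Y*Y*Y) + 17*X + 20*(X*Z) +
    11*(X*Y) + 5*(X*Y*Z) + 19*(X*Y*Y) + 14*(X*X) + 7*(X*X*Z) + 4*(X*X*Y) + 2*(X*X*Y*Y) + 16*(X*X*X) +
    13*(X*X*X*Z) + 4*(X*X*X*Y) + 5*(X*X*X*X) + 22*(X*X*X*X*Y) + 3*(X*X*X*X*X) + 11*(X*X*X*X*X*X)) -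
    6 * (P * (1 + 22*X)) - 396 * (n1) - 2970 * ((1 * n1 + 11 * n2 + P * (20 + 3*Z + 16*Y + 2*X + 12*(X*X) +
    16*(X*X*X)))) - 5544 * ((1 * n1 + 22 * n2 + 16 * n3 + P * (12 + 21*Z + 2*Y + 4*X + 14*(X*Z) + 12*(X*Y) +
    X*X + 4*(X*X*Y) + 16*(X*X*X) + 6*(X*X*X*X)))) - 2970 * ((1 * n1 + 10 * n2 + 15 * n3 + 10 * n4 + P * (3 +
    15*Z + 18*Y + 21*(Y*Z) + 5*(Y*Y) + 22*X + 10*(X*Z) + 13*(X*Y) + 20*(X*X) + 3*(X*X*Z) + 5*(X*X*Y) +
    11*(X*X*X) + 18*(X*X*X*Y) + 7*(X*X*X*X) + 13*(X*X*X*X*X)))) - 396 * ((1 * n1 + 21 * n2 + 20 * n3 +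
    4 * n4 + 17 * n5 + P * (8 + 9*Z + 8*(Z*Z) + 12*Y + 18*(Y*Z) + 22*(Y*Y) + 10*(Y*Y*Y) + 21*X + 16*(X*Z) +
    4*(X*Y) + 16*(X*Y*Z) + 17*(X*Y*Y) + 12*(X*X) + 16*(X*X*Z) + 21*(X*X*Y) + 20*(X*X*Y*Y) + 15*(X*X*X) +
    17*(X*X*X*Z) + 4*(X*X*X*Y) + 5*(X*X*X*X) + 8*(X*X*X*X*Y) + 13*(X*X*X*X*X) + 7*(X*X*X*X*X*X)))) -
    (- 11) * n0 - (- 154) * (1 * n0 + 11 * n1 + P * (20 + 14*Y + 22*X + 13*(X*X))) - (- 297) * (1 * n0 +
    22 * n1 + 16 * n2 + P * (12 + 17*Z + 11*Y + 16*X + 13*(X*Y) + 8*(X*X) + 15*(X*X*X))) - 132 * (1 * n0 +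
    10 * n1 + 15 * n2 + 10 * n3 + P * (3 + 7*Z + 22*Y + 20*(Y*Y) + 2*X + 2*(X*Z) + 18*(X*X) + 3*(X*X*X) +
    15*(X*X*X*X))) - 275 * (1 * n0 + 21 * n1 + 20 * n2 + 4 * n3 + 17 * n4 + P * (8 + 17*Z + Y + 22*(Y*Z) +
    15*(Y*Y) + 6*X + 20*(X*Z) + 21*(X*Y) + X*Y*Y + 6*(X*X) + 16*(X*X*Z) + 21*(X*X*Y) + 20*(X*X*X) +
    2*(X*X*X*Y) + 20*(X*X*X*X) + 11*(X*X*X*X*X)))) = 1 * n0 + 9 * n1 + 8 * n2 + 2 * n3 + 4 * n4 + 11 * n5 +
    P * (7 + 4*Z + 15*(Z*Z) + 2*Y + 13*(Y*Z) + 18*(Y*Y) + 20*X + 15*(X*Z) + 3*(X*Y) + 7*(X*Y*Z) + 3*(X*Y*Y) +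
    13*(X*X) + 8*(X*X*Z) + 12*(X*X*Y) + 7*(X*X*Y*Y) + 4*(X*X*X) + 15*(X*X*X*Z) + 18*(X*X*X*Y) + 7*(X*X*X*X) +
    21*(X*X*X*X*Y) + 13*(X*X*X*X*X) + 5*(X*X*X*X*X*X))"
  by (rule eq_mod_23[of _ _ "43 * n0 + (- 8721) * n1 + (- 152908) * n2 + (- 112378) * n3 + (- 28142) * n4 +
      (- 5269) * n5 + P * ((- 104837) + (- 136160)*Z + (- 2469)*(Z*Z) + (- 89662)*Y + (- 59111)*(Y*Z) +
      (- 23724)*(Y*Y) + (- 3096)*(Y*Y*Y) + (- 74866)*X + (- 93441)*(X*Z) + (- 85011)*(X*Y) +
      (- 4955)*(X*Y*Z) + (- 5469)*(X*Y*Y) + (- 82151)*(X*X) + (- 15370)*(X*X*Z) + (- 40002)*(X*X*Y) +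
      (- 6197)*(X*X*Y*Y) + (- 137942)*(X*X*X) + (- 5259)*(X*X*X*Z) + (- 43506)*(X*X*X*Y) +
      (- 49703)*(X*X*X*X) + (- 2463)*(X*X*X*X*Y) + (- 36611)*(X*X*X*X*X) +
      (- 2161)*(X*X*X*X*X*X))"], simp add: algebra_simps, rule m23)

text \<open>The numerical factors are those of the theorem, expanded in powers of \<open>n\<close>.
  The coefficients of \<open>n0\<close>, ..., \<open>n5\<close> all become multiples of 23, and what
  remains is the discriminant, since 15 is -8 modulo 23.\<close>

lemma final_identity: "840 * (P * (2 + 21*X)) + 60 * (P * (2 + 4*Y + 19*X + 21*(X*X))) + 116 * (P * (2 +
    14*Z + 12*Y + 17*X + 13*(X*Y) + 17*(X*X) + 17*(X*X*X))) + 60 * (P * (2 + 10*Z + Y + 13*(Y*Y) + 15*X +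
    4*(X*Z) + 6*(X*Y) + 11*(X*X) + 15*(X*X*Y) + 22*(X*X*X) + 16*(X*X*X*X))) + 8 * (P * (2 + 2*Z + 17*Y +
    14*(Y*Z) + 19*(Y*Y) + 13*X + 20*(X*Z) + 15*(X*Y) + 18*(X*Y*Y) + 3*(X*X) + X*X*Z + 6*(X*X*Y) + 9*(X*X*X) +
    14*(X*X*X*Y) + 11*(X*X*X*X) + 20*(X*X*X*X*X))) + 4 * (P * (2 + 4*Z + 3*(Z*Z) + 14*Y + 15*(Y*Z) +
    11*(Y*Y) + 3*(Y*Y*Y) + 11*X + 14*(X*Z) + 7*(X*Y) + 20*(X*Y*Z) + 16*(X*Y*Y) + 16*(X*X) + 6*(X*X*Z) +
    18*(X*X*Y) + 3*(X*X*Y*Y) + 18*(X*X*X) + 18*(X*X*X*Z) + 15*(X*X*X*Y) + 10*(X*X*X*X) + 5*(X*X*X*X*Y) +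
    5*(X*X*X*X*X) + 19*(X*X*X*X*X*X))) + 22 * (P * (21 + 14*Y + 22*X + 12*(X*X))) + 21 * (P * (21 + 3*Z +
    16*Y + X + 4*(X*Y) + 11*(X*X) + 13*(X*X*X))) + 8 * (P * (21 + 13*Z + 14*Y + 2*(Y*Y) + 3*X + X*Z +
    3*(X*Y) + 12*(X*X) + 4*(X*X*Y) + 19*(X*X*X*X))) + 2 * (P * (21 + 16*Z + 8*Y + 12*(Y*Z) + Y*Y + 5*X +
    5*(X*Z) + 7*(X*Y) + 2*(X*Y*Y) + 15*(X*X) + 4*(X*X*Z) + 8*(X*X*Y) + 13*(X*X*X) + 7*(X*X*X*Y) +
    19*(X*X*X*X) + 18*(X*X*X*X*X))) + 10 * (P * (21 + 21*Z + 19*(Z*Z) + 21*Y + 9*(Y*Z) + 2*(Y*Y) +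
    13*(Y*Y*Y) + 7*X + 10*(X*Z) + 3*(X*Y) + 19*(X*Y*Z) + 17*(X*Y*Y) + 20*(X*X) + 5*(X*X*Z) + 16*(X*X*Y) +
    13*(X*X*Y*Y) + 12*(X*X*X) + 4*(X*X*X*Z) + 12*(X*X*X*Y) + 15*(X*X*X*X) + 3*(X*X*X*X*Y) + 13*(X*X*X*X*X) +
    X*X*X*X*X*X)) + 3042 * (P * (21 + Z + 6*Y + 14*X + 17*(X*Y) + 15*(X*X) + 18*(X*X*X))) + 5083 * (P * (21 +
    22*Z + Y + 16*X + 13*(X*Z) + 22*(X*Y) + 6*(X*X) + 22*(X*X*Y) + 17*(X*X*X) + 21*(X*X*X*X))) +
    507 * (P * (21 + 14*Z + 15*Y + 20*(Y*Z) + 14*(Y*Y) + 18*X + 10*(X*Z) + 5*(X*Y) + 9*(X*Y*Y) + 22*(X*X) +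
    16*(X*X*Z) + 3*(X*X*Y) + 12*(X*X*X) + 5*(X*X*X*Y) + 14*(X*X*X*X) + 9*(X*X*X*X*X))) + 13 * (P * (21 +
    9*Z + Z*Z + 2*Y + 6*(Y*Z) + 20*(Y*Y) + 18*(Y*Y*Y) + 20*X + 9*(X*Z) + 22*(X*Y) + 11*(X*Y*Z) + 18*(X*Y*Y) +
    17*(X*X) + 7*(X*X*Z) + 22*(X*X*Y) + 9*(X*X*X) + 16*(X*X*X*Z) + 18*(X*X*X*Y) + 5*(X*X*X*X) +
    21*(X*X*X*X*Y) + 15*(X*X*X*X*X) + 12*(X*X*X*X*X*X))) + 30 * (P * (6 + 4*Z + Y + 19*(Y*Z) + 13*(Y*Y) +
    14*X + 5*(X*Z) + X*Y + 11*(X*Y*Y) + 19*(X*X) + 21*(X*X*Z) + 20*(X*X*Y) + 16*(X*X*X) + 4*(X*X*X*X) +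
    7*(X*X*X*X*X))) + 5 * (P * (6 + 19*Z + 9*(Z*Z) + 19*Y + 8*(Y*Z) + 9*(Y*Y) + 3*(Y*Y*Y) + 8*X + 18*(X*Z) +
    X*Y + 9*(X*Y*Z) + 20*(X*Y*Y) + 10*(X*X) + 18*(X*X*Z) + 2*(X*X*Y) + 4*(X*X*Y*Y) + 4*(X*X*X) +
    16*(X*X*X*Z) + 4*(X*X*X*Y) + 15*(X*X*X*X) + 22*(X*X*X*X*Y) + 12*(X*X*X*X*X) + 17*(X*X*X*X*X*X))) +
    285 * (P * (19 + 17*Z + 8*Y + 20*(Y*Y) + 12*X + 20*(X*Z) + 13*(X*Y) + 3*(X*Y*Y) + 20*(X*X) + 13*(X*X*Z) +
    9*(X*X*Y) + 7*(X*X*X) + 20*(X*X*X*Y) + 21*(X*X*X*X) + 5*(X*X*X*X*X))) + 15 * (P * (19 + 22*Z + 7*Y +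
    8*(Y*Z) + 20*(Y*Y) + 17*(Y*Y*Y) + 16*X + 11*(X*Z) + 12*(X*Y) + 15*(X*Y*Z) + 4*(X*Y*Y) + 9*(X*X) +
    17*(X*X*Z) + 15*(X*X*Y) + 5*(X*X*Y*Y) + 21*(X*X*X) + 12*(X*X*X*Z) + 20*(X*X*X*Y) + 10*(X*X*X*X) +
    3*(X*X*X*X*Y) + 14*(X*X*X*X*X) + 22*(X*X*X*X*X*X))) + 1 * (P * (8 + 15*Z + 16*(Z*Z) + 19*Y + 10*(Y*Y) +
    6*(Y*Y*Y) + 22*X + 10*(X*Z) + 2*(X*Y) + 5*(X*Y*Y) + 13*(X*X) + 14*(X*X*Z) + 16*(X*X*Y) + 9*(X*X*Y*Y) +
    17*(X*X*X) + 3*(X*X*X*Z) + 18*(X*X*X*Y) + 22*(X*X*X*X) + 7*(X*X*X*X*Y) + 16*(X*X*X*X*X) +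
    5*(X*X*X*X*X*X))) + (13406400 * n0 + 4312560 * n1 + 541872 * n2 + 33348 * n3 + 1008 * n4 + 12 * n5) +
    (1 * n0 + 9 * n1 + 8 * n2 + 2 * n3 + 4 * n4 + 11 * n5 + P * (7 + 4*Z + 15*(Z*Z) + 2*Y + 13*(Y*Z) +
    18*(Y*Y) + 20*X + 15*(X*Z) + 3*(X*Y) + 7*(X*Y*Z) + 3*(X*Y*Y) + 13*(X*X) + 8*(X*X*Z) + 12*(X*X*Y) +
    7*(X*X*Y*Y) + 4*(X*X*X) + 15*(X*X*X*Z) + 18*(X*X*X*Y) + 7*(X*X*X*X) + 21*(X*X*X*X*Y) + 13*(X*X*X*X*X) +
    5*(X*X*X*X*X*X))) = P * (15*(Z*Z) + 8*(Y*Y*Y))"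
  by (rule eq_mod_23[of _ _ "582887 * n0 + 187503 * n1 + 23560 * n2 + 1450 * n3 + 44 * n4 + 1 * n5 +
      P * (8303 + 5659*Z + 12*(Z*Z) + 1581*Y + 489*(Y*Z) + 645*(Y*Y) + 28*(Y*Y*Y) + 6951*X + 3390*(X*Z) +
      7498*(X*Y) + 30*(X*Y*Z) + 284*(X*Y*Y) + 4295*(X*X) + 565*(X*X*Z) + 5143*(X*X*Y) + 11*(X*X*Y*Y) +
      6698*(X*X*X) + 26*(X*X*X*Z) + 397*(X*X*X*Y) + 5291*(X*X*X*X) + 22*(X*X*X*X*Y) + 306*(X*X*X*X*X) +
      29*(X*X*X*X*X*X))"], simp add: algebra_simps, rule m23)

lemma combination:
  assumes f: "f1 = (1 + 22*X)" "f3 = (16 + 7*Y)" "f5 = (11 + 12*Z)" "f7 = (8 + 15*(Y*Y))" "f9 = (21 +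
      2*(Y*Z))" "f11 = (10 + 7*(Z*Z) + 6*(Y*Y*Y))"
    and M: "M2 = 2 * (f1 * P)"
      "M4 = 6 * (f1 * M2) + 2 * (f3 * P)"
      "M6 = 10 * (f1 * M4) + 20 * (f3 * M2) + 2 * (f5 * P)"
      "M8 = 14 * (f1 * M6) + 70 * (f3 * M4) + 42 * (f5 * M2) + 2 * (f7 * P)"
      "M10 = 18 * (f1 * M8) + 168 * (f3 * M6) + 252 * (f5 * M4) + 72 * (f7 * M2) + 2 * (f9 * P)"
      "M12 = 22 * (f1 * M10) + 330 * (f3 * M8) + 924 * (f5 * M6) + 660 * (f7 * M4) + 110 * (f9 * M2) + 2 * (f11 * P)"
    and y: "y2 = 6 * f1"
      "y4 = 18 * (f1 * y2) + 6 * f3"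
      "y6 = 30 * (f1 * y4) + 60 * (f3 * y2) + 6 * f5"
      "y8 = 42 * (f1 * y6) + 210 * (f3 * y4) + 126 * (f5 * y2) + 6 * f7"
      "y10 = 54 * (f1 * y8) + 504 * (f3 * y6) + 756 * (f5 * y4) + 216 * (f7 * y2) + 6 * f9"
      "y12 = 66 * (f1 * y10) + 990 * (f3 * y8) + 2772 * (f5 * y6) + 1980 * (f7 * y4) + 330 * (f9 * y2) + 6 * f11"
    and N0: "N0 = P"
    and R4: "1 * (6 * d N0 + N2) + 6 * (6 * d N2 + N4) + - 4 * N2 + - 4 * N4 + N4 = P * y4"
    and R6: "1 * (6 * d N0 + N2) + 15 * (6 * d N2 + N4) + 15 * (6 * d N4 + N6) + - 6 * N2 + - 20 * N4 + -
        6 * N6 + N6 = P * y6"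
    and R8: "1 * (6 * d N0 + N2) + 28 * (6 * d N2 + N4) + 70 * (6 * d N4 + N6) + 28 * (6 * d N6 + N8) + -
        8 * N2 + - 56 * N4 + - 56 * N6 + - 8 * N8 + N8 = P * y8"
    and R10: "1 * (6 * d N0 + N2) + 45 * (6 * d N2 + N4) + 210 * (6 * d N4 + N6) + 210 * (6 * d N6 + N8) +
        45 * (6 * d N8 + N10) + - 10 * N2 + - 120 * N4 + - 252 * N6 + - 120 * N8 + - 10 * N10 + N10 = P * y10"
    and R12: "1 * (6 * d N0 + N2) + 66 * (6 * d N2 + N4) + 495 * (6 * d N4 + N6) + 924 * (6 * d N6 + N8) +
        495 * (6 * d N8 + N10) + 66 * (6 * d N10 + N12) + - 12 * N2 + - 220 * N4 + - 792 * N6 + - 792 * N8 +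
        - 220 * N10 + - 12 * N12 + N12 = P * y12"
  shows "(840 * M2 + 60 * d M2 + 116 * d (d M2) + 60 * d (d (d M2)) + 8 * d (d (d (d M2))) +
      4 * d (d (d (d (d M2))))) + (22 * M4 + 21 * d M4 + 8 * d (d M4) + 2 * d (d (d M4)) +
      10 * d (d (d (d M4)))) + (3042 * M6 + 5083 * d M6 + 507 * d (d M6) + 13 * d (d (d M6))) + (30 * d M8 +
      5 * d (d M8)) + (285 * M10 + 15 * d M10) + (1 * M12) + (13406400 * N2 + 4312560 * d N2 +
      541872 * d (d N2) + 33348 * d (d (d N2)) + 1008 * d (d (d (d N2))) + 12 * d (d (d (d (d N2))))) + N12 =
      P * (15*(Z*Z) + 8*(Y*Y*Y))"
proof -
  note m2_0 = M(1)[unfolded f M2_id]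
  note m2_1 = arg_cong[OF m2_0, of d, unfolded M2_1]
  note m2_2 = arg_cong[OF m2_1, of d, unfolded M2_2]
  note m2_3 = arg_cong[OF m2_2, of d, unfolded M2_3]
  note m2_4 = arg_cong[OF m2_3, of d, unfolded M2_4]
  note m2_5 = arg_cong[OF m2_4, of d, unfolded M2_5]
  note m4_0 = M(2)[unfolded m2_0 f M4_id]
  note m4_1 = arg_cong[OF m4_0, of d, unfolded M4_1]
  note m4_2 = arg_cong[OF m4_1, of d, unfolded M4_2]
  note m4_3 = arg_cong[OF m4_2, of d, unfolded M4_3]
  note m4_4 = arg_cong[OF m4_3, of d, unfolded M4_4]
  note m6_0 = M(3)[unfolded m2_0 m4_0 f M6_id]
  note m6_1 = arg_cong[OF m6_0, of d, unfolded M6_1]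
  note m6_2 = arg_cong[OF m6_1, of d, unfolded M6_2]
  note m6_3 = arg_cong[OF m6_2, of d, unfolded M6_3]
  note m8_0 = M(4)[unfolded m2_0 m4_0 m6_0 f M8_id]
  note m8_1 = arg_cong[OF m8_0, of d, unfolded M8_1]
  note m8_2 = arg_cong[OF m8_1, of d, unfolded M8_2]
  note m10_0 = M(5)[unfolded m2_0 m4_0 m6_0 m8_0 f M10_id]
  note m10_1 = arg_cong[OF m10_0, of d, unfolded M10_1]
  note m12_0 = M(6)[unfolded m2_0 m4_0 m6_0 m8_0 m10_0 f M12_id]
  note Y2 = y(1)[unfolded f y2_id]
  note Y4 = y(2)[unfolded Y2 f y4_id]
  note Y6 = y(3)[unfolded Y2 Y4 f y6_id]
  note Y8 = y(4)[unfolded Y2 Y4 Y6 f y8_id]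
  note Y10 = y(5)[unfolded Y2 Y4 Y6 Y8 f y10_id]
  note Y12 = y(6)[unfolded Y2 Y4 Y6 Y8 Y10 f y12_id]
  have dN0: "d N0 = P * (1 + 22*X)" unfolding N0 by (rule V0_d)
  \<comment> \<open>The coefficients 3, 10, 21, 36, 55 of the leading rank moments are invertible
    modulo 23, with inverses 8, 7, 11, 16, 18.\<close>
  have "3 * N4 = P * y4 - 6 * d N0 - 36 * d N2 - (- 3) * N2"
    unfolding R4[symmetric] by (simp add: N0 algebra_simps)
  moreover have "N4 = 8 * (3 * N4)"
    by (rule eq_mod_23[of _ _ "(- 1) * N4"], simp add: algebra_simps, rule m23)
  ultimately have "N4 = 8 * (P * y4 - 6 * d N0 - 36 * d N2 - (- 3) * N2)" by simp
  note N4 = this[unfolded Y4 dN0, unfolded N4_id]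
  note dN4 = arg_cong[OF N4, of d, unfolded d_add V4_d d_numeral_mult d_one_mult]
  have "10 * N6 = P * y6 - 6 * d N0 - 90 * d N2 - 90 * d N4 - (- 5) * N2 - (- 5) * N4"
    unfolding R6[symmetric] by (simp add: N0 algebra_simps)
  moreover have "N6 = 7 * (10 * N6)"
    by (rule eq_mod_23[of _ _ "(- 3) * N6"], simp add: algebra_simps, rule m23)
  ultimately have "N6 = 7 * (P * y6 - 6 * d N0 - 90 * d N2 - 90 * d N4 - (- 5) * N2 - (- 5) * N4)" by simp
  note N6 = this[unfolded Y6 dN0 dN4, unfolded N4, unfolded N6_id]
  note dN6 = arg_cong[OF N6, of d, unfolded d_add V6_d d_numeral_mult d_one_mult]
  have "21 * N8 = P * y8 - 6 * d N0 - 168 * d N2 - 420 * d N4 - 168 * d N6 - (- 7) * N2 - (- 28) * N4 - 14 * N6"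
    unfolding R8[symmetric] by (simp add: N0 algebra_simps)
  moreover have "N8 = 11 * (21 * N8)"
    by (rule eq_mod_23[of _ _ "(- 10) * N8"], simp add: algebra_simps, rule m23)
  ultimately have "N8 = 11 * (P * y8 - 6 * d N0 - 168 * d N2 - 420 * d N4 - 168 * d N6 - (- 7) * N2 -
      (- 28) * N4 - 14 * N6)" by simp
  note N8 = this[unfolded Y8 dN0 dN4 dN6, unfolded N4 N6, unfolded N8_id]
  note dN8 = arg_cong[OF N8, of d, unfolded d_add V8_d d_numeral_mult d_one_mult]
  have "36 * N10 = P * y10 - 6 * d N0 - 270 * d N2 - 1260 * d N4 - 1260 * d N6 - 270 * d N8 - (- 9) * N2 -
      (- 75) * N4 - (- 42) * N6 - 90 * N8"
    unfolding R10[symmetric] by (simp add: N0 algebra_simps)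
  moreover have "N10 = 16 * (36 * N10)"
    by (rule eq_mod_23[of _ _ "(- 25) * N10"], simp add: algebra_simps, rule m23)
  ultimately have "N10 = 16 * (P * y10 - 6 * d N0 - 270 * d N2 - 1260 * d N4 - 1260 * d N6 - 270 * d N8 -
      (- 9) * N2 - (- 75) * N4 - (- 42) * N6 - 90 * N8)" by simp
  note N10 = this[unfolded Y10 dN0 dN4 dN6 dN8, unfolded N4 N6 N8, unfolded N10_id]
  note dN10 = arg_cong[OF N10, of d, unfolded d_add V10_d d_numeral_mult d_one_mult]
  have "55 * N12 = P * y12 - 6 * d N0 - 396 * d N2 - 2970 * d N4 - 5544 * d N6 - 2970 * d N8 - 396 * d N10 -
      (- 11) * N2 - (- 154) * N4 - (- 297) * N6 - 132 * N8 - 275 * N10"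
    unfolding R12[symmetric] by (simp add: N0 algebra_simps)
  moreover have "N12 = 18 * (55 * N12)"
    by (rule eq_mod_23[of _ _ "(- 43) * N12"], simp add: algebra_simps, rule m23)
  ultimately have "N12 = 18 * (P * y12 - 6 * d N0 - 396 * d N2 - 2970 * d N4 - 5544 * d N6 - 2970 * d N8 -
      396 * d N10 - (- 11) * N2 - (- 154) * N4 - (- 297) * N6 - 132 * N8 - 275 * N10)" by simp
  note N12 = this[unfolded Y12 dN0 dN4 dN6 dN8 dN10, unfolded N4 N6 N8 N10, unfolded N12_id]
  show ?thesis
    \<comment> \<open>Higher derivatives are replaced before lower ones, since rewriting
      \<open>M2\<close> first would destroy the term \<open>d M2\<close>.\<close>
    by (rule trans[OF _ final_identity])
      (unfold m2_5, unfold m2_4 m4_4, unfold m2_3 m4_3 m6_3, unfold m2_2 m4_2 m6_2 m8_2, unfold m2_1 m4_1 m6_1 m8_1 m10_1, unfold m2_0 m4_0 m6_0 m8_0 m10_0 m12_0 N12,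
        simp only: add.assoc)
qed

end

section \<open>Power series over the field with 23 elements\<close>

definition eta :: "int fps \<Rightarrow> 23 fps" where
  "eta f = Abs_fps (\<lambda>n. of_int (f $ n))"

lemma eta_nth [simp]: "eta f $ n = of_int (f $ n)"
  by (simp add: eta_def)

lemma eta_add: "eta (f + g) = eta f + eta g"
  and eta_diff: "eta (f - g) = eta f - eta g"
  and eta_uminus: "eta (- f) = - eta f"
  and eta_mult: "eta (f * g) = eta f * eta g"
  and eta_1: "eta 1 = 1"
  and eta_X: "eta fps_X = fps_X"
  and eta_qd: "eta (qd f) = qd (eta f)"
  by (rule fps_ext, simp add: fps_mult_nth fps_X_def)+

lemma eta_numeral: "eta (numeral k) = numeral k"
  by (rule fps_ext) (simp add: numeral_fps_const fps_const_def)

lemma eta_power: "eta (f ^ k) = eta f ^ k"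
  by (induction k) (simp_all add: eta_1 eta_mult)

lemmas eta_simps = eta_add eta_diff eta_uminus eta_mult eta_1 eta_X eta_qd eta_numeral eta_power

lemma zero_23: "(23 :: 23 fps) = 0"
  by (rule fps_ext) (simp add: numeral_fps_const fps_const_def)

lemma eq_mod_23':
  "a = b + 23 * c \<Longrightarrow> a = b" for a b c :: "23 fps"
  by (rule eq_mod_23[OF _ zero_23])

text \<open>The Frobenius map is additive on finite sums. The tail of \<open>f\<close> beyond
  \<open>n\<close> is a multiple of \<open>fps_X ^ Suc n\<close>, so its 23rd power does not reach
  the coefficient \<open>n\<close>.\<close>

lemma power_23_nth: "(f ^ 23) $ n = (if 23 dvd n then (f $ (n div 23)) ^ 23 else 0)"
  for f :: "23 fps"
proof -
  define g where "g = (\<Sum>i\<le>n. fps_const (f $ i) * fps_X ^ i)"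
  have g: "g $ i = (if i \<le> n then f $ i else 0)" for i
    by (simp add: g_def fps_sum_nth fps_X_power_nth mult_delta_right)
  have f: "f = g + fps_X ^ Suc n * fps_shift (Suc n) f"
    by (rule fps_ext) (simp add: g fps_X_power_mult_nth del: power_Suc)
  have prime: "prime CHAR(23 fps)" and char: "23 = CHAR(23 fps)" by simp_all
  have "f ^ 23 = g ^ 23 + fps_X ^ (23 * Suc n) * fps_shift (Suc n) f ^ 23"
    by (subst f, subst freshmans_dream[OF prime char])
      (simp only: power_mult_distrib power_mult[symmetric] mult.commute)
  then have "(f ^ 23) $ n = (g ^ 23) $ n"
    by (simp add: fps_X_power_mult_nth del: power_Suc)
  also have "g ^ 23 = (\<Sum>i\<le>n. fps_const ((f $ i) ^ 23) * fps_X ^ (23 * i))"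
    unfolding g_def freshmans_dream_sum[OF prime char]
    by (simp only: power_mult_distrib fps_const_power power_mult[symmetric] mult.commute)
  also have "\<dots> $ n = (\<Sum>i\<le>n. if n = 23 * i then (f $ i) ^ 23 else 0)"
    by (simp add: fps_sum_nth fps_X_power_nth if_distrib cong: if_cong)
  also have "\<dots> = (if 23 dvd n then (f $ (n div 23)) ^ 23 else 0)"
  proof (cases "23 dvd n")
    case True
    then have "(n = 23 * i) = (i = n div 23)" for i by auto
    then show ?thesis using True by simp
  next
    case False
    then show ?thesis by (auto intro!: sum.neutral)
  qed
  finally show ?thesis .
qed

lemma eta_pent_power_nth:
  "(fps_X * eta pent ^ 23) $ n =
    (if n \<noteq> 0 \<and> 23 dvd n - 1 then of_int (pent $ ((n - 1) div 23)) else 0)"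
proof -
  \<comment> \<open>The pentagonal series has coefficients -1, 0 and 1 only, which an odd power
    leaves unchanged.\<close>
  have "(of_int c :: 23) ^ 23 = of_int c" if "c \<in> {-1, 0, 1}" for c
    using that by auto
  from this[OF pent_nth_range] show ?thesis
    by (simp add: power_23_nth)
qed

definition phi :: "nat \<Rightarrow> 23 fps" where
  "phi k = eta (Phi k)"

lemmas eta_phi = eta_simps phi_def[symmetric]

text \<open>The factors 4, 10, 17 are the inverses of 6, 30, 42 modulo 23. In the same way 21 and 16
  in \<open>phi_rec\<close> are the inverses of 11 and 13.\<close>

lemma qd_phi:
  "qd (phi 1) = 4 * (phi 1 - 12 * phi 1 ^ 2 + 5 * phi 3)"
  "qd (phi 3) = 10 * (10 * phi 3 + 21 * phi 5 - 240 * phi 1 * phi 3 - phi 1)"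
  "qd (phi 5) = 17 * (phi 1 + 20 * phi 3 + 21 * phi 5 - 504 * phi 1 * phi 5 + 2400 * phi 3 ^ 2)"
proof -
  have *: "6 * qd (phi 1) = phi 1 - 12 * phi 1 ^ 2 + 5 * phi 3"
    using arg_cong[OF qd_Phi(1), of eta] unfolding eta_phi .
  show "qd (phi 1) = 4 * (phi 1 - 12 * phi 1 ^ 2 + 5 * phi 3)"
    unfolding *[symmetric] by (rule eq_mod_23'[of _ _ "- qd (phi 1)"]) simp
  have *: "30 * qd (phi 3) = 10 * phi 3 + 21 * phi 5 - 240 * phi 1 * phi 3 - phi 1"
    using arg_cong[OF qd_Phi(2), of eta] unfolding eta_phi .
  show "qd (phi 3) = 10 * (10 * phi 3 + 21 * phi 5 - 240 * phi 1 * phi 3 - phi 1)"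
    unfolding *[symmetric] by (rule eq_mod_23'[of _ _ "- 13 * qd (phi 3)"]) simp
  have *: "42 * qd (phi 5) = phi 1 + 20 * phi 3 + 21 * phi 5 - 504 * phi 1 * phi 5 + 2400 * phi 3 ^ 2"
    using arg_cong[OF qd_Phi(3), of eta] unfolding eta_phi .
  show "qd (phi 5) = 17 * (phi 1 + 20 * phi 3 + 21 * phi 5 - 504 * phi 1 * phi 5 + 2400 * phi 3 ^ 2)"
    unfolding *[symmetric] by (rule eq_mod_23'[of _ _ "- 31 * qd (phi 5)"]) simp
qed

lemma phi_rec:
  "phi 7 = phi 3 + 120 * phi 3 ^ 2"
  "phi 9 = 21 * (21 * phi 5 - 10 * phi 3 + 5040 * phi 3 * phi 5)"
  "phi 11 = 16 * (63 * phi 3 - 50 * phi 5 + 15120 * phi 3 ^ 2 + 1209600 * phi 3 ^ 3 + 12600 * phi 5 ^ 2)"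
proof -
  show "phi 7 = phi 3 + 120 * phi 3 ^ 2"
    using arg_cong[OF Phi_rec(1), of eta] unfolding eta_phi .
  have *: "11 * phi 9 = 21 * phi 5 - 10 * phi 3 + 5040 * phi 3 * phi 5"
    using arg_cong[OF Phi_rec(2), of eta] unfolding eta_phi .
  show "phi 9 = 21 * (21 * phi 5 - 10 * phi 3 + 5040 * phi 3 * phi 5)"
    unfolding *[symmetric] by (rule eq_mod_23'[of _ _ "- 10 * phi 9"]) simp
  have *: "13 * phi 11 = 63 * phi 3 - 50 * phi 5 + 15120 * phi 3 ^ 2 + 1209600 * phi 3 ^ 3 + 12600 * phi 5 ^ 2"
    using arg_cong[OF Phi_rec(3), of eta] unfolding eta_phi .
  show "phi 11 = 16 * (63 * phi 3 - 50 * phi 5 + 15120 * phi 3 ^ 2 + 1209600 * phi 3 ^ 3 + 12600 * phi 5 ^ 2)"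
    unfolding *[symmetric] by (rule eq_mod_23'[of _ _ "- 9 * phi 11"]) simp
qed

definition P23 :: "23 fps" where "P23 = eta genP"
text \<open>E2, with -24 reduced to -1; in E4 and E6 below, 240 and -504 are reduced to 10 and
  2.\<close>

definition X23 :: "23 fps" where "X23 = 1 - phi 1"
definition Y23 :: "23 fps" where "Y23 = 1 + 10 * phi 3"
definition Z23 :: "23 fps" where "Z23 = 1 + 2 * phi 5"

lemmas expand = X23_def Y23_def Z23_def algebra_simps power2_eq_square power3_eq_cube

lemma qd_mod23:
  "qd P23 = P23 + 22 * (X23 * P23)"
  "qd X23 = 2 * (X23 * X23) + 21 * Y23"
  "qd Y23 = 8 * (X23 * Y23) + 15 * Z23"
  "qd Z23 = 12 * (X23 * Z23) + 11 * (Y23 * Y23)"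
proof -
  have *: "qd P23 = phi 1 * P23"
    unfolding P23_def phi_def eta_qd[symmetric] eta_mult[symmetric] qd_genP ..
  show "qd P23 = P23 + 22 * (X23 * P23)"
    unfolding * by (rule eq_mod_23'[of _ _ "phi 1 * P23 - P23"]) (simp add: expand)
  show "qd X23 = 2 * (X23 * X23) + 21 * Y23"
    by (rule eq_mod_23'[of _ _ "- 1 + 2 * phi 1 ^ 2 - 10 * phi 3"])
      (unfold X23_def qd_diff qd_1 qd_phi, simp add: expand)
  show "qd Y23 = 8 * (X23 * Y23) + 15 * Z23"
    by (rule eq_mod_23'[of _ _ "- 1 + 40 * phi 3 + 90 * phi 5 - 1040 * phi 1 * phi 3 - 4 * phi 1"])
      (unfold Y23_def qd_add qd_mult qd_numeral qd_1 qd_phi, simp add: expand)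
  show "qd Z23 = 12 * (X23 * Z23) + 11 * (Y23 * Y23)"
    by (rule eq_mod_23'[of _ _ "- 1 + 2 * phi 1 + 20 * phi 3 + 30 * phi 5 - 744 * phi 1 * phi 5 + 3500 * phi 3 ^ 2"])
      (unfold Z23_def qd_add qd_mult qd_numeral qd_1 qd_phi, simp add: expand)
qed

interpretation mod23: qm23 qd P23 X23 Y23 Z23
  by unfold_locales (simp_all only: zero_23 qd_add qd_mult qd_mod23)

lemma phi_eqs:
  "phi 1 = 1 + 22 * X23" "phi 3 = 16 + 7 * Y23" "phi 5 = 11 + 12 * Z23" "phi 7 = 8 + 15 * (Y23 * Y23)"
  "phi 9 = 21 + 2 * (Y23 * Z23)" "phi 11 = 10 + 7 * (Z23 * Z23) + 6 * (Y23 * Y23 * Y23)"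
proof -
  show "phi 1 = 1 + 22 * X23"
    by (rule eq_mod_23'[of _ _ "phi 1 - 1"]) (simp add: expand)
  show "phi 3 = 16 + 7 * Y23"
    by (rule eq_mod_23'[of _ _ "- 1 - 3 * phi 3"]) (simp add: expand)
  show "phi 5 = 11 + 12 * Z23"
    by (rule eq_mod_23'[of _ _ "- 1 - phi 5"]) (simp add: expand)
  show "phi 7 = 8 + 15 * (Y23 * Y23)"
    by (rule eq_mod_23'[of _ _ "- 1 - 13 * phi 3 - 60 * phi 3 ^ 2"]) (unfold phi_rec, simp add: expand)
  show "phi 9 = 21 + 2 * (Y23 * Z23)"
    by (rule eq_mod_23'[of _ _ "- 1 - 10 * phi 3 + 19 * phi 5 + 4600 * phi 3 * phi 5"])
      (unfold phi_rec, simp add: expand)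
  show "phi 11 = 10 + 7 * (Z23 * Z23) + 6 * (Y23 * Y23 * Y23)"
    by (rule eq_mod_23'[of _ _ "- 1 + 36 * phi 3 - 36 * phi 5 + 10440 * phi 3 ^ 2 + 841200 * phi 3 ^ 3 + 8764 * phi 5 ^ 2"])
      (unfold phi_rec, simp add: expand)
qed

lemma P23_Delta: "P23 * (15 * (Z23 * Z23) + 8 * (Y23 * Y23 * Y23)) = fps_X * eta pent ^ 23"
proof -
  define W where "W = eta ((1 + 240 * Phi 3) ^ 3 - (1 - 504 * Phi 5)\<^sup>2)"
  \<comment> \<open>Modulo 23 the left-hand side is 8 (E4^3 - E6^2), as 15 is -8; the witness
    collects the quotients of the coefficients.\<close>
  have W: "15 * (Z23 * Z23) + 8 * (Y23 * Y23 * Y23) = 8 * W"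
    by (rule eq_mod_23'[of _ _ "(1) * 1 + (- 240) * phi 3 ^ 1 + (- 60000) * phi 3 ^ 2 +
        (- 4808000) * phi 3 ^ 3 + (- 348) * phi 5 ^ 1 + (88356) * phi 5 ^ 2"]) (simp add: W_def eta_phi expand)
  have 1: "P23 * eta pent = 1"
    unfolding P23_def eta_mult[symmetric] genP_pent eta_1 ..
  have "P23 ^ 24 * (8 * W) = 8 * eta Delta"
    by (simp only: Delta_def eta_mult eta_power P23_def W_def mult_ac)
  also have "\<dots> = fps_X"
    unfolding Delta_eq eta_simps by (rule eq_mod_23'[of _ _ "601 * fps_X"]) simp
  finally have D: "P23 ^ 24 * (8 * W) = fps_X" .
  have "P23 * (8 * W) = (P23 * eta pent) ^ 23 * (P23 * (8 * W))"
    unfolding 1 by simp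
  also have "\<dots> = P23 ^ 24 * (8 * W) * eta pent ^ 23"
    unfolding power_mult_distrib power_Suc[of P23 23, simplified] by (simp only: mult_ac)
  finally show ?thesis unfolding W D .
qed

lemma moments_mod_23:
  fixes m r :: "nat \<Rightarrow> 23 fps"
  defines "m j \<equiv> eta (mom j crank_gf)" and "r j \<equiv> eta (mom j rank_gf)"
  shows "(840 * m 2 + 60 * qd (m 2) + 116 * qd (qd (m 2)) + 60 * qd (qd (qd (m 2))) +
      8 * qd (qd (qd (qd (m 2)))) + 4 * qd (qd (qd (qd (qd (m 2)))))) + (22 * m 4 + 21 * qd (m 4) +
      8 * qd (qd (m 4)) + 2 * qd (qd (qd (m 4))) + 10 * qd (qd (qd (qd (m 4))))) + (3042 * m 6 +
      5083 * qd (m 6) + 507 * qd (qd (m 6)) + 13 * qd (qd (qd (m 6)))) + (30 * qd (m 8) +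
      5 * qd (qd (m 8))) + (285 * m 10 + 15 * qd (m 10)) + (1 * m 12) + (13406400 * r 2 +
      4312560 * qd (r 2) + 541872 * qd (qd (r 2)) + 33348 * qd (qd (qd (r 2))) +
      1008 * qd (qd (qd (qd (r 2)))) + 12 * qd (qd (qd (qd (qd (r 2)))))) + r 12 = fps_X * eta pent ^ 23"
proof -
  define y2 where "y2 = 6 * Phi 1"
  define y4 where "y4 = 18 * (Phi 1 * y2) + 6 * Phi 3"
  define y6 where "y6 = 30 * (Phi 1 * y4) + 60 * (Phi 3 * y2) + 6 * Phi 5"
  define y8 where "y8 = 42 * (Phi 1 * y6) + 210 * (Phi 3 * y4) + 126 * (Phi 5 * y2) + 6 * Phi 7"
  define y10 where "y10 = 54 * (Phi 1 * y8) + 504 * (Phi 3 * y6) + 756 * (Phi 5 * y4) + 216 * (Phi 7 * y2) + 6 * Phi 9"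
  define y12 where "y12 = 66 * (Phi 1 * y10) + 990 * (Phi 3 * y8) + 2772 * (Phi 5 * y6) +
      1980 * (Phi 7 * y4) + 330 * (Phi 9 * y2) + 6 * Phi 11"
  have c0: "mom 0 crank3 = genP ^ 3"
    by (simp add: mom_0 ev1_crank3)
  have c2: "mom 2 crank3 = genP ^ 3 * y2"
    unfolding crank3_rec(1) c0 y2_def by (simp add: algebra_simps)
  have c4: "mom 4 crank3 = genP ^ 3 * y4"
    unfolding crank3_rec(2) c0 c2 y4_def by (simp add: algebra_simps)
  have c6: "mom 6 crank3 = genP ^ 3 * y6"
    unfolding crank3_rec(3) c0 c2 c4 y6_def by (simp add: algebra_simps)
  have c8: "mom 8 crank3 = genP ^ 3 * y8"
    unfolding crank3_rec(4) c0 c2 c4 c6 y8_def by (simp add: algebra_simps)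
  have c10: "mom 10 crank3 = genP ^ 3 * y10"
    unfolding crank3_rec(5) c0 c2 c4 c6 c8 y10_def by (simp add: algebra_simps)
  have c12: "mom 12 crank3 = genP ^ 3 * y12"
    unfolding crank3_rec(6) c0 c2 c4 c6 c8 c10 y12_def by (simp add: algebra_simps)
  \<comment> \<open>The rank-crank equation carries \<open>genP\<^sup>2\<close> on the side of the
    rank and \<open>genP ^ 3\<close> on that of the crank. Cancelling leaves the single factor
    \<open>P\<close> in the hypotheses of \<open>combination\<close>.\<close>
  have cancel: "P23 * eta y = eta A" if "genP ^ 3 * y = genP\<^sup>2 * A" for y A
  proof -
    have "genP\<^sup>2 * (genP * y) = genP\<^sup>2 * A"
      using that by (simp add: power2_eq_square power3_eq_cube mult.assoc)
    moreover have "genP \<noteq> 0" using genP_pent by auto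
    ultimately have "genP * y = A" by simp
    then show ?thesis by (auto simp: P23_def eta_mult)
  qed
  have "r 0 = P23" by (simp add: r_def P23_def mom_0 ev1_rank_gf)
  note M = crank_rec[THEN arg_cong[of _ _ eta], unfolded eta_phi mom_0 ev1_crank_gf P23_def[symmetric] m_def[symmetric]]
  note R = cancel[OF rank_rec(1)[unfolded c4], unfolded eta_phi r_def[symmetric], symmetric]
    cancel[OF rank_rec(2)[unfolded c6], unfolded eta_phi r_def[symmetric], symmetric]
    cancel[OF rank_rec(3)[unfolded c8], unfolded eta_phi r_def[symmetric], symmetric]
    cancel[OF rank_rec(4)[unfolded c10], unfolded eta_phi r_def[symmetric], symmetric]
    cancel[OF rank_rec(5)[unfolded c12], unfolded eta_phi r_def[symmetric], symmetric]
  note y = y2_def y4_def y6_def y8_def y10_def y12_def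
  from mod23.combination[OF phi_eqs M y[THEN arg_cong[of _ _ eta], unfolded eta_phi] \<open>r 0 = P23\<close> R]
  show ?thesis unfolding P23_Delta .
qed

lemma moments_mod_23_nth:
  fixes n :: nat
  defines "x \<equiv> int n"
  shows "(of_int ((840 * crank_moment 2 n + 60 * (x * crank_moment 2 n) +
      116 * (x * (x * crank_moment 2 n)) + 60 * (x * (x * (x * crank_moment 2 n))) +
      8 * (x * (x * (x * (x * crank_moment 2 n)))) + 4 * (x * (x * (x * (x * (x * crank_moment 2 n)))))) +
      (22 * crank_moment 4 n + 21 * (x * crank_moment 4 n) + 8 * (x * (x * crank_moment 4 n)) +
      2 * (x * (x * (x * crank_moment 4 n))) + 10 * (x * (x * (x * (x * crank_moment 4 n))))) +
      (3042 * crank_moment 6 n + 5083 * (x * crank_moment 6 n) + 507 * (x * (x * crank_moment 6 n)) +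
      13 * (x * (x * (x * crank_moment 6 n)))) + (30 * (x * crank_moment 8 n) +
      5 * (x * (x * crank_moment 8 n))) + (285 * crank_moment 10 n + 15 * (x * crank_moment 10 n)) +
      (1 * crank_moment 12 n) + (13406400 * rank_moment 2 n + 4312560 * (x * rank_moment 2 n) +
      541872 * (x * (x * rank_moment 2 n)) + 33348 * (x * (x * (x * rank_moment 2 n))) +
      1008 * (x * (x * (x * (x * rank_moment 2 n)))) + 12 * (x * (x * (x * (x * (x * rank_moment 2 n)))))) +
      rank_moment 12 n) :: 23) = (fps_X * eta pent ^ 23) $ n"
  unfolding moments_mod_23[symmetric] x_def
  by (simp add: numeral_fps_mult_nth mom_crank_gf mom_rank_gf)

theorem theorem6p2:
  fixes n :: nat
  shows
    "let A =
        int (4 * (n^2 + n + 14) * (n^3 + n^2 + 15)) * crank_moment 2 n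
      + int (10 * n^4 + 2 * n^3 + 8 * n^2 + 21 * n + 22) * crank_moment 4 n
      + int (13 * (n + 18) * (n^2 + 21 * n + 13)) * crank_moment 6 n
      + int (5 * n * (n + 6)) * crank_moment 8 n
      + int (15 * (n + 19)) * crank_moment 10 n
      + crank_moment 12 n
      + int (12 * (n + 10) * (n + 14) * (n + 19) * (n + 20) * (n + 21)) * rank_moment 2 n
      + rank_moment 12 n
     in (\<forall>k::int. \<forall>s::int. s \<in> {1, -1} \<longrightarrow> int n = (23 * k * (3 * k + s)) div 2 + 1
            \<longrightarrow> [A = (-1) ^ nat \<bar>k\<bar>] (mod 23))
      \<and> ((\<nexists>k::int. \<exists>s::int. s \<in> {1, -1} \<and> int n = (23 * k * (3 * k + s)) div 2 + 1)
            \<longrightarrow> [A = 0] (mod 23))"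
proof -
  define A where "A = int (4 * (n^2 + n + 14) * (n^3 + n^2 + 15)) * crank_moment 2 n + int (10 * n^4 +
      2 * n^3 + 8 * n^2 + 21 * n + 22) * crank_moment 4 n + int (13 * (n + 18) * (n^2 + 21 * n +
      13)) * crank_moment 6 n + int (5 * n * (n + 6)) * crank_moment 8 n + int (15 * (n +
      19)) * crank_moment 10 n + crank_moment 12 n + int (12 * (n + 10) * (n + 14) * (n + 19) * (n +
      20) * (n + 21)) * rank_moment 2 n + rank_moment 12 n"
  define x where "x = int n"
  \<comment> \<open>Each power of \<open>n\<close> is written as an iterated multiplication, the
    shape that iterating \<open>qd\<close> gives to a coefficient.\<close>
  have A: "A = (840 * crank_moment 2 n + 60 * (x * crank_moment 2 n) + 116 * (x * (x * crank_moment 2 n)) +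
      60 * (x * (x * (x * crank_moment 2 n))) + 8 * (x * (x * (x * (x * crank_moment 2 n)))) +
      4 * (x * (x * (x * (x * (x * crank_moment 2 n)))))) + (22 * crank_moment 4 n +
      21 * (x * crank_moment 4 n) + 8 * (x * (x * crank_moment 4 n)) +
      2 * (x * (x * (x * crank_moment 4 n))) + 10 * (x * (x * (x * (x * crank_moment 4 n))))) +
      (3042 * crank_moment 6 n + 5083 * (x * crank_moment 6 n) + 507 * (x * (x * crank_moment 6 n)) +
      13 * (x * (x * (x * crank_moment 6 n)))) + (30 * (x * crank_moment 8 n) +
      5 * (x * (x * crank_moment 8 n))) + (285 * crank_moment 10 n + 15 * (x * crank_moment 10 n)) +
      (1 * crank_moment 12 n) + (13406400 * rank_moment 2 n + 4312560 * (x * rank_moment 2 n) +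
      541872 * (x * (x * rank_moment 2 n)) + 33348 * (x * (x * (x * rank_moment 2 n))) +
      1008 * (x * (x * (x * (x * rank_moment 2 n)))) + 12 * (x * (x * (x * (x * (x * rank_moment 2 n)))))) +
      rank_moment 12 n"
    unfolding A_def x_def by (simp add: algebra_simps power2_eq_square power3_eq_cube power4_eq_xxxx)
  have A23: "(of_int A :: 23) = (if n \<noteq> 0 \<and> 23 dvd n - 1 then of_int (pent $ ((n - 1) div 23)) else 0)"
    unfolding A x_def moments_mod_23_nth eta_pent_power_nth ..
  have cong: "[A = B] (mod 23)" if "(of_int A :: 23) = of_int B" for B
    using that of_int_eq_iff_cong_CHAR[where 'a = 23, of A B] by simp
  \<comment> \<open>Both divisions by 2 are exact, as \<open>k * (3 * k + s)\<close> is even. It is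
    also nonnegative, and \<open>n \<noteq> 0\<close> guards the truncated subtraction in
    \<open>n - 1\<close>.\<close>
  have n: "int n = (23 * k * (3 * k + s)) div 2 + 1 \<longleftrightarrow>
      n \<noteq> 0 \<and> 23 dvd n - 1 \<and> int ((n - 1) div 23) = (k * (3 * k + s)) div 2"
    if s: "s \<in> {1, -1}" for k s :: int
  proof -
    have "even (k * (3 * k + s))" using s by auto
    then obtain t where t: "k * (3 * k + s) = 2 * t" by blast
    have "t \<ge> 0"
    proof -
      have "k * (3 * k + s) = 3 * k\<^sup>2 + s * k" by (simp add: algebra_simps power2_eq_square)
      moreover have "\<bar>k\<bar> \<le> k\<^sup>2"
        using mult_left_mono[of 1 "\<bar>k\<bar>" "\<bar>k\<bar>"] by (cases "k = 0") (auto simp: power2_eq_square)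
      ultimately show ?thesis using s t by auto
    qed
    have "23 * k * (3 * k + s) = 2 * (23 * t)" using t by (simp add: mult.assoc)
    then have "(23 * k * (3 * k + s)) div 2 = 23 * t" "(k * (3 * k + s)) div 2 = t"
      using t by simp_all
    moreover obtain u where u: "t = int u" using \<open>t \<ge> 0\<close> nonneg_int_cases by blast
    have "n = 23 * u + 1 \<longleftrightarrow> n \<noteq> 0 \<and> 23 dvd n - 1 \<and> (n - 1) div 23 = u"
      by (cases n) auto
    moreover have "int n = 23 * int u + 1 \<longleftrightarrow> n = 23 * u + 1" by linarith
    ultimately show ?thesis unfolding u by simp
  qed
  have 1: "[A = (-1) ^ nat \<bar>k\<bar>] (mod 23)"
    if s: "s \<in> {1, -1}" and k: "int n = (23 * k * (3 * k + s)) div 2 + 1" for k s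
  proof (rule cong)
    have "pent $ ((n - 1) div 23) = (-1) ^ nat \<bar>k\<bar>"
      using k unfolding n[OF s] by (intro pent_nth[OF s]) blast
    then show "(of_int A :: 23) = of_int ((-1) ^ nat \<bar>k\<bar>)"
      using k unfolding n[OF s] A23 by simp
  qed
  have 2: "[A = 0] (mod 23)"
    if no: "\<nexists>k::int. \<exists>s::int. s \<in> {1, -1} \<and> int n = (23 * k * (3 * k + s)) div 2 + 1"
  proof (rule cong)
    have "pent $ ((n - 1) div 23) = 0" if "n \<noteq> 0 \<and> 23 dvd n - 1"
      using pent_nth_cases[of "(n - 1) div 23"] no n that by metis
    then show "(of_int A :: 23) = of_int 0"
      unfolding A23 by auto
  qed
  show ?thesis
    using 1 2 unfolding Let_def A_def by blast
qed

end
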